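(* Let $a_1,\dots,a_N$ be nonzero complex numbers with pairwise distinct arguments. The class $\mathcal{M}'$, the region $U_\delta$, the contour $\Gamma_\epsilon$ and the symbol $\oint_0^\infty$ are defined in the context. (i) Let $f(z)=\sum_{k=0}^\infty c_k z^k$ be a power series with positive, finite radius of convergence, and suppose that $$c_k=\sum_{j=1}^N a_j^{-k}\oint_0^\infty e^{-kp}F_j(p)\,dp\qquad (k\ge 1),$$ where, for some $\delta>0$, each $F_j$ is analytic in $U_\delta\setminus[0,\infty)$ and algebraically bounded at $\infty$. Then $f$ is given by $$f(z)=f(0)+z\oint_0^\infty \sum_{j=1}^N\frac{F_j(\ln(1+s))}{(1+s)\left((1+s)a_j-z\right)}\,ds .$$ (ii) Furthermore, under the hypotheses of (i), $f\in\mathcal{M}'$ (i.e. $f$ continues analytically to an element of $\mathcal{M}'$). The behavior of $f$ at $a_j$ is of the same type as the behavior of $F_j(\ln(1+s))$ at $s=0$. More precisely, for each $j$ and for small $z\notin[0,\infty)$, $$f(a_j(z+1))=2\pi i\,F_j(\ln(1+z))+G(z),$$ where $G$ (depending on $j$) is analytic at $0$. (iii) Conversely, assume that $f\in\mathcal{M}'$ has finitely many singularities, located at the points $a_jt_{j,l}$ ($1\le j\le N$, $l\ge 1$), with $t_{j,1}=1$ and $t_{j,l}<t_{j,l+1}$ for all $j,l$. Let $c_k=f^{(k)}(0)/k!$. Then the $c_k$ have Borel sum-like representations of the form $$c_k=\frac{1}{2\pi i}\sum_{j=1}^N a_j^{-k}\oint_0^\infty e^{-ks}f(a_je^s)\,ds\qquad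 (k\ge 1).$$
   Context: Class $\mathcal{M}'$ (relative to $a_1,\dots,a_N$): $\mathcal{M}$ is the set of functions analytic in $\mathbb{C}\setminus\bigcup_{j=1}^N\{a_jt: t\ge 1\}$ and algebraically bounded at $\infty$, i.e. $|f(z)|\le C|z|^m$ for some $C,m$ and all $z$ in this domain with $|z|$ large. $\mathcal{M}'=\{f\in\mathcal{M}: f(z)=o(z)\text{ as } z\to\infty\}$. Region: for $\delta>0$, $U_\delta=\{z\in\mathbb{C}: |\operatorname{Im} z|\le\delta,\ \operatorname{Re} z\ge-\delta\}$. A function $F$ on $U_\delta\setminus[0,\infty)$ is algebraically bounded at $\infty$ if $|F(p)|\le C|p|^m$ for some $C,m$ and all $p\in U_\delta\setminus[0,\infty)$ with $|p|$ large. Contour: for $0<\epsilon\le\delta$, $\Gamma_\epsilon$ is the contour around $[0,\infty)$ consisting of the ray $\{x-i\epsilon:x\in[0,\infty)\}$ oriented towards the left, followed by the left semicircle of radius $\epsilon$ centered at the origin, from $-i\epsilon$ to $i\epsilon$, oriented clockwise, followed by the ray $\{x+i\epsilon:x\in[0,\infty)\}$ oriented towards the right. If $g$ is analytic in $U_\delta\setminus[0,\infty)$ for some $\delta>0$ and $g(s)\to0$ uniformly in $U_\delta$ as $\operatorname{Re}s\to\infty$, then $\oint_0^\infty g(s)\,ds$ denotes the integral of $g$ over $\Gamma_\epsilon$, which is independent of $\epsilon$ for $\epsilon$ small enough. In the formula of (i), $z\in\mathbb{C}\setminus\bigcup_j\{a_jt:t\ge1\}$ and $\epsilon$ is taken small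 enough (depending on $z$) that none of the points $s=z/a_j-1$ lies on or inside $\Gamma_\epsilon$ (on the side containing $[0,\infty)$). $\ln(1+s)$ is the principal branch, with cut $(-\infty,-1]$.
   Formalization: In (iii) with k=1 the separate integrals can diverge (a=±1, f=z(Log(1+z)−Log(1−z))/(Log(1−z)+10i)); the termwise formula is proved for k≥2, and for k=1 when they converge; for all k≥1 it is proved with the sum over j inside the integral, cut off at a common Re s. *)

theory Defs
  imports "HOL-Complex_Analysis.Complex_Analysis" "HOL-Library.Landau_Symbols"
begin

definition cuts :: "(nat \<Rightarrow> complex) \<Rightarrow> nat \<Rightarrow> complex set" where
  "cuts a N = (\<Union>j\<in>{1..N}. {a j * of_real t |t::real. t \<ge> 1})"

definition cut_plane :: "(nat \<Rightarrow> complex) \<Rightarrow> nat \<Rightarrow> complex set" where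
  "cut_plane a N = - cuts a N"

definition algebraically_bounded_on :: "complex set \<Rightarrow> (complex \<Rightarrow> complex) \<Rightarrow> bool" where
  "algebraically_bounded_on D f \<longleftrightarrow>
     (\<exists>(C::real) (m::nat) (R::real). \<forall>z\<in>D. norm z \<ge> R \<longrightarrow> norm (f z) \<le> C * norm z ^ m)"

definition class_M :: "(nat \<Rightarrow> complex) \<Rightarrow> nat \<Rightarrow> (complex \<Rightarrow> complex) set" where
  "class_M a N =
     {f. f analytic_on cut_plane a N \<and> algebraically_bounded_on (cut_plane a N) f}"

text \<open>The limit at infinity is taken inside the cut plane, uniformly up to the cuts; the values
  of a representative \<open>f\<close> on the cuts are irrelevant.\<close>

definition class_M' :: "(nat \<Rightarrow> complex) \<Rightarrow> nat \<Rightarrow> (complex \<Rightarrow> complex) set" where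
  "class_M' a N =
     {f \<in> class_M a N. f \<in> o[inf at_infinity (principal (cut_plane a N))](\<lambda>z. z)}"

definition half_strip :: "real \<Rightarrow> complex set" where
  "half_strip \<delta> = {z. \<bar>Im z\<bar> \<le> \<delta> \<and> Re z \<ge> - \<delta>}"

text \<open>The contour \<open>\<Gamma>\<^sub>\<epsilon>\<close> truncated at real part \<open>R\<close>. The middle piece runs through the angles from
  \<open>3 * pi / 2\<close> down to \<open>pi / 2\<close>, i.e. clockwise along the left semicircle.\<close>

definition loop_contour :: "real \<Rightarrow> real \<Rightarrow> real \<Rightarrow> complex" where
  "loop_contour \<epsilon> R =
     linepath (Complex R (- \<epsilon>)) (Complex 0 (- \<epsilon>)) +++
     part_circlepath 0 \<epsilon> (3 * pi / 2) (pi / 2) +++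
     linepath (Complex 0 \<epsilon>) (Complex R \<epsilon>)"

text \<open>The improper integral over \<open>\<Gamma>\<^sub>\<epsilon>\<close> cuts both rays off at the same real part: the integrals over
  the two rays need not converge separately for integrands that merely tend to zero.\<close>

definition has_loop_integral_at ::
  "(complex \<Rightarrow> complex) \<Rightarrow> real \<Rightarrow> complex \<Rightarrow> bool" where
  "has_loop_integral_at g \<epsilon> I \<longleftrightarrow>
     (\<forall>\<^sub>F R in at_top. g contour_integrable_on loop_contour \<epsilon> R) \<and>
     ((\<lambda>R. contour_integral (loop_contour \<epsilon> R) g) \<longlongrightarrow> I) at_top"

text \<open>The loop integral of \<open>g\<close> around \<open>[0,\<infinity>)\<close> is the common value of its integrals over
  \<open>\<Gamma>\<^sub>\<epsilon>\<close> for all sufficiently small \<open>\<epsilon> > 0\<close>.\<close>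

definition has_loop_integral :: "(complex \<Rightarrow> complex) \<Rightarrow> complex \<Rightarrow> bool"
    (infixr "has'_loop'_integral" 50) where
  "g has_loop_integral I \<longleftrightarrow> (\<forall>\<^sub>F \<epsilon> in at_right 0. has_loop_integral_at g \<epsilon> I)"

lemma has_loop_integral_unique:
  assumes "g has_loop_integral I" "g has_loop_integral J"
  shows "I = J"
proof -
  have "\<forall>\<^sub>F \<epsilon> in at_right (0::real). I = J"
    using assms[unfolded has_loop_integral_def]
  proof eventually_elim
    case (elim \<epsilon>)
    then show ?case
      unfolding has_loop_integral_at_def using tendsto_unique[OF trivial_limit_at_top_linorder] by blast
  qed
  then show ?thesis by simp
qed

definition loop_integrable :: "(complex \<Rightarrow> complex) \<Rightarrow> bool" where
  "loop_integrable g \<longleftrightarrow> (\<exists>I. g has_loop_integral I)"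

definition loop_integral :: "(complex \<Rightarrow> complex) \<Rightarrow> complex" where
  "loop_integral g = (THE I. g has_loop_integral I)"

text \<open>At a point \<open>w\<close> of a cut, \<open>f\<close> is regular if its restriction to either side of the cut continues
  analytically to a full neighbourhood of \<open>w\<close>. The two continuations may differ (e.g. at
  \<open>w = 2\<close> for \<open>f z = Ln (1 - z)\<close>), so that points in the interior of a branch cut
  do not count as singularities. At the endpoint of a cut they necessarily agree.\<close>

definition regular_on_cut_at :: "(complex \<Rightarrow> complex) \<Rightarrow> complex \<Rightarrow> bool" where
  "regular_on_cut_at f w \<longleftrightarrow>
     (\<exists>r>0. \<exists>g. g analytic_on ball w r \<and> (\<forall>z\<in>ball w r. Im (z / w) > 0 \<longrightarrow> g z = f z)) \<and>
     (\<exists>r>0. \<exists>g. g analytic_on ball w r \<and> (\<forall>z\<in>ball w r. Im (z / w) < 0 \<longrightarrow> g z = f z))"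

definition singularities ::
  "(nat \<Rightarrow> complex) \<Rightarrow> nat \<Rightarrow> (complex \<Rightarrow> complex) \<Rightarrow> complex set" where
  "singularities a N f = {w \<in> cuts a N. \<not> regular_on_cut_at f w}"

end

theory Submission
  imports Defs
begin

text \<open>In the variable \<open>p\<close> every contour lies in a strip around \<open>[0,\<infinity>)\<close> slit along that half-line,
  which is a starlike domain. Holomorphic integrands therefore have primitives there, and a loop
  integral is the limit of the increments of a primitive across the slit; as long as the integrand
  tends to zero at the right end, this limit does not depend on \<open>\<epsilon>\<close> and survives the substitution
  \<open>s = exp p - 1\<close>.

  For the direct part, summing geometric series gives \<open>f z = c\<^sub>0 + (\<Sum>j. w\<^sub>j * H\<^sub>j w\<^sub>j)\<close> with
  \<open>w\<^sub>j = z / a\<^sub>j\<close> and \<open>H\<^sub>j w\<close> the loop integral of \<open>F\<^sub>j p / (exp p - w)\<close>. Moving \<open>w\<close> across a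
  contour of fixed width produces the residue term \<open>2 \<pi> \<i> F\<^sub>j (Ln w)\<close>. This yields both the
  behaviour at \<open>w = 1\<close> and the growth up to the cut, where one of two contours of different widths
  always stays at an angle from \<open>w\<close>.

  For the converse, \<open>f z / z ^ Suc k - c\<^sub>k / z\<close> has a primitive on the punctured cut plane, which is
  starlike apart from the puncture. In the variable \<open>Ln z\<close> the sum of the loop integrals is the
  monodromy \<open>2 \<pi> \<i> c\<^sub>k\<close> of a primitive, up to its increments between neighbouring cuts, which vanish
  in the limit because \<open>f z = o(z)\<close>.\<close>

section \<open>Primitives and contours in the slit strip\<close>

text \<open>The difficulty is uniformity near the cuts: as \<open>w\<close> approaches a cut, the
  contour must shrink and every estimate along it degenerates. Contours of fixed width are therefore
  studied as objects of their own (\<open>cauchy_loop\<close>); they are differentiable off the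
  image of the contour, on the cut as well, and \<open>cauchy_transform\<close> is compared with
  them through an explicit residue.

  The exponents divide up the decay of the kernel. Algebraic growth of \<open>F j\<close> is relaxed
  to \<open>exp (Re p / 4)\<close>, a power of \<open>norm (exp p)\<close>; a kernel decaying like
  \<open>exp (- (3 / 4) * Re p)\<close> then leaves \<open>exp (- Re p / 2)\<close> to integrate.
  Since \<open>1 / (exp p - w)\<close> decays like \<open>exp (- Re p)\<close>, a factor
  \<open>norm w powr (- (1 / 4))\<close> can be taken out of it, and \<open>w * H w\<close> grows at
  most like \<open>norm w powr (3 / 4)\<close>.

  The ends of truncated contours do not match after a change of width, after the logarithm, or when
  the \<open>a j\<close> differ in modulus. They stay within bounded distance, and a primitive of a
  function that tends to zero has vanishing increments over bounded distances, so no contour has to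
  be deformed.\<close>

definition slit :: "real \<Rightarrow> complex set" where
  "slit d = {p. \<bar>Im p\<bar> < d \<and> - d < Re p} - \<real>\<^sub>\<ge>\<^sub>0"

text \<open>The trace of the untruncated contour. Bounds stated on it hold for all truncations at
  once.\<close>

definition loop_set :: "real \<Rightarrow> complex set" where
  "loop_set e = {p. (0 \<le> Re p \<and> \<bar>Im p\<bar> = e) \<or> (Re p \<le> 0 \<and> norm p = e)}"

lemma slit_mono: "d \<le> d' \<Longrightarrow> slit d \<subseteq> slit d'"
  by (auto simp: slit_def)

lemma open_slit: "open (slit d)"
proof -
  have "open ({p. \<bar>Im p\<bar> < d} \<inter> {p. - d < Re p})"
    by (intro open_Int open_Collect_less continuous_intros)
  then show ?thesis
    unfolding slit_def by (auto intro!: open_Diff simp: Collect_conj_eq)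
qed

text \<open>Seen from the negative point \<open>- d / 2\<close>, the removed half-line hides
  nothing: at parameter \<open>u\<close> the imaginary part is \<open>u * Im p\<close>, so a segment
  meets the real axis away from its start only if \<open>p\<close> is real, hence negative, and then
  the whole segment is negative.\<close>

lemma starlike_slit:
  assumes "0 < d"
  shows "starlike (slit d)"
  unfolding starlike_def
proof (intro bexI ballI)
  let ?a = "complex_of_real (- d / 2)"
  show a: "?a \<in> slit d"
    using assms by (auto simp: slit_def complex_nonneg_Reals_iff)
  fix p assume p: "p \<in> slit d"
  have cv: "convex ({p. Im p < d} \<inter> {p. - d < Im p} \<inter> {p. - d < Re p})"
    by (intro convex_Int convex_halfspace_Im_lt convex_halfspace_Im_gt convex_halfspace_Re_gt)
  have "closed_segment ?a p \<subseteq> {p. Im p < d} \<inter> {p. - d < Im p} \<inter> {p. - d < Re p}"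
    using p a by (intro closed_segment_subset[OF _ _ cv]) (auto simp: slit_def)
  moreover have "x \<notin> \<real>\<^sub>\<ge>\<^sub>0" if x: "x \<in> closed_segment ?a p" for x
  proof
    assume nn: "x \<in> \<real>\<^sub>\<ge>\<^sub>0"
    obtain u where u: "0 \<le> u" "u \<le> 1" "x = (1 - u) *\<^sub>R ?a + u *\<^sub>R p"
      using x by (auto simp: in_segment)
    have 1: "u * Im p = 0" and 2: "0 \<le> (1 - u) * (- d / 2) + u * Re p"
      using nn unfolding u complex_nonneg_Reals_iff by auto
    show False
    proof (cases "u = 0")
      case True then show ?thesis using 2 assms by simp
    next
      case False
      then have "Im p = 0" using 1 by simp
      then have "Re p < 0" using p by (auto simp: slit_def complex_nonneg_Reals_iff)
      then have "u * Re p < 0" using False u by (simp add: mult_pos_neg)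
      moreover have "(1 - u) * (- d / 2) \<le> 0"
        using u assms by (simp add: mult_le_0_iff)
      ultimately show False using 2 by linarith
    qed
  qed
  ultimately show "closed_segment ?a p \<subseteq> slit d" unfolding slit_def abs_less_iff by fastforce
qed

lemma slit_primitive:
  assumes "0 < d" "g holomorphic_on slit d"
  obtains \<Phi> where "\<And>p. p \<in> slit d \<Longrightarrow> (\<Phi> has_field_derivative g p) (at p)"
  using holomorphic_starlike_primitive[OF holomorphic_on_imp_continuous_on[OF assms(2)]
      starlike_slit[OF assms(1)] open_slit finite.emptyI] assms(2) open_slit
  by (auto simp: holomorphic_on_open field_differentiable_def)

lemma loop_set_subset_slit:
  assumes "0 < e" "e < d"
  shows "loop_set e \<subseteq> slit d"
proof
  fix p assume p: "p \<in> loop_set e"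
  show "p \<in> slit d"
  proof (cases "0 \<le> Re p \<and> \<bar>Im p\<bar> = e")
    case True
    then show ?thesis using assms by (auto simp: slit_def complex_nonneg_Reals_iff)
  next
    case False
    then have *: "Re p \<le> 0" "norm p = e" using p by (auto simp: loop_set_def)
    then have "\<bar>Im p\<bar> < d" "- d < Re p"
      using abs_Im_le_cmod[of p] abs_Re_le_cmod[of p] assms by auto
    moreover have "p \<notin> \<real>\<^sub>\<ge>\<^sub>0" 
      using * assms by (auto elim!: nonneg_Reals_cases)
    ultimately show ?thesis by (auto simp: slit_def)
  qed
qed

lemma Re_loop_set_ge: "p \<in> loop_set e \<Longrightarrow> 0 < e \<Longrightarrow> - e \<le> Re p"
  using abs_Re_le_cmod[of p] by (auto simp: loop_set_def)

lemma closed_loop_set: "closed (loop_set e)"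
proof -
  have "loop_set e = ({p. 0 \<le> Re p} \<inter> {p. \<bar>Im p\<bar> = e}) \<union> ({p. Re p \<le> 0} \<inter> {p. norm p = e})"
    by (auto simp: loop_set_def)
  then show ?thesis
    by (auto intro!: closed_Un closed_Int closed_Collect_le closed_Collect_eq continuous_intros)
qed

lemma ray_subset_loop_set:
  assumes "0 \<le> x" "0 \<le> x'" "\<bar>y\<bar> = e"
  shows "closed_segment (Complex x y) (Complex x' y) \<subseteq> loop_set e"
proof
  fix p assume "p \<in> closed_segment (Complex x y) (Complex x' y)"
  then obtain u where u: "0 \<le> u" "u \<le> 1" "p = (1 - u) *\<^sub>R Complex x y + u *\<^sub>R Complex x' y"
    by (auto simp: in_segment)
  then have "Im p = (1 - u) * y + u * y" "Re p = (1 - u) * x + u * x'" by auto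
  then have "Im p = y" "Re p = (1 - u) * x + u * x'" by (auto simp: algebra_simps)
  then show "p \<in> loop_set e" using assms u by (auto simp: loop_set_def)
qed

lemma arc_subset_loop_set:
  assumes "0 < e"
  shows "path_image (part_circlepath 0 e (3 * pi / 2) (pi / 2)) \<subseteq> loop_set e"
proof -
  have "e * cos x \<le> 0" if "pi / 2 \<le> x" "x \<le> 3 * pi / 2" for x
  proof -
    have "cos x = - cos (x - pi)" by simp
    moreover have "0 \<le> cos (x - pi)" using that by (intro cos_ge_zero) auto
    ultimately show ?thesis using assms by (simp add: mult_le_0_iff)
  qed
  then show ?thesis using assms
    unfolding path_image_part_circlepath' closed_segment_eq_real_ivl
    by (auto simp: loop_set_def norm_mult)
qed

lemma arc_ends:
  "pathstart (part_circlepath 0 e (3 * pi / 2) (pi / 2)) = Complex 0 (- e)"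
  "pathfinish (part_circlepath 0 e (3 * pi / 2) (pi / 2)) = Complex 0 e"
proof -
  have "pathstart (part_circlepath 0 e (3 * pi / 2) (pi / 2)) = e * cis (3 / 2 * pi)"
    by (simp add: pathstart_def pathfinish_def part_circlepath_def linepath_def cis_conv_exp del: pathstart_part_circlepath pathfinish_part_circlepath)
  also have "\<dots> = Complex 0 (- e)"
    using cos_3over2_pi sin_3over2_pi by (simp add: complex_eq_iff)
  finally show "pathstart (part_circlepath 0 e (3 * pi / 2) (pi / 2)) = Complex 0 (- e)" .
  have "pathfinish (part_circlepath 0 e (3 * pi / 2) (pi / 2)) = e * cis (pi / 2)"
    by (simp add: pathstart_def pathfinish_def part_circlepath_def linepath_def cis_conv_exp del: pathstart_part_circlepath pathfinish_part_circlepath)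
  then show "pathfinish (part_circlepath 0 e (3 * pi / 2) (pi / 2)) = Complex 0 e"
    by (simp add: complex_eq_iff)
qed

lemma valid_path_loop_contour: "valid_path (loop_contour e R)"
  and pathstart_loop_contour: "pathstart (loop_contour e R) = Complex R (- e)"
  and pathfinish_loop_contour: "pathfinish (loop_contour e R) = Complex R e"
proof -
  show "valid_path (loop_contour e R)"
    unfolding loop_contour_def
    by (intro valid_path_join valid_path_linepath valid_path_part_circlepath) (simp_all add: arc_ends del: pathstart_part_circlepath pathfinish_part_circlepath)
qed (simp_all add: loop_contour_def)

lemma path_image_loop_contour:
  assumes "0 < e" "0 \<le> R"
  shows "path_image (loop_contour e R) \<subseteq> loop_set e"
proof -
  have "path_image (loop_contour e R) \<subseteq> closed_segment (Complex R (- e)) (Complex 0 (- e)) \<union>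
      (path_image (part_circlepath 0 e (3 * pi / 2) (pi / 2)) \<union>
        closed_segment (Complex 0 e) (Complex R e))"
    unfolding loop_contour_def
    by (intro order_trans[OF path_image_join_subset] Un_mono) auto
  then show ?thesis
    using ray_subset_loop_set[of R 0 "- e" e] ray_subset_loop_set[of 0 R e e]
      arc_subset_loop_set[of e] assms by auto
qed

lemma loop_contour_primitive:
  assumes "\<And>p. p \<in> S \<Longrightarrow> (\<Phi> has_field_derivative g p) (at p)" "loop_set e \<subseteq> S" "0 < e" "0 \<le> R"
  shows "(g has_contour_integral (\<Phi> (Complex R e) - \<Phi> (Complex R (- e)))) (loop_contour e R)"
  using contour_integral_primitive[of S \<Phi> g "loop_contour e R"] assms path_image_loop_contour[of e R]
  by (auto simp: valid_path_loop_contour pathstart_loop_contour pathfinish_loop_contour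
      intro: has_field_derivative_at_within)

section \<open>Exponentially decaying integrands: existence and size of the integral\<close>

text \<open>Comparison with the integral of \<open>B * exp (- t / 2)\<close> from \<open>x\<close>
  to infinity. Since \<open>x'\<close> does not enter, the bound serves as a Cauchy estimate for
  large \<open>x\<close> and as a total bound for \<open>x = 0\<close>.\<close>

lemma linepath_exp_bound:
  assumes "continuous_on (closed_segment (Complex x y) (Complex x' y)) g" "x \<le> x'"
    and "\<And>p. p \<in> closed_segment (Complex x y) (Complex x' y) \<Longrightarrow> norm (g p) \<le> B * exp (- Re p / 2)"
  shows "norm (contour_integral (linepath (Complex x y) (Complex x' y)) g) \<le> 2 * B * exp (- x / 2)"
proof -
  let ?l = "linepath (Complex x y) (Complex x' y)"
  define L where "L = x' - x"
  have L: "0 \<le> L" using assms by (simp add: L_def)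
  have "0 \<le> B * exp (- Re (Complex x y) / 2)"
    by (rule order_trans[OF norm_ge_zero assms(3)]) simp
  then have B: "0 \<le> B" by (simp add: zero_le_mult_iff)
  have int: "(\<lambda>t. g (?l t) * (Complex x' y - Complex x y)) integrable_on {0..1}"
    using contour_integrable_continuous_linepath[OF assms(1)]
    by (simp add: contour_integrable_on_def has_contour_integral_linepath integrable_on_def)
  have "((\<lambda>t. L * B * exp (- (x + t * L) / 2)) has_integral
     (- 2 * B * exp (- (x + 1 * L) / 2) - (- 2 * B * exp (- (x + 0 * L) / 2)))) {0..1}"
    by (rule fundamental_theorem_of_calculus)
       (auto intro!: derivative_eq_intros simp flip: has_real_derivative_iff_has_vector_derivative)
  then have hi: "((\<lambda>t. L * B * exp (- (x + t * L) / 2)) has_integral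
     (2 * B * exp (- x / 2) - 2 * B * exp (- x' / 2))) {0..1}" by (simp add: L_def)
  have Re_l: "Re (?l t) = x + t * L" for t by (simp add: linepath_def L_def algebra_simps)
  have "norm (contour_integral ?l g) = norm (integral {0..1} (\<lambda>t. g (?l t) * (Complex x' y - Complex x y)))"
    by (simp add: contour_integral_integral)
  also have "\<dots> \<le> integral {0..1} (\<lambda>t. L * B * exp (- (x + t * L) / 2))"
  proof (rule integral_norm_bound_integral[OF int])
    show "(\<lambda>t. L * B * exp (- (x + t * L) / 2)) integrable_on {0..1}"
      using hi by (auto simp: integrable_on_def)
    fix t :: real assume "t \<in> {0..1}"
    then have "?l t \<in> closed_segment (Complex x y) (Complex x' y)"
      by (rule linepath_in_path)
    from assms(3)[OF this] have "norm (g (?l t)) \<le> B * exp (- (x + t * L) / 2)" by (simp only: Re_l)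
    moreover have "Complex x' y - Complex x y = of_real L" by (simp add: L_def complex_eq_iff)
    ultimately show "norm (g (?l t) * (Complex x' y - Complex x y)) \<le> L * B * exp (- (x + t * L) / 2)"
      using mult_left_mono[OF _ L, of "norm (g (?l t))" "B * exp (- (x + t * L) / 2)"]
      by (simp add: norm_mult mult_ac abs_of_nonneg[OF L])
  qed
  also have "\<dots> = 2 * B * exp (- x / 2) - 2 * B * exp (- x' / 2)"
    using hi by (rule integral_unique)
  also have "\<dots> \<le> 2 * B * exp (- x / 2)" using B by simp
  finally show ?thesis .
qed

text \<open>The limit is taken along the integers, where completeness applies to a sequence, and
  each real \<open>R\<close> is then compared with later integers.\<close>

lemma tendsto_at_top_of_Cauchy_bound:
  fixes V :: "real \<Rightarrow> 'a::banach"
  assumes V: "\<And>R R'. 0 \<le> R \<Longrightarrow> R \<le> R' \<Longrightarrow> norm (V R' - V R) \<le> h R"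
    and h: "(h \<longlongrightarrow> 0) at_top"
  obtains L where "(V \<longlongrightarrow> L) at_top"
proof -
  have hn: "(\<lambda>n. h (real n)) \<longlonglongrightarrow> 0"
    using h filterlim_real_sequentially by (rule filterlim_compose)
  have "Cauchy (\<lambda>n. V (real n))"
  proof (rule CauchyI', goal_cases)
    case (1 e)
    then have "\<forall>\<^sub>F n in sequentially. h (real n) < e" using order_tendstoD(2)[OF hn] by blast
    then obtain M where M: "\<And>n. n \<ge> M \<Longrightarrow> h (real n) < e" by (auto simp: eventually_sequentially)
    show ?case
    proof (intro exI[of _ M] allI impI)
      fix m n assume "M \<le> m" "m < n"
      then show "dist (V (real m)) (V (real n)) < e"
        using V[of "real m" "real n"] M[of m] by (simp add: dist_norm norm_minus_commute)
    qed
  qed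
  then obtain L where L: "(\<lambda>n. V (real n)) \<longlonglongrightarrow> L" using Cauchy_convergent convergent_def by blast
  have "norm (V R - L) \<le> h R" if "0 \<le> R" for R
  proof (rule tendsto_upperbound)
    show "(\<lambda>n. norm (V R - V (real n))) \<longlonglongrightarrow> norm (V R - L)" by (intro tendsto_intros L)
    show "\<forall>\<^sub>F n in sequentially. norm (V R - V (real n)) \<le> h R"
      using eventually_ge_at_top[of "nat \<lceil>R\<rceil>"]
      by eventually_elim (use that V in \<open>auto simp: norm_minus_commute\<close>)
  qed simp
  then have "((\<lambda>R. V R - L) \<longlongrightarrow> 0) at_top"
    by (intro Lim_null_comparison[OF _ h] eventually_mono[OF eventually_ge_at_top[of 0]]) auto
  then show ?thesis using that Lim_null by blast
qed

lemma loop_contour_split: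
  assumes "continuous_on (loop_set e) g" "0 < e" "0 \<le> R"
  shows "(g has_contour_integral
    (contour_integral (linepath (Complex 0 e) (Complex R e)) g
      - contour_integral (linepath (Complex 0 (- e)) (Complex R (- e))) g
      + contour_integral (part_circlepath 0 e (3 * pi / 2) (pi / 2)) g)) (loop_contour e R)"
proof -
  let ?l1 = "linepath (Complex R (- e)) (Complex 0 (- e))"
  let ?c = "part_circlepath 0 e (3 * pi / 2) (pi / 2)"
  let ?l2 = "linepath (Complex 0 e) (Complex R e)"
  have 1: "(g has_contour_integral contour_integral ?l1 g) ?l1"
    using assms ray_subset_loop_set[of R 0 "- e" e]
    by (intro has_contour_integral_integral contour_integrable_continuous_linepath)
       (auto intro: continuous_on_subset)
  have 2: "(g has_contour_integral contour_integral ?c g) ?c"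
    using assms arc_subset_loop_set[of e]
    by (intro has_contour_integral_integral contour_integrable_continuous_part_circlepath)
       (auto intro: continuous_on_subset)
  have 3: "(g has_contour_integral contour_integral ?l2 g) ?l2"
    using assms ray_subset_loop_set[of 0 R "e" e]
    by (intro has_contour_integral_integral contour_integrable_continuous_linepath)
       (auto intro: continuous_on_subset)
  have "(g has_contour_integral (contour_integral ?l1 g + (contour_integral ?c g + contour_integral ?l2 g)))
    (loop_contour e R)"
    unfolding loop_contour_def
    by (intro has_contour_integral_join 1 2 3 valid_path_join) (simp_all add: arc_ends del: pathstart_part_circlepath pathfinish_part_circlepath)
  moreover have "contour_integral ?l1 g = - contour_integral (linepath (Complex 0 (- e)) (Complex R (- e))) g"
    using contour_integral_reversepath[of "linepath (Complex 0 (- e)) (Complex R (- e))" g] by simp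
  ultimately show ?thesis by (simp add: algebra_simps)
qed

text \<open>Each ray contributes at most \<open>2 * B\<close>, the semicircle its length
  \<open>e * pi\<close> times \<open>B * exp (e / 2)\<close>, because \<open>Re p\<close> is at
  least \<open>- e\<close> there. The later estimates in \<open>w\<close> rest on the linearity of
  the bound in \<open>B\<close>.\<close>

lemma continuous_has_loop_integral_at:
  assumes cont: "continuous_on (loop_set e) g" and e: "0 < e"
    and B: "\<And>p. p \<in> loop_set e \<Longrightarrow> norm (g p) \<le> B * exp (- Re p / 2)"
  obtains I where "has_loop_integral_at g e I" "norm I \<le> B * (4 + exp (e / 2) * e * pi)"
proof -
  let ?V = "\<lambda>y R. contour_integral (linepath (Complex 0 y) (Complex R y)) g"
  let ?c = "contour_integral (part_circlepath 0 e (3 * pi / 2) (pi / 2)) g"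
  have B0: "0 \<le> B"
    using order_trans[OF norm_ge_zero B[of "Complex 0 e"]] e by (auto simp: loop_set_def)
  have cs: "continuous_on (closed_segment (Complex x y) (Complex x' y)) g"
    if "0 \<le> x" "0 \<le> x'" "\<bar>y\<bar> = e" for x x' y
    using cont ray_subset_loop_set[OF that] by (rule continuous_on_subset)
  have lim: "\<exists>L. (?V y \<longlongrightarrow> L) at_top" if y: "\<bar>y\<bar> = e" for y
  proof -
    have "((\<lambda>x::real. exp (- x / 2)) \<longlongrightarrow> 0) at_top" by real_asymp
    then have h: "((\<lambda>x::real. 2 * B * exp (- x / 2)) \<longlongrightarrow> 0) at_top"
      using tendsto_mult_right_zero by blast
    have "norm (?V y R' - ?V y R) \<le> 2 * B * exp (- R / 2)" if R: "0 \<le> R" "R \<le> R'" for R R'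
    proof -
      have "Complex R y \<in> closed_segment (Complex 0 y) (Complex R' y)"
        using R by (auto simp: closed_segment_same_Im closed_segment_eq_real_ivl)
      then have "?V y R' = ?V y R + contour_integral (linepath (Complex R y) (Complex R' y)) g"
        using cs[of 0 R' y] R y by (intro contour_integral_split_linepath) auto
      then show ?thesis
        using linepath_exp_bound[OF cs, of R R' y B] R y B ray_subset_loop_set[of R R' y e]
        by auto
    qed
    from tendsto_at_top_of_Cauchy_bound[OF this h] show ?thesis by auto
  qed
  obtain L1 L2 where L: "(?V e \<longlongrightarrow> L1) at_top" "(?V (- e) \<longlongrightarrow> L2) at_top"
    using lim[of e] lim[of "- e"] e by auto
  have nb: "norm L \<le> 2 * B" if "(?V y \<longlongrightarrow> L) at_top" "\<bar>y\<bar> = e" for y L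
  proof (rule tendsto_upperbound)
    show "((\<lambda>R. norm (?V y R)) \<longlongrightarrow> norm L) at_top" using that by (intro tendsto_intros)
    show "\<forall>\<^sub>F R in at_top. norm (?V y R) \<le> 2 * B"
      using eventually_ge_at_top[of 0]
    proof eventually_elim
      case (elim R)
      then show ?case using linepath_exp_bound[OF cs, of 0 R y B] that(2) B ray_subset_loop_set[of 0 R y e] by auto
    qed
  qed simp
  have nc: "norm ?c \<le> (B * exp (e / 2)) * e * \<bar>pi / 2 - 3 * pi / 2\<bar>"
  proof (rule contour_integral_bound_part_circlepath)
    show "g contour_integrable_on part_circlepath 0 e (3 * pi / 2) (pi / 2)"
      using cont arc_subset_loop_set[OF e]
      by (intro contour_integrable_continuous_part_circlepath) (rule continuous_on_subset)
    fix p assume "p \<in> path_image (part_circlepath 0 e (3 * pi / 2) (pi / 2))"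
    then have p: "p \<in> loop_set e" using arc_subset_loop_set[OF e] by auto
    have "B * exp (- Re p / 2) \<le> B * exp (e / 2)"
      using B0 Re_loop_set_ge[OF p e] by (intro mult_left_mono) auto
    then show "norm (g p) \<le> B * exp (e / 2)" using B[OF p] by linarith
  qed (use B0 e in auto)
  have nc: "norm ?c \<le> (B * exp (e / 2)) * e * pi"
    using nc by simp
  show ?thesis
  proof (rule that)
    have ev: "\<forall>\<^sub>F R in at_top. (g has_contour_integral ?V e R - ?V (- e) R + ?c) (loop_contour e R)"
      using eventually_ge_at_top[of 0] by eventually_elim (rule loop_contour_split[OF cont e])
    have "((\<lambda>R. ?V e R - ?V (- e) R + ?c) \<longlongrightarrow> L1 - L2 + ?c) at_top"
      by (intro tendsto_intros L)
    then have "((\<lambda>R. contour_integral (loop_contour e R) g) \<longlongrightarrow> L1 - L2 + ?c) at_top"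
      by (rule Lim_transform_eventually)
         (use ev in \<open>auto elim!: eventually_mono dest: contour_integral_unique\<close>)
    then show "has_loop_integral_at g e (L1 - L2 + ?c)"
      unfolding has_loop_integral_at_def
      using ev by (auto elim!: eventually_mono simp: contour_integrable_on_def)
    have "norm (L1 - L2 + ?c) \<le> 2 * B + 2 * B + (B * exp (e / 2)) * e * pi"
      using norm_triangle_ineq[of "L1 - L2" ?c] norm_triangle_ineq4[of L1 L2]
        nb[OF L(1)] nb[OF L(2)] nc e by auto
    then show "norm (L1 - L2 + ?c) \<le> B * (4 + exp (e / 2) * e * pi)" by (simp add: algebra_simps)
  qed
qed

section \<open>Loop integrals\<close>

lemma has_loop_integral_at_unique:
  "has_loop_integral_at g e I \<Longrightarrow> has_loop_integral_at g e J \<Longrightarrow> I = J"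
  unfolding has_loop_integral_at_def using tendsto_unique[OF trivial_limit_at_top_linorder] by blast

text \<open>Naming the truncated values \<open>T R\<close> makes linear combinations a matter of
  \<open>has_contour_integral\<close>, without separate integrability conditions.\<close>

lemma has_loop_integral_at_alt:
  "has_loop_integral_at g e I \<longleftrightarrow>
     (\<exists>T. (\<forall>\<^sub>F R in at_top. (g has_contour_integral T R) (loop_contour e R)) \<and> (T \<longlongrightarrow> I) at_top)"
proof
  assume "has_loop_integral_at g e I"
  then show "\<exists>T. (\<forall>\<^sub>F R in at_top. (g has_contour_integral T R) (loop_contour e R)) \<and> (T \<longlongrightarrow> I) at_top"
    unfolding has_loop_integral_at_def
    by (intro exI[of _ "\<lambda>R. contour_integral (loop_contour e R) g"])
       (auto elim!: eventually_mono intro: has_contour_integral_integral)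
next
  assume "\<exists>T. (\<forall>\<^sub>F R in at_top. (g has_contour_integral T R) (loop_contour e R)) \<and> (T \<longlongrightarrow> I) at_top"
  then obtain T where T: "\<forall>\<^sub>F R in at_top. (g has_contour_integral T R) (loop_contour e R)"
    "(T \<longlongrightarrow> I) at_top" by blast
  then show "has_loop_integral_at g e I"
    unfolding has_loop_integral_at_def
    by (auto elim!: eventually_mono Lim_transform_eventually simp: contour_integrable_on_def
         dest: contour_integral_unique)
qed

lemma has_loop_integral_at_add:
  assumes "has_loop_integral_at f e I" "has_loop_integral_at g e J"
  shows "has_loop_integral_at (\<lambda>p. f p + g p) e (I + J)"
proof -
  obtain T U where "\<forall>\<^sub>F R in at_top. (f has_contour_integral T R) (loop_contour e R)" "(T \<longlongrightarrow> I) at_top"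
    "\<forall>\<^sub>F R in at_top. (g has_contour_integral U R) (loop_contour e R)" "(U \<longlongrightarrow> J) at_top"
    using assms unfolding has_loop_integral_at_alt by blast
  then show ?thesis
    unfolding has_loop_integral_at_alt
    by (intro exI[of _ "\<lambda>R. T R + U R"] conjI tendsto_add)
       (auto elim: eventually_elim2 intro: has_contour_integral_add)
qed

lemma has_loop_integral_at_cmult:
  assumes "has_loop_integral_at f e I"
  shows "has_loop_integral_at (\<lambda>p. c * f p) e (c * I)"
proof -
  obtain T where "\<forall>\<^sub>F R in at_top. (f has_contour_integral T R) (loop_contour e R)" "(T \<longlongrightarrow> I) at_top"
    using assms unfolding has_loop_integral_at_alt by blast
  then show ?thesis
    unfolding has_loop_integral_at_alt
    by (intro exI[of _ "\<lambda>R. c * T R"] conjI tendsto_mult tendsto_const)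
       (auto elim: eventually_mono intro: has_contour_integral_lmul)
qed

lemma has_loop_integral_at_diff:
  assumes "has_loop_integral_at f e I" "has_loop_integral_at g e J"
  shows "has_loop_integral_at (\<lambda>p. f p - g p) e (I - J)"
  using has_loop_integral_at_add[OF assms(1) has_loop_integral_at_cmult[OF assms(2), of "-1"]] by simp

lemma has_loop_integral_at_sum:
  assumes "finite A" "\<And>j. j \<in> A \<Longrightarrow> has_loop_integral_at (f j) e (I j)"
  shows "has_loop_integral_at (\<lambda>p. \<Sum>j\<in>A. f j p) e (\<Sum>j\<in>A. I j)"
  using assms
proof (induction rule: finite_induct)
  case empty
  have "\<forall>\<^sub>F R in at_top. ((\<lambda>p. 0) has_contour_integral 0) (loop_contour e R)"
    by (simp add: has_contour_integral_0)
  then show ?case unfolding has_loop_integral_at_alt by auto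
next
  case (insert x F)
  then show ?case by (simp add: has_loop_integral_at_add)
qed

lemma has_loop_integral_at_cong:
  assumes "\<And>p. p \<in> loop_set e \<Longrightarrow> f p = g p" "0 < e" "has_loop_integral_at f e I"
  shows "has_loop_integral_at g e I"
proof -
  obtain T where T: "\<forall>\<^sub>F R in at_top. (f has_contour_integral T R) (loop_contour e R)" "(T \<longlongrightarrow> I) at_top"
    using assms unfolding has_loop_integral_at_alt by blast
  have "\<forall>\<^sub>F R in at_top. (g has_contour_integral T R) (loop_contour e R)"
    using T(1) eventually_ge_at_top[of 0]
  proof eventually_elim
    case (elim R)
    then show ?case
      using assms path_image_loop_contour[of e R] by (auto intro: has_contour_integral_eq)
  qed
  then show ?thesis unfolding has_loop_integral_at_alt using T by blast
qed

lemma has_loop_integral_sum: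
  assumes "finite A" "\<And>j. j \<in> A \<Longrightarrow> f j has_loop_integral I j"
  shows "(\<lambda>p. \<Sum>j\<in>A. f j p) has_loop_integral (\<Sum>j\<in>A. I j)"
proof -
  have "\<forall>\<^sub>F e in at_right 0. \<forall>j\<in>A. has_loop_integral_at (f j) e (I j)"
    using assms by (intro eventually_ball_finite) (auto simp: has_loop_integral_def)
  then show ?thesis
    unfolding has_loop_integral_def
    by eventually_elim (use assms(1) in \<open>auto intro: has_loop_integral_at_sum\<close>)
qed

lemma has_loop_integral_cmult:
  "f has_loop_integral I \<Longrightarrow> (\<lambda>p. c * f p) has_loop_integral (c * I)"
  unfolding has_loop_integral_def by (erule eventually_mono) (rule has_loop_integral_at_cmult)

lemma loop_integral_eq: "g has_loop_integral I \<Longrightarrow> loop_integral g = I"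
  unfolding loop_integral_def by (rule the_equality) (auto dest: has_loop_integral_unique)

lemma has_loop_integralI:
  assumes "0 < d" "\<And>e. 0 < e \<Longrightarrow> e < d \<Longrightarrow> has_loop_integral_at g e I"
  shows "g has_loop_integral I"
  unfolding has_loop_integral_def eventually_at_right_field using assms by blast

section \<open>Integrands that tend to zero at the right end\<close>

text \<open>Uniform decay without a rate. Such integrands need not be absolutely integrable along
  the rays, but increments of their primitives over bounded distances tend to zero.\<close>

definition vanishes_right :: "complex set \<Rightarrow> (complex \<Rightarrow> complex) \<Rightarrow> bool" where
  "vanishes_right S g \<longleftrightarrow> (\<forall>e>0. \<exists>X. \<forall>p\<in>S. X \<le> Re p \<longrightarrow> norm (g p) \<le> e)"

lemma vanishes_right_mono: "vanishes_right S g \<Longrightarrow> T \<subseteq> S \<Longrightarrow> vanishes_right T g"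
  unfolding vanishes_right_def by blast

lemma vanishes_right_exp:
  assumes "\<And>p. p \<in> S \<Longrightarrow> X \<le> Re p \<Longrightarrow> norm (g p) \<le> B * exp (- Re p / 2)"
  shows "vanishes_right S g"
  unfolding vanishes_right_def
proof (intro allI impI)
  fix e :: real assume e: "0 < e"
  have "((\<lambda>x::real. exp (- x / 2)) \<longlongrightarrow> 0) at_top" by real_asymp
  then have "((\<lambda>x::real. B * exp (- x / 2)) \<longlongrightarrow> 0) at_top"
    using tendsto_mult_right_zero by blast
  then have "\<forall>\<^sub>F x in at_top. B * exp (- x / 2) < e" using e by (rule order_tendstoD)
  then obtain Y where Y: "\<And>x. Y \<le> x \<Longrightarrow> B * exp (- x / 2) < e"
    by (auto simp: eventually_at_top_linorder)
  have "norm (g p) \<le> e" if "p \<in> S" "max X Y \<le> Re p" for p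
    using assms[of p] Y[of "Re p"] that by linarith
  then show "\<exists>X. \<forall>p\<in>S. X \<le> Re p \<longrightarrow> norm (g p) \<le> e" by blast
qed

text \<open>Mean value inequality on the convex part of \<open>T\<close> beyond \<open>X\<close>:
  the increment is at most \<open>K\<close> times a bound of \<open>norm (g p)\<close> there. All
  comparisons of contour ends go through this estimate.\<close>

lemma primitive_gap_tendsto:
  assumes der: "\<And>p. p \<in> T \<Longrightarrow> (\<Phi> has_field_derivative g p) (at p)"
    and van: "vanishes_right T g" and "convex T"
    and ev: "\<forall>\<^sub>F R in at_top. u R \<in> T \<and> v R \<in> T \<and> norm (u R - v R) \<le> K"
    and fu: "filterlim (\<lambda>R. Re (u R)) at_top at_top" and fv: "filterlim (\<lambda>R. Re (v R)) at_top at_top"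
  shows "((\<lambda>R::real. \<Phi> (u R) - \<Phi> (v R)) \<longlongrightarrow> 0) at_top"
proof (rule tendstoI)
  fix e :: real assume e: "0 < e"
  define K' where "K' = max K 1"
  have K': "0 < K'" "K \<le> K'" by (auto simp: K'_def)
  obtain X where X: "\<And>p. p \<in> T \<Longrightarrow> X \<le> Re p \<Longrightarrow> norm (g p) \<le> e / (2 * K')"
    using van e K' unfolding vanishes_right_def by (metis divide_pos_pos mult_pos_pos zero_less_numeral)
  have "\<forall>\<^sub>F R in at_top. X \<le> Re (u R)" "\<forall>\<^sub>F R in at_top. X \<le> Re (v R)"
    using fu fv by (auto simp: filterlim_at_top)
  with ev show "\<forall>\<^sub>F R in at_top. dist (\<Phi> (u R) - \<Phi> (v R)) 0 < e"
  proof eventually_elim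
    case (elim R)
    let ?s = "T \<inter> {p. X \<le> Re p}"
    have "norm (\<Phi> (u R) - \<Phi> (v R)) \<le> e / (2 * K') * norm (u R - v R)"
    proof (rule field_differentiable_bound[of ?s])
      show "convex ?s" by (intro convex_Int \<open>convex T\<close> convex_halfspace_Re_ge)
      show "(\<Phi> has_field_derivative g z) (at z within ?s)" if "z \<in> ?s" for z
        using der that by (auto intro: has_field_derivative_at_within)
    qed (use X elim in auto)
    also have "\<dots> \<le> e / (2 * K') * K'"
      using elim K' e by (intro mult_left_mono) auto
    also have "\<dots> < e" using K' e by simp
    finally show ?case by simp
  qed
qed

lemma has_loop_integral_at_primitive:
  assumes "\<And>p. p \<in> S \<Longrightarrow> (\<Phi> has_field_derivative g p) (at p)" "loop_set e \<subseteq> S" "0 < e"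
  shows "has_loop_integral_at g e I \<longleftrightarrow>
    ((\<lambda>R. \<Phi> (Complex R e) - \<Phi> (Complex R (- e))) \<longlongrightarrow> I) at_top"
proof -
  have ev: "\<forall>\<^sub>F R in at_top. (g has_contour_integral (\<Phi> (Complex R e) - \<Phi> (Complex R (- e)))) (loop_contour e R)"
    using eventually_ge_at_top[of 0] by eventually_elim (rule loop_contour_primitive[OF assms])
  then have "\<forall>\<^sub>F R in at_top. contour_integral (loop_contour e R) g = \<Phi> (Complex R e) - \<Phi> (Complex R (- e))"
    by eventually_elim (rule contour_integral_unique)
  then have "((\<lambda>R. contour_integral (loop_contour e R) g) \<longlongrightarrow> I) at_top \<longleftrightarrow>
    ((\<lambda>R. \<Phi> (Complex R e) - \<Phi> (Complex R (- e))) \<longlongrightarrow> I) at_top"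
    by (rule tendsto_cong)
  moreover have "\<forall>\<^sub>F R in at_top. g contour_integrable_on loop_contour e R"
    using ev by eventually_elim (auto simp: contour_integrable_on_def)
  ultimately show ?thesis unfolding has_loop_integral_at_def by simp
qed

text \<open>The slit strip is not convex, so the mean value inequality is applied on each side of
  the slit separately; the ends of the contours lie in two convex pieces, this one and
  \<open>lower_slit\<close>.\<close>

definition upper_slit :: "real \<Rightarrow> complex set" where
  "upper_slit d = {p. 0 < Im p \<and> Im p < d \<and> - d < Re p}"

definition lower_slit :: "real \<Rightarrow> complex set" where
  "lower_slit d = {p. Im p < 0 \<and> - d < Im p \<and> - d < Re p}"

lemma upper_slit_subset: "upper_slit d \<subseteq> slit d" and lower_slit_subset: "lower_slit d \<subseteq> slit d"
  by (auto simp: slit_def upper_slit_def lower_slit_def complex_nonneg_Reals_iff)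

lemma convex_upper_slit: "convex (upper_slit d)" and convex_lower_slit: "convex (lower_slit d)"
proof -
  have "upper_slit d = {p. 0 < Im p} \<inter> {p. Im p < d} \<inter> {p. - d < Re p}"
    "lower_slit d = {p. Im p < 0} \<inter> {p. - d < Im p} \<inter> {p. - d < Re p}"
    by (auto simp: upper_slit_def lower_slit_def)
  then show "convex (upper_slit d)" "convex (lower_slit d)"
    by (auto intro!: convex_Int convex_halfspace_Im_lt convex_halfspace_Im_gt convex_halfspace_Re_gt)
qed

text \<open>The upper end moves from \<open>v R\<close> to \<open>u R\<close> above the slit, the
  lower one from \<open>v' R\<close> to \<open>u' R\<close> below it, and nothing but these ends
  enters the limit. With \<open>K = 0\<close> this changes the width of the contour, with
  \<open>K = ln 2\<close> it performs the logarithmic substitution.\<close>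

lemma slit_primitive_gap_tendsto:
  assumes der: "\<And>p. p \<in> slit d \<Longrightarrow> (\<Phi> has_field_derivative g p) (at p)"
    and van: "vanishes_right (slit d) g"
    and ev: "\<forall>\<^sub>F R in at_top. 0 < Im (u R) \<and> Im (u R) < d \<and> 0 < Im (v R) \<and> Im (v R) < d \<and> \<bar>Re (u R) - Re (v R)\<bar> \<le> K"
    and ev': "\<forall>\<^sub>F R in at_top. Im (u' R) < 0 \<and> - d < Im (u' R) \<and> Im (v' R) < 0 \<and> - d < Im (v' R) \<and> \<bar>Re (u' R) - Re (v' R)\<bar> \<le> K"
    and f: "filterlim (\<lambda>R. Re (u R)) at_top at_top" "filterlim (\<lambda>R. Re (v R)) at_top at_top"
      "filterlim (\<lambda>R. Re (u' R)) at_top at_top" "filterlim (\<lambda>R. Re (v' R)) at_top at_top"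
    and lim: "((\<lambda>R. \<Phi> (v R) - \<Phi> (v' R)) \<longlongrightarrow> I) at_top"
  shows "((\<lambda>R::real. \<Phi> (u R) - \<Phi> (u' R)) \<longlongrightarrow> I) at_top"
proof -
  have fd: "\<forall>\<^sub>F R in at_top. - d < Re (w R)" if "filterlim (\<lambda>R. Re (w R)) at_top at_top" for w
    using that by (simp add: filterlim_at_top_dense)
  have 1: "((\<lambda>R::real. \<Phi> (u R) - \<Phi> (v R)) \<longlongrightarrow> 0) at_top"
  proof (rule primitive_gap_tendsto[OF _ vanishes_right_mono[OF van upper_slit_subset] convex_upper_slit _ f(1,2)])
    show "\<forall>\<^sub>F R in at_top. u R \<in> upper_slit d \<and> v R \<in> upper_slit d \<and> norm (u R - v R) \<le> K + d"
      using ev fd[OF f(1)] fd[OF f(2)]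
    proof eventually_elim
      case (elim R)
      have "norm (u R - v R) \<le> \<bar>Re (u R - v R)\<bar> + \<bar>Im (u R - v R)\<bar>" by (rule cmod_le)
      with elim show ?case by (auto simp: upper_slit_def)
    qed
  qed (use der upper_slit_subset in blast)
  have 2: "((\<lambda>R::real. \<Phi> (u' R) - \<Phi> (v' R)) \<longlongrightarrow> 0) at_top"
  proof (rule primitive_gap_tendsto[OF _ vanishes_right_mono[OF van lower_slit_subset] convex_lower_slit _ f(3,4)])
    show "\<forall>\<^sub>F R in at_top. u' R \<in> lower_slit d \<and> v' R \<in> lower_slit d \<and> norm (u' R - v' R) \<le> K + d"
      using ev' fd[OF f(3)] fd[OF f(4)]
    proof eventually_elim
      case (elim R)
      have "norm (u' R - v' R) \<le> \<bar>Re (u' R - v' R)\<bar> + \<bar>Im (u' R - v' R)\<bar>" by (rule cmod_le)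
      with elim show ?case by (auto simp: lower_slit_def)
    qed
  qed (use der lower_slit_subset in blast)
  have "((\<lambda>R. (\<Phi> (u R) - \<Phi> (v R)) - (\<Phi> (u' R) - \<Phi> (v' R)) + (\<Phi> (v R) - \<Phi> (v' R))) \<longlongrightarrow> 0 - 0 + I) at_top"
    by (intro tendsto_intros 1 2 lim)
  then show ?thesis by simp
qed

lemma has_loop_integral_at_slit:
  assumes hol: "g holomorphic_on slit d" and van: "vanishes_right (slit d) g"
    and e: "0 < e" "e < d" "0 < e'" "e' < d" and int: "has_loop_integral_at g e I"
  shows "has_loop_integral_at g e' I"
proof -
  obtain \<Phi> where der: "\<And>p. p \<in> slit d \<Longrightarrow> (\<Phi> has_field_derivative g p) (at p)"
    using slit_primitive[OF _ hol] e by fastforce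
  have "((\<lambda>R. \<Phi> (Complex R e) - \<Phi> (Complex R (- e))) \<longlongrightarrow> I) at_top"
    by (rule iffD1[OF has_loop_integral_at_primitive[OF der loop_set_subset_slit[OF e(1,2)] e(1)] int])
  then have "((\<lambda>R. \<Phi> (Complex R e') - \<Phi> (Complex R (- e'))) \<longlongrightarrow> I) at_top"
    by (rule slit_primitive_gap_tendsto[OF der van _ _ _ _ _ _, rotated -1, where K = 0 and v = "\<lambda>R. Complex R e" and v' = "\<lambda>R. Complex R (- e)"])
       (use e in \<open>auto intro: filterlim_ident\<close>)
  then show ?thesis
    using has_loop_integral_at_primitive[of "slit d" \<Phi> g e' I, OF der loop_set_subset_slit[OF e(3,4)] e(3)]
    by (rule iffD2[rotated])
qed

lemma has_loop_integral_slit: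
  assumes "g holomorphic_on slit d" "vanishes_right (slit d) g" "0 < e" "e < d" "has_loop_integral_at g e I"
  shows "g has_loop_integral I"
proof (rule has_loop_integralI)
  show "0 < d" using assms by simp
  show "has_loop_integral_at g e' I" if "0 < e'" "e' < d" for e'
    by (rule has_loop_integral_at_slit[OF assms(1-4) that assms(5)])
qed

section \<open>The substitution \<open>s = exp p - 1\<close>\<close>

text \<open>Halving the strip pays for the distortion by the logarithm: \<open>Re (1 + s)\<close>
  exceeds \<open>1 / 2\<close>, so the slope \<open>Im s / (1 + Re s)\<close> stays below
  \<open>d\<close> in modulus, and \<open>ln (1 - d / 2)\<close> is at least \<open>- d\<close> by a
  quadratic lower bound for the logarithm.\<close>

lemma Ln_1_plus_slit:
  assumes "s \<in> slit (d / 2)" "0 < d" "d \<le> 1"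
  shows "Ln (1 + s) \<in> slit d" "1 + s \<notin> \<real>\<^sub>\<le>\<^sub>0" "Im (Ln (1 + s)) = arctan (Im s / (1 + Re s))"
proof -
  have s: "\<bar>Im s\<bar> < d / 2" "- d / 2 < Re s" "s \<notin> \<real>\<^sub>\<ge>\<^sub>0" using assms(1) by (simp_all add: slit_def)
  have Re: "1 / 2 < 1 + Re s" using s assms by linarith
  then show nr: "1 + s \<notin> \<real>\<^sub>\<le>\<^sub>0" by (auto simp: complex_nonpos_Reals_iff)
  then have nz: "1 + s \<noteq> 0" by auto
  show im: "Im (Ln (1 + s)) = arctan (Im s / (1 + Re s))"
    using Re arg_conv_arctan[of "1 + s"] nz by (simp add: Arg_eq_Im_Ln)
  have "\<bar>Im s / (1 + Re s)\<bar> < d"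
  proof -
    have "\<bar>Im s\<bar> < d * (1 + Re s)" using s Re mult_strict_left_mono[OF Re assms(2)] by simp
    then show ?thesis using Re by (simp add: divide_less_eq)
  qed
  then have 1: "\<bar>Im (Ln (1 + s))\<bar> < d"
    unfolding im using abs_arctan_le[of "Im s / (1 + Re s)"] by linarith
  have "- (d/2) - 2 * (d/2)\<^sup>2 \<le> ln (1 - d / 2)"
    using assms by (intro ln_one_minus_pos_lower_bound) auto
  moreover have "(d / 2)\<^sup>2 \<le> d / 4" using assms by (simp add: power2_eq_square)
  moreover have "ln (1 - d / 2) < ln (norm (1 + s))"
    using s assms abs_Re_le_cmod[of "1 + s"] nz by (subst ln_less_cancel_iff) auto
  ultimately have 2: "- d < Re (Ln (1 + s))" using nz by simp
  have "Ln (1 + s) \<notin> \<real>\<^sub>\<ge>\<^sub>0"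
  proof
    assume "Ln (1 + s) \<in> \<real>\<^sub>\<ge>\<^sub>0"
    then obtain r where r: "Ln (1 + s) = of_real r" "0 \<le> r" by (auto elim: nonneg_Reals_cases)
    then have "1 + s = of_real (exp r)" using nz by (metis exp_Ln exp_of_real)
    then have "s = of_real (exp r - 1)" by (simp add: algebra_simps)
    moreover have "complex_of_real (exp r - 1) \<in> \<real>\<^sub>\<ge>\<^sub>0" 
      by (subst nonneg_Reals_of_real_iff) (use r in simp)
    ultimately show False using s by blast
  qed
  then show "Ln (1 + s) \<in> slit d" using 1 2 by (auto simp: slit_def)
qed

text \<open>No image of the contour is followed. \<open>\<Phi>\<close> composed with
  \<open>Ln (1 + s)\<close> is a primitive of the new integrand, and its values at the new contour
  ends are values of \<open>\<Phi>\<close> at points with real part near \<open>ln (1 + R)\<close>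
  on either side of the slit.\<close>

lemma has_loop_integral_exp_subst:
  assumes hol: "g holomorphic_on slit d" and van: "vanishes_right (slit d) g" and d: "0 < d" "d \<le> 1"
    and int: "g has_loop_integral I"
  shows "(\<lambda>s. g (Ln (1 + s)) / (1 + s)) has_loop_integral I"
proof (rule has_loop_integralI[of "d / 2"])
  obtain e where e: "0 < e" "e < d" "has_loop_integral_at g e I"
  proof -
    obtain b where b: "b > 0" "\<And>e. 0 < e \<Longrightarrow> e < b \<Longrightarrow> has_loop_integral_at g e I"
      using int unfolding has_loop_integral_def eventually_at_right_field by auto
    show ?thesis using that[of "min b d / 2"] b d by auto
  qed
  obtain \<Phi> where der: "\<And>p. p \<in> slit d \<Longrightarrow> (\<Phi> has_field_derivative g p) (at p)"
    using slit_primitive[OF d(1) hol] by blast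
  have lim: "((\<lambda>R. \<Phi> (Complex R e) - \<Phi> (Complex R (- e))) \<longlongrightarrow> I) at_top"
    by (rule iffD1[OF has_loop_integral_at_primitive[OF der loop_set_subset_slit[OF e(1,2)] e(1)] e(3)])
  fix e' assume e': "0 < e'" "e' < d / 2"
  have der': "((\<lambda>s. \<Phi> (Ln (1 + s))) has_field_derivative g (Ln (1 + s)) / (1 + s)) (at s)"
    if "s \<in> slit (d / 2)" for s
  proof -
    note L = Ln_1_plus_slit[OF that d]
    have "((\<lambda>s. Ln (1 + s)) has_field_derivative 1 / (1 + s)) (at s)"
      using L(2) by (auto intro!: derivative_eq_intros simp: divide_inverse)
    from DERIV_chain2[OF der[OF L(1)] this] show ?thesis by simp
  qed
  have ln: "filterlim (\<lambda>R::real. ln (1 + R)) at_top at_top" by real_asymp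
  have lim': "((\<lambda>R. \<Phi> (Complex (ln (1 + R)) e) - \<Phi> (Complex (ln (1 + R)) (- e))) \<longlongrightarrow> I) at_top"
    by (rule filterlim_compose[OF lim ln])
  \<comment> \<open>The \<open>ln 2\<close> comes from
    \<open>1 + R \<le> norm (1 + Complex R y) \<le> 2 * (1 + R)\<close>; the sign of the imaginary
    part decides on which side of the slit the end lies.\<close>
  have pt: "0 < \<bar>Im (Ln (1 + Complex R y))\<bar> \<and> \<bar>Im (Ln (1 + Complex R y))\<bar> < d \<and>
      sgn (Im (Ln (1 + Complex R y))) = sgn y \<and> \<bar>Re (Ln (1 + Complex R y)) - ln (1 + R)\<bar> \<le> ln 2"
    if "0 \<le> R" "\<bar>y\<bar> = e'" for R y
  proof -
    let ?u = "1 + Complex R y"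
    have "Complex R y \<in> slit (d / 2)" using that e' by (auto simp: slit_def complex_nonneg_Reals_iff)
    note L = Ln_1_plus_slit[OF this d]
    have nz: "?u \<noteq> 0" using L(2) by auto
    have y: "y \<noteq> 0" using that e' by auto
    have "1 + R \<le> norm ?u" using abs_Re_le_cmod[of ?u] that by simp
    moreover have "norm ?u \<le> 2 * (1 + R)" using cmod_le[of ?u] that e' d by simp
    ultimately have "ln (1 + R) \<le> ln (norm ?u)" "ln (norm ?u) \<le> ln (2 * (1 + R))"
      using that nz by (auto intro!: ln_mono)
    moreover have "ln (2 * (1 + R)) = ln 2 + ln (1 + R)" using that by (subst ln_mult) auto
    ultimately have "\<bar>Re (Ln ?u) - ln (1 + R)\<bar> \<le> ln 2" using nz by simp
    moreover have "sgn (Im (Ln ?u)) = sgn y" using that y L(3) by (auto simp: sgn_if zero_less_divide_iff)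
    moreover have "\<bar>Im (Ln ?u)\<bar> < d" using L(1) by (auto simp: slit_def)
    moreover have "Im (Ln ?u) \<noteq> 0" using that y L(3) by auto
    ultimately show ?thesis by auto
  qed
  have fl: "filterlim (\<lambda>R. Re (Ln (1 + Complex R y))) at_top at_top" if "\<bar>y\<bar> = e'" for y
  proof (rule filterlim_at_top_mono)
    show "filterlim (\<lambda>R::real. ln (1 + R) - ln 2) at_top at_top" by real_asymp
    show "\<forall>\<^sub>F R in at_top. ln (1 + R) - ln 2 \<le> Re (Ln (1 + Complex R y))"
      using eventually_ge_at_top[of 0] by eventually_elim (use pt[OF _ that] in force)
  qed
  have "((\<lambda>R. \<Phi> (Ln (1 + Complex R e')) - \<Phi> (Ln (1 + Complex R (- e')))) \<longlongrightarrow> I) at_top"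
  proof (rule slit_primitive_gap_tendsto[OF der van _ _ fl _ fl _ lim', where K = "ln 2"])
    have s: "0 < x" if "sgn x = sgn e'" for x :: real using that e' by (auto simp: sgn_if split: if_splits)
    have s': "x < 0" if "sgn x = sgn (- e')" for x :: real using that e' by (auto simp: sgn_if split: if_splits)
    show "\<forall>\<^sub>F R in at_top. 0 < Im (Ln (1 + Complex R e')) \<and> Im (Ln (1 + Complex R e')) < d \<and>
        0 < Im (Complex (ln (1 + R)) e) \<and> Im (Complex (ln (1 + R)) e) < d \<and>
        \<bar>Re (Ln (1 + Complex R e')) - Re (Complex (ln (1 + R)) e)\<bar> \<le> ln 2"
      using eventually_ge_at_top[of 0]
    proof eventually_elim
      case (elim R)
      have "\<bar>e'\<bar> = e'" using e' by simp
      then show ?case using pt[OF elim, of e'] s[of "Im (Ln (1 + Complex R e'))"] e by simp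
    qed
    show "\<forall>\<^sub>F R in at_top. Im (Ln (1 + Complex R (- e'))) < 0 \<and> - d < Im (Ln (1 + Complex R (- e'))) \<and>
        Im (Complex (ln (1 + R)) (- e)) < 0 \<and> - d < Im (Complex (ln (1 + R)) (- e)) \<and>
        \<bar>Re (Ln (1 + Complex R (- e'))) - Re (Complex (ln (1 + R)) (- e))\<bar> \<le> ln 2"
      using eventually_ge_at_top[of 0]
    proof eventually_elim
      case (elim R)
      have "\<bar>- e'\<bar> = e'" using e' by simp
      then show ?case using pt[OF elim, of "- e'"] s'[of "Im (Ln (1 + Complex R (- e')))"] e by simp
    qed
  qed (use e' ln in auto)
  then show "has_loop_integral_at (\<lambda>s. g (Ln (1 + s)) / (1 + s)) e' I"
    using has_loop_integral_at_primitive[of "slit (d / 2)" "\<lambda>s. \<Phi> (Ln (1 + s))" "\<lambda>s. g (Ln (1 + s)) / (1 + s)" e' I,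
      OF der' loop_set_subset_slit[OF e'] e'(1)]
    by (rule iffD2[rotated])
qed (use d in simp)

section \<open>Residues of the kernel \<open>1 / (p - q)\<close>\<close>

lemma vanishes_right_add:
  assumes "vanishes_right S f" "vanishes_right S g"
  shows "vanishes_right S (\<lambda>p. f p + g p)"
  unfolding vanishes_right_def
proof (intro allI impI)
  fix e :: real assume "0 < e"
  then have "0 < e / 2" by simp
  then obtain X Y where "\<And>p. p \<in> S \<Longrightarrow> X \<le> Re p \<Longrightarrow> norm (f p) \<le> e / 2"
    "\<And>p. p \<in> S \<Longrightarrow> Y \<le> Re p \<Longrightarrow> norm (g p) \<le> e / 2"
    using assms unfolding vanishes_right_def by meson
  then have "norm (f p + g p) \<le> e" if "p \<in> S" "max X Y \<le> Re p" for p
    using that norm_triangle_ineq[of "f p" "g p"] by fastforce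
  then show "\<exists>X. \<forall>p\<in>S. X \<le> Re p \<longrightarrow> norm (f p + g p) \<le> e" by blast
qed

lemma vanishes_right_cong:
  assumes "\<And>p. p \<in> S \<Longrightarrow> Y \<le> Re p \<Longrightarrow> f p = g p" "vanishes_right S f"
  shows "vanishes_right S g"
  unfolding vanishes_right_def
proof (intro allI impI)
  fix e :: real assume "0 < e"
  then obtain X where X: "\<And>p. p \<in> S \<Longrightarrow> X \<le> Re p \<Longrightarrow> norm (f p) \<le> e"
    using assms(2) unfolding vanishes_right_def by meson
  have "norm (g p) \<le> e" if "p \<in> S" "max X Y \<le> Re p" for p
    using X[of p] assms(1)[of p] that by simp
  then show "\<exists>X. \<forall>p\<in>S. X \<le> Re p \<longrightarrow> norm (g p) \<le> e" by blast
qed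

lemma vanishes_right_inverse: "vanishes_right S (\<lambda>p. c / (p - q))"
  unfolding vanishes_right_def
proof (intro allI impI)
  fix e :: real assume e: "0 < e"
  have "norm (c / (p - q)) \<le> e" if "Re q + norm c / e + 1 \<le> Re p" for p
  proof -
    have pos: "0 \<le> norm c / e" using e by simp
    have "norm c / e + 1 \<le> norm (p - q)" using abs_Re_le_cmod[of "p - q"] that by simp
    then have *: "norm c / e < norm (p - q)" by linarith
    then have "norm c < norm (p - q) * e" using e by (simp add: divide_less_eq)
    moreover have "0 < norm (p - q)" using * pos by linarith
    ultimately show ?thesis by (simp add: norm_divide divide_le_eq mult.commute)
  qed
  then show "\<exists>X. \<forall>p\<in>S. X \<le> Re p \<longrightarrow> norm (c / (p - q)) \<le> e" by blast
qed

lemma filterlim_Complex: "filterlim (\<lambda>R. Re (Complex R y)) at_top at_top"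
  by (simp add: filterlim_ident)

text \<open>The contour lies in the strip \<open>\<bar>Im p\<bar> < \<bar>Im q\<bar>\<close>, which
  is convex and free of the pole, so the two ends can be compared directly across the real
  axis.\<close>

lemma has_loop_integral_at_inverse_outside:
  assumes "0 < e" "e < \<bar>Im q\<bar>"
  shows "has_loop_integral_at (\<lambda>p. 1 / (p - q)) e 0"
proof -
  let ?S = "{p. Im p < \<bar>Im q\<bar>} \<inter> {p. - \<bar>Im q\<bar> < Im p}"
  have cv: "convex ?S" by (intro convex_Int convex_halfspace_Im_lt convex_halfspace_Im_gt)
  have op: "open ?S" by (intro open_Int open_halfspace_Im_lt open_halfspace_Im_gt)
  have "(\<lambda>p. 1 / (p - q)) holomorphic_on ?S"
    by (intro holomorphic_intros) auto
  from holomorphic_convex_primitive'[OF cv op this]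
  obtain \<Phi> where "\<And>p. p \<in> ?S \<Longrightarrow> (\<Phi> has_field_derivative 1 / (p - q)) (at p within ?S)" by blast
  then have der: "(\<Phi> has_field_derivative 1 / (p - q)) (at p)" if "p \<in> ?S" for p
    using that op at_within_open by metis
  have "loop_set e \<subseteq> ?S"
  proof
    fix p assume "p \<in> loop_set e"
    then have "\<bar>Im p\<bar> \<le> e" using abs_Im_le_cmod[of p] by (auto simp: loop_set_def)
    then show "p \<in> ?S" using assms by auto
  qed
  from has_loop_integral_at_primitive[of ?S \<Phi> "\<lambda>p. 1 / (p - q)" e 0, OF der this assms(1)]
  show ?thesis
  proof (rule iffD2)
    show "((\<lambda>R. \<Phi> (Complex R e) - \<Phi> (Complex R (- e))) \<longlongrightarrow> 0) at_top"
    proof (rule primitive_gap_tendsto[OF der vanishes_right_inverse cv _ filterlim_Complex filterlim_Complex])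
      have "norm (Complex R e - Complex R (- e)) \<le> 2 * e" for R
        using cmod_le[of "Complex R e - Complex R (- e)"] assms by simp
      then show "\<forall>\<^sub>F R in at_top. Complex R e \<in> ?S \<and> Complex R (- e) \<in> ?S \<and>
           norm (Complex R e - Complex R (- e)) \<le> 2 * e"
        using assms by auto
    qed
  qed
qed

text \<open>The path avoids the horizontal ray from \<open>q\<close> to the right, on the complement of which
  \<open>Ln (q - p)\<close> is a primitive; its limits at the two ends of the path differ by \<open>- 2 \<pi> \<i>\<close>.\<close>

lemma has_loop_integral_at_inverse_inside:
  assumes e: "0 < e" "\<bar>Im q\<bar> < e" and q: "0 \<le> Re q \<or> norm q < e"
  shows "has_loop_integral_at (\<lambda>p. 1 / (p - q)) e (- (2 * of_real pi * \<i>))"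
proof -
  let ?S = "{p. q - p \<notin> \<real>\<^sub>\<le>\<^sub>0}"
  have der: "((\<lambda>p. Ln (q - p)) has_field_derivative 1 / (p - q)) (at p)" if "p \<in> ?S" for p
  proof -
    have "p \<noteq> q" using that by auto
    then show ?thesis
      using that by (auto intro!: derivative_eq_intros simp: divide_simps)
  qed
  have "loop_set e \<subseteq> ?S"
  proof safe
    fix p assume p: "p \<in> loop_set e" "q - p \<in> \<real>\<^sub>\<le>\<^sub>0"
    then have *: "Im p = Im q" "Re q \<le> Re p" by (auto simp: complex_nonpos_Reals_iff)
    then have **: "Re p \<le> 0" "norm p = e" using p e by (auto simp: loop_set_def)
    have nq: "(norm z)\<^sup>2 = (Re z)\<^sup>2 + (Im z)\<^sup>2" for z by (simp add: cmod_power2)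
    show False
    proof (cases "0 \<le> Re q")
      case True
      then have "Re p = 0" using * ** by linarith
      then have "norm p = \<bar>Im q\<bar>" using * by (simp add: cmod_def)
      then show False using ** e by simp
    next
      case False
      \<comment> \<open>Here \<open>p\<close> lies between \<open>q\<close> and the imaginary axis
        at the height of \<open>q\<close>, so it is no farther from 0 than \<open>q\<close>, against
        \<open>norm q < e\<close>.\<close>
      have "(Re p)\<^sup>2 \<le> (Re q)\<^sup>2" using * ** abs_le_square_iff[of "Re p" "Re q"] by simp
      then have "(norm p)\<^sup>2 \<le> (norm q)\<^sup>2" unfolding nq using * by simp
      then show False using ** q False by (simp add: power2_le_iff_abs_le)
    qed
  qed
  from has_loop_integral_at_primitive[of ?S "\<lambda>p. Ln (q - p)" "\<lambda>p. 1 / (p - q)" e "- (2 * of_real pi * \<i>)", OF der this e(1)]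
  show ?thesis
  proof (rule iffD2)
    let ?T = "{p. Re q < Re p}"
    \<comment> \<open>At the right end \<open>Ln (p - q)\<close> is smooth across the ray and its
      gap tends to zero. \<open>Ln (q - p)\<close> differs from it by \<open>- \<i> * pi\<close>
      above the ray and by \<open>+ \<i> * pi\<close> below.\<close>
    have gap: "((\<lambda>R. Ln (Complex R e - q) - Ln (Complex R (- e) - q)) \<longlongrightarrow> 0) at_top"
    proof (rule primitive_gap_tendsto[OF _ vanishes_right_inverse convex_halfspace_Re_gt _ filterlim_Complex filterlim_Complex])
      show "((\<lambda>p. Ln (p - q)) has_field_derivative 1 / (p - q)) (at p)" if "p \<in> ?T" for p
      proof -
        have "p - q \<notin> \<real>\<^sub>\<le>\<^sub>0" using that by (auto simp: complex_nonpos_Reals_iff)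
        then show ?thesis by (auto intro!: derivative_eq_intros simp: divide_inverse)
      qed
      have "norm (Complex R e - Complex R (- e)) \<le> 2 * e" for R
        using cmod_le[of "Complex R e - Complex R (- e)"] e by simp
      then show "\<forall>\<^sub>F R in at_top. Complex R e \<in> ?T \<and> Complex R (- e) \<in> ?T \<and>
           norm (Complex R e - Complex R (- e)) \<le> 2 * e"
        using eventually_gt_at_top[of "Re q"] by (auto elim: eventually_mono)
    qed
    have "Ln (q - Complex R e) - Ln (q - Complex R (- e)) =
        Ln (Complex R e - q) - Ln (Complex R (- e) - q) - 2 * of_real pi * \<i>" for R
    proof -
      have im: "0 < Im (Complex R e - q)" "Im (Complex R (- e) - q) < 0" using e by auto
      then have nz: "Complex R e - q \<noteq> 0" "Complex R (- e) - q \<noteq> 0" by force+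
      have "Ln (- (Complex R e - q)) = Ln (Complex R e - q) - \<i> * pi"
        using im by (subst Ln_minus[OF nz(1)]) auto
      moreover have "Ln (- (Complex R (- e) - q)) = Ln (Complex R (- e) - q) + \<i> * pi"
        using im by (subst Ln_minus[OF nz(2)]) auto
      ultimately show ?thesis by simp
    qed
    then show "((\<lambda>R. Ln (q - Complex R e) - Ln (q - Complex R (- e))) \<longlongrightarrow> - (2 * of_real pi * \<i>)) at_top"
      using tendsto_diff[OF gap tendsto_const[of "2 * of_real pi * \<i>"]] by simp
  qed
qed

text \<open>The pole is split off: \<open>\<phi>\<close> has a removable singularity at
  \<open>q\<close>, so its integral is the same for both widths, while the integral of
  \<open>h q / (p - q)\<close> passes from 0 to \<open>- 2 * pi * \<i> * h q\<close> once the
  contour encloses \<open>q\<close>.\<close>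

lemma has_loop_integral_at_jump:
  assumes h: "h holomorphic_on slit d" and van: "vanishes_right (slit d) (\<lambda>p. h p / (p - q))"
    and q: "q \<in> slit d" "0 \<le> Re q \<or> norm q < e'"
    and e: "0 < e" "e < \<bar>Im q\<bar>" "\<bar>Im q\<bar> < e'" "e' < d"
    and int: "has_loop_integral_at (\<lambda>p. h p / (p - q)) e I"
  shows "has_loop_integral_at (\<lambda>p. h p / (p - q)) e' (I - 2 * of_real pi * \<i> * h q)"
proof -
  define \<phi> where "\<phi> p = (if p = q then deriv h q else (h p - h q) / (p - q))" for p
  have hol: "\<phi> holomorphic_on slit d"
    unfolding \<phi>_def by (rule pole_lemma_open[OF h open_slit])
  have eq: "\<phi> p = h p / (p - q) + (- h q) / (p - q)" if "p \<noteq> q" for p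
    using that by (simp add: \<phi>_def diff_divide_distrib)
  have "vanishes_right (slit d) \<phi>"
  proof (rule vanishes_right_cong[OF _ vanishes_right_add[OF van vanishes_right_inverse[of _ "- h q" q]]])
    fix p assume "Re q + 1 \<le> Re p"
    then have "p \<noteq> q" by auto
    then show "h p / (p - q) + - h q / (p - q) = \<phi> p" by (rule eq[symmetric])
  qed
  moreover have "has_loop_integral_at \<phi> e (I + (- h q) * 0)"
  proof (rule has_loop_integral_at_cong)
    show "has_loop_integral_at (\<lambda>p. h p / (p - q) + (- h q) * (1 / (p - q))) e (I + (- h q) * 0)"
      by (rule has_loop_integral_at_add[OF int has_loop_integral_at_cmult[OF
              has_loop_integral_at_inverse_outside[OF e(1,2)]]])
    fix p assume "p \<in> loop_set e"
    then have "p \<noteq> q" using e abs_Im_le_cmod[of p] by (auto simp: loop_set_def)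
    then show "h p / (p - q) + (- h q) * (1 / (p - q)) = \<phi> p" by (simp add: eq)
  qed (rule e)
  ultimately have "has_loop_integral_at \<phi> e' (I + (- h q) * 0)"
    using has_loop_integral_at_slit[OF hol, of e e'] e by auto
  then have "has_loop_integral_at (\<lambda>p. \<phi> p + h q * (1 / (p - q))) e'
      (I + (- h q) * 0 + h q * (- (2 * of_real pi * \<i>)))"
    by (intro has_loop_integral_at_add has_loop_integral_at_cmult
        has_loop_integral_at_inverse_inside) (use e q in auto)
  then show ?thesis
  proof (rule has_loop_integral_at_cong[rotated 2, THEN back_subst[of "has_loop_integral_at _ _"]])
    fix p assume p: "p \<in> loop_set e'"
    have "p \<noteq> q"
    proof
      assume "p = q"
      then have "Re q \<le> 0" "norm q = e'" using p e by (auto simp: loop_set_def)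
      then have "Re q = 0" using q by auto
      then show False using \<open>norm q = e'\<close> e by (simp add: cmod_def)
    qed
    then show "\<phi> p + h q * (1 / (p - q)) = h p / (p - q)" by (simp add: eq)
  qed (use e in auto)
qed

section \<open>The kernel \<open>1 / (exp p - w)\<close> and its distance from the contour\<close>

text \<open>For nonzero \<open>w\<close> this function factors \<open>exp p - w\<close> as
  \<open>w * E (p - Ln w) * (p - Ln w)\<close>, which reduces the exponential kernel to the Cauchy
  kernel. Its zeros are the nonzero multiples of \<open>2 * pi * \<i>\<close>.\<close>

lemma exp_diff_quotient:
  obtains E where "E holomorphic_on UNIV" "E 0 = 1"
    "\<And>x. x \<noteq> 0 \<Longrightarrow> E x = (exp x - 1) / x" "\<And>x. \<bar>Im x\<bar> < 2 * pi \<Longrightarrow> E x \<noteq> (0::complex)"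
proof
  let ?E = "\<lambda>x::complex. if x = 0 then deriv exp 0 else (exp x - exp 0) / (x - 0)"
  show "?E holomorphic_on UNIV"
    by (rule pole_lemma_open) (auto intro: holomorphic_intros)
  have d: "deriv exp (0::complex) = 1" by (metis DERIV_exp DERIV_imp_deriv exp_zero)
  then show "?E 0 = 1" by simp
  show "?E x = (exp x - 1) / x" if "x \<noteq> 0" for x using that by simp
  fix x :: complex assume x: "\<bar>Im x\<bar> < 2 * pi"
  have "exp x \<noteq> exp 0" if "x \<noteq> 0"
  proof
    assume "exp x = exp 0"
    then have "x = 0" by (rule exp_complex_eqI[rotated]) (use x in auto)
    then show False using that by simp
  qed
  then show "?E x \<noteq> 0" using d by auto
qed

text \<open>Each cut in the variable \<open>w = z / a j\<close>, and the image of the nonnegative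
  half-line under \<open>exp\<close>.\<close>

definition cut1 :: "complex set" where "cut1 = {of_real t |t. 1 \<le> t}"

lemma closed_cut1: "closed cut1"
proof -
  have "cut1 = {z. Im z = 0} \<inter> {z. 1 \<le> Re z}"
    by (auto simp: cut1_def complex_eq_iff intro!: exI[of _ "Re _"])
  moreover have "closed ({z. Im z = 0} \<inter> {z. 1 \<le> Re z})"
    by (intro closed_Int closed_Collect_eq closed_Collect_le continuous_intros)
  ultimately show ?thesis by simp
qed

text \<open>Comparison with \<open>exp (max (Re p) 0)\<close>: turning \<open>exp p\<close> onto the
  real axis costs at most \<open>exp (Re p) * \<bar>Im p\<bar>\<close>, moving a negative
  \<open>Re p\<close> up to 0 costs at most \<open>d\<close>.\<close>

lemma exp_slit_near_cut1:
  assumes "p \<in> slit d"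
  obtains z where "z \<in> cut1" "norm (exp p - z) \<le> d * (norm (exp p) + 1)"
proof -
  have p: "\<bar>Im p\<bar> < d" "- d < Re p" using assms by (auto simp: slit_def)
  define m where "m = max (Re p) 0"
  have "norm (exp p - of_real (exp (Re p))) = exp (Re p) * norm (cis (Im p) - cis 0)"
  proof -
    have "exp p = of_real (exp (Re p)) * cis (Im p)" by (simp add: exp_eq_polar)
    then have "exp p - of_real (exp (Re p)) = of_real (exp (Re p)) * (cis (Im p) - cis 0)"
      by (simp add: algebra_simps)
    then show ?thesis by (simp only: norm_mult norm_of_real abs_exp_cancel)
  qed
  also have "norm (cis (Im p) - cis 0) \<le> \<bar>Im p\<bar>"
    using dist_exp_i_1[of "Im p"] abs_sin_x_le_abs_x[of "Im p / 2"] by (simp add: cis_conv_exp)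
  finally have 1: "norm (exp p - of_real (exp (Re p))) \<le> exp (Re p) * \<bar>Im p\<bar>" by simp
  have "\<bar>exp (Re p) - exp m\<bar> \<le> d"
  proof (cases "0 \<le> Re p")
    case True then show ?thesis using p by (simp add: m_def)
  next
    case False
    then show ?thesis using p exp_ge_add_one_self[of "Re p"] by (simp add: m_def del: exp_ge_add_one_self)
  qed
  then have 2: "norm (of_real (exp (Re p)) - of_real (exp m) :: complex) \<le> d"
    by (metis norm_of_real of_real_diff)
  have "norm (exp p - of_real (exp m)) \<le> exp (Re p) * \<bar>Im p\<bar> + d"
    using norm_triangle_ineq[of "exp p - of_real (exp (Re p))" "of_real (exp (Re p)) - of_real (exp m)"] 1 2
    by simp
  also have "\<dots> \<le> exp (Re p) * d + d" using p by (intro add_right_mono mult_left_mono) auto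
  finally have "norm (exp p - of_real (exp m)) \<le> d * (norm (exp p) + 1)"
    by (simp add: algebra_simps)
  moreover have "of_real (exp m) \<in> cut1"
    unfolding cut1_def by (auto simp: m_def intro!: exI[of _ "exp m"])
  ultimately show ?thesis using that by blast
qed

text \<open>\<open>w\<close> has a positive distance \<open>s\<close> from the closed ray, and a
  strip whose width is small compared with \<open>s / (norm w + 2)\<close> has an image too close to
  the ray to reach points near \<open>w\<close>. A common width for a whole ball of
  \<open>w'\<close> is what makes it possible to differentiate in \<open>w\<close>.\<close>

lemma exp_slit_avoids:
  assumes "w \<notin> cut1" "0 < d"
  obtains d' r where "0 < d'" "d' \<le> d" "0 < r" "\<And>w' p. w' \<in> ball w r \<Longrightarrow> p \<in> slit d' \<Longrightarrow> exp p \<noteq> w'"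
proof -
  have "open (- cut1)" using closed_cut1 by auto
  then obtain s where s: "0 < s" "ball w s \<subseteq> - cut1" using assms open_contains_ball by blast
  define r where "r = min 1 (s / 2)"
  define d' where "d' = min d (s / (2 * (norm w + 2)))"
  have d': "0 < d'" "d' \<le> d" "d' * (norm w + 2) \<le> s / 2"
  proof -
    have pos: "0 < norm w + 2" using norm_ge_zero[of w] by linarith
    then show "0 < d'" "d' \<le> d" using assms s by (auto simp: d'_def)
    have "d' * (norm w + 2) \<le> s / (2 * (norm w + 2)) * (norm w + 2)"
      using pos by (intro mult_right_mono) (auto simp: d'_def)
    also have "\<dots> = s / 2" using pos by (simp add: field_simps)
    finally show "d' * (norm w + 2) \<le> s / 2" .
  qed
  have "exp p \<noteq> w'" if w': "w' \<in> ball w r" and p: "p \<in> slit d'" for w' p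
  proof
    assume eq: "exp p = w'"
    obtain z where z: "z \<in> cut1" "norm (w' - z) \<le> d' * (norm w' + 1)"
      using exp_slit_near_cut1[OF p] eq by auto
    have "norm (w' - w) < min 1 (s / 2)" using w' by (simp add: r_def dist_norm norm_minus_commute)
    then have 1: "norm (w' - w) < s / 2" "norm w' \<le> norm w + 1"
      using norm_triangle_ineq2[of w' w] by auto
    have "d' * (norm w' + 1) \<le> d' * (norm w + 2)" using 1 d' by (intro mult_left_mono) auto
    then have "norm (w - z) < s"
      using z d'(3) 1 norm_triangle_ineq4[of "w - w'" "z - w'"] by (simp add: norm_minus_commute)
    then show False using s z by (auto simp: dist_norm)
  qed
  then show ?thesis using that[of d' r] d' s by (auto simp: r_def)
qed

text \<open>Beyond \<open>X\<close> the modulus of \<open>exp p\<close> is at least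
  \<open>2 * (norm w + 1)\<close> and dominates; the rest of the contour is compact, and its image
  misses \<open>w\<close>.\<close>

lemma exp_loop_separated:
  assumes e: "0 < e" "e < d" and w: "w \<notin> exp ` loop_set e"
  obtains c r where "0 < c" "0 < r"
    "\<And>w' p. w' \<in> ball w r \<Longrightarrow> p \<in> loop_set e \<Longrightarrow> c * exp (Re p) \<le> norm (exp p - w')"
proof -
  define X where "X = ln (2 * (norm w + 1))"
  have eX: "exp X = 2 * (norm w + 1)"
    unfolding X_def by (rule exp_ln) (simp add: add_nonneg_pos)
  have "exp 0 < exp X" unfolding eX by (simp add: add_pos_nonneg distrib_left add.commute)
  then have X0: "0 < X" by simp
  let ?K = "loop_set e \<inter> {p. Re p \<le> X}"
  have "compact ?K"
    unfolding compact_eq_bounded_closed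
  proof
    have "norm p \<le> X + 2 * e" if "p \<in> ?K" for p
    proof -
      have "\<bar>Im p\<bar> \<le> e" using that abs_Im_le_cmod[of p] by (auto simp: loop_set_def)
      moreover have "\<bar>Re p\<bar> \<le> X + e" using that Re_loop_set_ge[of p e] e X0 by auto
      ultimately show ?thesis using cmod_le[of p] by linarith
    qed
    then show "bounded ?K" by (auto simp: bounded_iff)
    show "closed ?K" by (intro closed_Int closed_loop_set closed_halfspace_Re_le)
  qed
  then have "compact (exp ` ?K)" by (intro compact_continuous_image continuous_intros)
  moreover have "w \<notin> exp ` ?K" using w by auto
  ultimately obtain s where s: "0 < s" "ball w s \<subseteq> - exp ` ?K"
    using compact_imp_closed open_contains_ball[of "- exp ` ?K"] by (metis ComplI open_Compl)
  define c where "c = min (1/2) (s / 2 * exp (- X))"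
  define r where "r = min 1 (s / 2)"
  have "c * exp (Re p) \<le> norm (exp p - w')" if w': "w' \<in> ball w r" and p: "p \<in> loop_set e" for w' p
  proof -
    have w1: "norm (w' - w) < 1" "norm (w' - w) < s / 2"
      using w' by (auto simp: r_def dist_norm norm_minus_commute)
    show ?thesis
    proof (cases "Re p \<le> X")
      case True
      have "exp p \<notin> ball w s" using s True p by auto
      then have "s \<le> norm (exp p - w)" by (simp add: dist_norm norm_minus_commute)
      then have "s / 2 \<le> norm (exp p - w')"
        using norm_triangle_ineq[of "exp p - w'" "w' - w"] w1 by simp
      moreover have "c * exp (Re p) \<le> s / 2 * exp (- X) * exp X"
        using True s by (intro mult_mono) (auto simp: c_def)
      ultimately show ?thesis by (simp add: mult.assoc flip: exp_add)
    next
      case False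
      then have "2 * (norm w + 1) \<le> exp (Re p)" using eX by (metis exp_le_cancel_iff nle_le)
      moreover have "norm w' \<le> norm w + 1" using w1 norm_triangle_ineq2[of w' w] by linarith
      ultimately have "exp (Re p) / 2 \<le> norm (exp p - w')"
        using norm_triangle_ineq2[of "exp p" w'] by simp
      moreover have "c * exp (Re p) \<le> 1 / 2 * exp (Re p)" by (intro mult_right_mono) (auto simp: c_def)
      ultimately show ?thesis by linarith
    qed
  qed
  then show ?thesis using that[of c r] s by (auto simp: c_def r_def)
qed

text \<open>Law of cosines, with \<open>k\<close> bounding the cosine of the angle: the square of
  \<open>norm (u - w)\<close> is at least \<open>1 - k\<close> times the sum of the squares plus
  \<open>k * (norm u - norm w)\<^sup>2\<close>.\<close>

lemma norm_diff_ge_of_angle: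
  fixes u w :: complex
  assumes "Re (u * cnj w) \<le> k * (norm u * norm w)" "0 \<le> k" "k \<le> 1"
  shows "sqrt (1 - k) * max (norm u) (norm w) \<le> norm (u - w)"
proof -
  let ?m = "max (norm u) (norm w)"
  have "(norm (u - w))\<^sup>2 = (norm u)\<^sup>2 + (norm w)\<^sup>2 - 2 * Re (u * cnj w)"
    unfolding cmod_power2 by (simp add: power2_eq_square algebra_simps)
  also have "\<dots> \<ge> (norm u)\<^sup>2 + (norm w)\<^sup>2 - 2 * (k * (norm u * norm w))"
    using assms by simp
  also have "(norm u)\<^sup>2 + (norm w)\<^sup>2 - 2 * (k * (norm u * norm w)) =
     (1 - k) * ((norm u)\<^sup>2 + (norm w)\<^sup>2) + k * (norm u - norm w)\<^sup>2"
    by (simp add: power2_eq_square algebra_simps)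
  also have "\<dots> \<ge> (1 - k) * ((norm u)\<^sup>2 + (norm w)\<^sup>2)" using assms by simp
  finally have "(1 - k) * ((norm u)\<^sup>2 + (norm w)\<^sup>2) \<le> (norm (u - w))\<^sup>2" .
  moreover have "?m\<^sup>2 \<le> (norm u)\<^sup>2 + (norm w)\<^sup>2" by (simp add: max_def)
  then have "(1 - k) * ?m\<^sup>2 \<le> (1 - k) * ((norm u)\<^sup>2 + (norm w)\<^sup>2)"
    using assms by (intro mult_left_mono) auto
  ultimately have "(sqrt (1 - k) * ?m)\<^sup>2 \<le> (norm (u - w))\<^sup>2"
    using assms by (simp add: power_mult_distrib)
  then show ?thesis by (rule power2_le_imp_le) simp
qed

lemma cos_le_cos_of_dist:
  assumes "0 \<le> e" "e \<le> pi" "e \<le> \<bar>x\<bar>" "\<bar>x\<bar> \<le> 2 * pi - e"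
  shows "cos x \<le> cos e"
proof (cases "\<bar>x\<bar> \<le> pi")
  case True
  then have "cos \<bar>x\<bar> \<le> cos e" using assms by (intro cos_monotone_0_pi_le) auto
  then show ?thesis by simp
next
  case False
  then have "cos (2 * pi - \<bar>x\<bar>) \<le> cos e" using assms by (intro cos_monotone_0_pi_le) auto
  then show ?thesis by (simp add: cos_diff)
qed

text \<open>On the rays \<open>exp p\<close> has direction \<open>e'\<close> or \<open>- e'\<close>
  and keeps an angle of at least \<open>e\<close> from \<open>exp q\<close>; on the semicircle
  \<open>norm (exp p) \<le> 1\<close>, at most half of \<open>norm (exp q)\<close>. The two cases
  account for the two terms of the minimum.\<close>

lemma exp_loop_angle_bound:
  assumes e: "0 < e" "e \<le> 1" and e': "0 < e'"
    and p: "p \<in> loop_set e'" and q: "2 \<le> exp (Re q)" 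
    and ang: "e \<le> \<bar>e' - Im q\<bar>" "\<bar>e' - Im q\<bar> \<le> 2 * pi - e" "e \<le> \<bar>- e' - Im q\<bar>" "\<bar>- e' - Im q\<bar> \<le> 2 * pi - e"
  shows "min (1/2) (sqrt (1 - cos e)) * max (norm (exp p)) (norm (exp q)) \<le> norm (exp p - exp q)"
proof (cases "0 \<le> Re p \<and> \<bar>Im p\<bar> = e'")
  case True
  have "e \<le> \<bar>Im p - Im q\<bar>" "\<bar>Im p - Im q\<bar> \<le> 2 * pi - e" using True ang by (auto simp: abs_if split: if_splits)
  then have "cos (Im p - Im q) \<le> cos e" using e pi_ge_two by (intro cos_le_cos_of_dist) auto
  moreover have "exp p * cnj (exp q) = exp (p + cnj q)" by (simp add: exp_add exp_cnj)
  then have "Re (exp p * cnj (exp q)) = exp (Re p) * exp (Re q) * cos (Im p - Im q)"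
    by (simp only: Re_exp) (simp add: exp_add)
  ultimately have "Re (exp p * cnj (exp q)) \<le> cos e * (norm (exp p) * norm (exp q))"
    by (simp add: mult.commute)
  moreover have "0 \<le> cos e" using e pi_ge_two by (intro cos_ge_zero) auto
  ultimately have "sqrt (1 - cos e) * max (norm (exp p)) (norm (exp q)) \<le> norm (exp p - exp q)"
    by (intro norm_diff_ge_of_angle) auto
  moreover have "min (1/2) (sqrt (1 - cos e)) * max (norm (exp p)) (norm (exp q)) \<le>
      sqrt (1 - cos e) * max (norm (exp p)) (norm (exp q))"
    by (intro mult_right_mono) (auto simp: max_def)
  ultimately show ?thesis by linarith
next
  case False
  then have "Re p \<le> 0" using p by (auto simp: loop_set_def)
  then have "exp (Re p) \<le> 1" by simp
  then have 1: "norm (exp p) \<le> norm (exp q) / 2" "norm (exp p) \<le> norm (exp q)"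
    using q unfolding norm_exp_eq_Re by linarith+
  then have "1 / 2 * max (norm (exp p)) (norm (exp q)) \<le> norm (exp p - exp q)"
    using norm_triangle_ineq2[of "exp q" "exp p"] by (simp add: norm_minus_commute max_def del: norm_exp_eq_Re)
  moreover have "min (1/2) (sqrt (1 - cos e)) * max (norm (exp p)) (norm (exp q)) \<le>
      1 / 2 * max (norm (exp p)) (norm (exp q))"
    by (intro mult_right_mono) (auto simp: max_def)
  ultimately show ?thesis by linarith
qed

section \<open>Cauchy transforms over the loop\<close>

text \<open>An algebraic bound implies the growth condition, and
  \<open>exp (- s) * f (a j * exp s)\<close> satisfies it as well, so that the converse part can use
  the same estimates. \<open>d \<le> 1\<close> keeps the strip where \<open>Ln\<close> inverts
  \<open>exp\<close>.\<close>

locale loop_density =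
  fixes d :: real and F :: "complex \<Rightarrow> complex"
  assumes d: "0 < d" "d \<le> 1"
    and holomorphic: "F holomorphic_on slit d"
    and growth: "\<exists>B X. \<forall>p\<in>slit d. X \<le> Re p \<longrightarrow> norm (F p) \<le> B * exp (Re p / 4)"
begin

lemma bounded_on_loop:
  assumes e: "0 < e" "e < d"
  obtains B where "0 \<le> B" "\<And>p. p \<in> loop_set e \<Longrightarrow> norm (F p) \<le> B * exp (Re p / 4)"
proof -
  obtain B0 X where B0: "\<And>p. p \<in> slit d \<Longrightarrow> X \<le> Re p \<Longrightarrow> norm (F p) \<le> B0 * exp (Re p / 4)"
    using growth by blast
  let ?K = "loop_set e \<inter> {p. Re p \<le> X}"
  have "compact ?K"
    unfolding compact_eq_bounded_closed
  proof
    have "norm p \<le> \<bar>X\<bar> + 2 * e" if "p \<in> ?K" for p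
    proof -
      have "\<bar>Im p\<bar> \<le> e" using that abs_Im_le_cmod[of p] by (auto simp: loop_set_def)
      moreover have "\<bar>Re p\<bar> \<le> \<bar>X\<bar> + e" using that Re_loop_set_ge[of p e] e by auto
      ultimately show ?thesis using cmod_le[of p] by linarith
    qed
    then show "bounded ?K" by (auto simp: bounded_iff)
    show "closed ?K" by (intro closed_Int closed_loop_set closed_halfspace_Re_le)
  qed
  moreover have "continuous_on ?K F"
    using loop_set_subset_slit[OF e] by (intro continuous_on_subset[OF holomorphic_on_imp_continuous_on[OF holomorphic]]) auto
  ultimately have "bounded (F ` ?K)" using compact_continuous_image compact_imp_bounded by blast
  then obtain M where M: "0 < M" "\<And>p. p \<in> ?K \<Longrightarrow> norm (F p) \<le> M"
    by (auto simp: bounded_pos)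
  \<comment> \<open>The factor \<open>exp (e / 4)\<close> compensates \<open>exp (Re p / 4)\<close>
    at the leftmost point, where \<open>Re p = - e\<close>.\<close>
  define B where "B = max B0 (M * exp (e / 4))"
  show ?thesis
  proof
    show "0 \<le> B" using M by (simp add: B_def le_max_iff_disj)
    fix p assume p: "p \<in> loop_set e"
    show "norm (F p) \<le> B * exp (Re p / 4)"
    proof (cases "X \<le> Re p")
      case True
      then have "norm (F p) \<le> B0 * exp (Re p / 4)" using B0 p loop_set_subset_slit[OF e] by auto
      also have "\<dots> \<le> B * exp (Re p / 4)" by (intro mult_right_mono) (auto simp: B_def)
      finally show ?thesis .
    next
      case False
      then have "norm (F p) \<le> M * 1" using M p by auto
      also have "\<dots> \<le> M * exp (e / 4 + Re p / 4)"
        using M Re_loop_set_ge[OF p e(1)] by (intro mult_left_mono) auto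
      also have "\<dots> = (M * exp (e / 4)) * exp (Re p / 4)" by (simp add: exp_add)
      also have "\<dots> \<le> B * exp (Re p / 4)" by (intro mult_right_mono) (auto simp: B_def)
      finally show ?thesis .
    qed
  qed
qed

text \<open>\<open>M\<close> depends on \<open>F\<close> and \<open>e\<close> only, so a bound on
  the kernel turns into a bound on the integral. Derivative, growth and series remainder of the
  transforms below arise by choosing \<open>k\<close> and \<open>A\<close>.\<close>

lemma kernel_integral:
  assumes e: "0 < e" "e < d"
  obtains M where "0 \<le> M"
    "\<And>k A. continuous_on (loop_set e) k \<Longrightarrow>
       (\<And>p. p \<in> loop_set e \<Longrightarrow> norm (k p) \<le> A * exp (- (3 / 4) * Re p)) \<Longrightarrow>
       \<exists>I. has_loop_integral_at (\<lambda>p. F p * k p) e I \<and> norm I \<le> A * M"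
proof -
  obtain B where B: "0 \<le> B" "\<And>p. p \<in> loop_set e \<Longrightarrow> norm (F p) \<le> B * exp (Re p / 4)"
    using bounded_on_loop[OF e] by blast
  show ?thesis
  proof
    show "0 \<le> B * (4 + exp (e / 2) * e * pi)" using B e by (intro mult_nonneg_nonneg add_nonneg_nonneg) auto
    fix k :: "complex \<Rightarrow> complex" and A assume k: "continuous_on (loop_set e) k"
      "\<And>p. p \<in> loop_set e \<Longrightarrow> norm (k p) \<le> A * exp (- (3 / 4) * Re p)"
    have cont: "continuous_on (loop_set e) (\<lambda>p. F p * k p)"
      using loop_set_subset_slit[OF e] holomorphic_on_imp_continuous_on[OF holomorphic]
      by (intro continuous_on_mult k(1)) (rule continuous_on_subset)
    have "norm (F p * k p) \<le> (A * B) * exp (- Re p / 2)" if p: "p \<in> loop_set e" for p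
    proof -
      have "norm (F p * k p) \<le> (B * exp (Re p / 4)) * (A * exp (- (3 / 4) * Re p))"
        unfolding norm_mult using B k(2)[OF p] p by (intro mult_mono) auto
      also have "\<dots> = (A * B) * exp (Re p / 4 + - (3 / 4) * Re p)" unfolding exp_add by (simp only: mult_ac)
      also have "Re p / 4 + - (3 / 4) * Re p = - Re p / 2" by simp
      finally show ?thesis .
    qed
    from continuous_has_loop_integral_at[OF cont e(1) this]
    show "\<exists>I. has_loop_integral_at (\<lambda>p. F p * k p) e I \<and> norm I \<le> A * (B * (4 + exp (e / 2) * e * pi))"
      by (metis mult.assoc)
  qed
qed

section \<open>Cauchy integrals over a contour of fixed width\<close>

definition cauchy_loop :: "real \<Rightarrow> complex \<Rightarrow> complex" where
  "cauchy_loop e w = (THE I. has_loop_integral_at (\<lambda>p. F p / (exp p - w)) e I)"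

lemma cauchy_loop_eq: "has_loop_integral_at (\<lambda>p. F p / (exp p - w)) e I \<Longrightarrow> cauchy_loop e w = I"
  unfolding cauchy_loop_def by (rule the_equality) (auto dest: has_loop_integral_at_unique)

text \<open>Trims a faster decay down to the exponent \<open>3 / 4\<close> that
  \<open>kernel_integral\<close> asks for; the loss is \<open>exp a\<close> because
  \<open>Re p \<ge> - 1\<close> on the contour.\<close>

lemma exp_minus_le:
  assumes "p \<in> loop_set e" "0 < e" "e < d" "0 \<le> a"
  shows "exp (- (3 / 4 + a) * Re p) \<le> exp a * exp (- (3 / 4) * Re p)"
proof -
  have "- Re p \<le> 1" using Re_loop_set_ge[OF assms(1,2)] assms d by linarith
  from mult_left_mono[OF this assms(4)] show ?thesis by (simp add: algebra_simps flip: exp_add)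
qed

lemma has_cauchy_loop:
  assumes e: "0 < e" "e < d" and c: "0 < c" "\<And>p. p \<in> loop_set e \<Longrightarrow> c * exp (Re p) \<le> norm (exp p - w)"
  shows "has_loop_integral_at (\<lambda>p. F p / (exp p - w)) e (cauchy_loop e w)"
proof -
  obtain M where M: "\<And>k A. continuous_on (loop_set e) k \<Longrightarrow>
       (\<And>p. p \<in> loop_set e \<Longrightarrow> norm (k p) \<le> A * exp (- (3 / 4) * Re p)) \<Longrightarrow>
       \<exists>I. has_loop_integral_at (\<lambda>p. F p * k p) e I \<and> norm I \<le> A * M"
    using kernel_integral[OF e] by metis
  have nz: "exp p - w \<noteq> 0" if "p \<in> loop_set e" for p using c(2)[OF that] c(1)
    by (metis exp_gt_zero linorder_not_less mult_pos_pos norm_zero)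
  have "continuous_on (loop_set e) (\<lambda>p. 1 / (exp p - w))"
    using nz by (intro continuous_intros) auto
  moreover have "norm (1 / (exp p - w)) \<le> (exp (1/4) / c) * exp (- (3 / 4) * Re p)" if p: "p \<in> loop_set e" for p
  proof -
    have "norm (1 / (exp p - w)) \<le> 1 / (c * exp (Re p))"
      using c(1) c(2)[OF p] by (simp add: norm_divide frac_le)
    also have "\<dots> = exp (- (3 / 4 + 1 / 4) * Re p) / c" by (simp add: exp_minus divide_simps)
    also have "\<dots> \<le> (exp (1/4) * exp (- (3 / 4) * Re p)) / c"
      using exp_minus_le[OF p e, of "1/4"] c by (intro divide_right_mono) auto
    finally show ?thesis by simp
  qed
  ultimately obtain I where "has_loop_integral_at (\<lambda>p. F p * (1 / (exp p - w))) e I" using M by blast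
  then have "has_loop_integral_at (\<lambda>p. F p / (exp p - w)) e I" by simp
  then show ?thesis using cauchy_loop_eq by metis
qed

text \<open>Differentiation under the integral sign is replaced by the identity \<open>1/(x - w') -
  1/(x - w) - (w' - w)/(x - w)\<^sup>2 = (w' - w)\<^sup>2 / ((x - w)\<^sup>2 * (x - w'))\<close>
  with \<open>x = exp p\<close>: the integral of the right side is quadratically small in
  \<open>w' - w\<close>.\<close>

lemma cauchy_loop_differentiable:
  assumes e: "0 < e" "e < d" and w: "w \<notin> exp ` loop_set e"
  shows "cauchy_loop e field_differentiable at w"
proof -
  obtain c r where c: "0 < c" "0 < r"
    "\<And>w' p. w' \<in> ball w r \<Longrightarrow> p \<in> loop_set e \<Longrightarrow> c * exp (Re p) \<le> norm (exp p - w')"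
    using exp_loop_separated[OF e w] by blast
  obtain M where M: "\<And>k A. continuous_on (loop_set e) k \<Longrightarrow>
       (\<And>p. p \<in> loop_set e \<Longrightarrow> norm (k p) \<le> A * exp (- (3 / 4) * Re p)) \<Longrightarrow>
       \<exists>I. has_loop_integral_at (\<lambda>p. F p * k p) e I \<and> norm I \<le> A * M"
    using kernel_integral[OF e] by metis
  have I: "has_loop_integral_at (\<lambda>p. F p / (exp p - w')) e (cauchy_loop e w')" if "w' \<in> ball w r" for w'
    using has_cauchy_loop[OF e c(1)] c(3) that by blast
  have nz: "exp p - w' \<noteq> 0" if "w' \<in> ball w r" "p \<in> loop_set e" for w' p using c(3)[OF that] c(1)
    by (metis exp_gt_zero linorder_not_less mult_pos_pos norm_zero)
  have ww: "w \<in> ball w r" using c by simp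
  have inv: "norm (1 / (exp p - w')) \<le> exp (- Re p) / c" if "w' \<in> ball w r" "p \<in> loop_set e" for w' p
  proof -
    have "norm (1 / (exp p - w')) \<le> 1 / (c * exp (Re p))"
      using c(1) c(3)[OF that] by (simp add: norm_divide frac_le)
    then show ?thesis by (simp add: exp_minus divide_simps mult_ac)
  qed
  have "continuous_on (loop_set e) (\<lambda>p. (1 / (exp p - w))\<^sup>2)"
    using nz[OF ww] by (intro continuous_intros) auto
  moreover have "norm ((1 / (exp p - w))\<^sup>2) \<le> (exp (5/4) / c\<^sup>2) * exp (- (3 / 4) * Re p)" if p: "p \<in> loop_set e" for p
  proof -
    have "norm ((1 / (exp p - w))\<^sup>2) \<le> (exp (- Re p) / c)\<^sup>2"
      unfolding norm_power using inv[OF ww p] by (intro power_mono) auto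
    also have "\<dots> = exp (- (3 / 4 + 5 / 4) * Re p) / c\<^sup>2"
      by (simp add: power_divide power2_eq_square flip: exp_add)
    also have "\<dots> \<le> (exp (5/4) * exp (- (3 / 4) * Re p)) / c\<^sup>2"
      using exp_minus_le[OF p e, of "5/4"] by (intro divide_right_mono) auto
    finally show ?thesis by simp
  qed
  ultimately obtain D where D: "has_loop_integral_at (\<lambda>p. F p * (1 / (exp p - w))\<^sup>2) e D" using M by blast
  have bound: "norm (cauchy_loop e w' - cauchy_loop e w - (w' - w) * D) \<le> (norm (w' - w))\<^sup>2 * (exp (9/4) / c ^ 3 * M)"
    if w': "w' \<in> ball w r" for w'
  proof -
    let ?k = "\<lambda>p. (1 / (exp p - w))\<^sup>2 * (1 / (exp p - w'))"
    have "continuous_on (loop_set e) ?k"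
      using nz[OF ww] nz[OF w'] by (intro continuous_intros) auto
    moreover have "norm (?k p) \<le> (exp (9/4) / c ^ 3) * exp (- (3 / 4) * Re p)" if p: "p \<in> loop_set e" for p
    proof -
      have "norm (?k p) \<le> (exp (- Re p) / c)\<^sup>2 * (exp (- Re p) / c)"
        unfolding norm_mult norm_power using inv[OF ww p] inv[OF w' p] by (intro mult_mono power_mono) auto
      also have "\<dots> = exp (- (3 / 4 + 9 / 4) * Re p) / c ^ 3"
        by (simp add: power_divide power2_eq_square power3_eq_cube flip: exp_add)
      also have "\<dots> \<le> (exp (9/4) * exp (- (3 / 4) * Re p)) / c ^ 3"
        using exp_minus_le[OF p e, of "9/4"] c by (intro divide_right_mono) auto
      finally show ?thesis by simp
    qed
    ultimately obtain J where J: "has_loop_integral_at (\<lambda>p. F p * ?k p) e J" "norm J \<le> exp (9/4) / c ^ 3 * M"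
      using M by blast
    have "has_loop_integral_at (\<lambda>p. F p / (exp p - w') - F p / (exp p - w) - (w' - w) * (F p * (1 / (exp p - w))\<^sup>2)) e
       (cauchy_loop e w' - cauchy_loop e w - (w' - w) * D)"
      by (intro has_loop_integral_at_diff has_loop_integral_at_cmult I w' ww D)
    moreover have "has_loop_integral_at (\<lambda>p. F p / (exp p - w') - F p / (exp p - w) - (w' - w) * (F p * (1 / (exp p - w))\<^sup>2)) e
       ((w' - w)\<^sup>2 * J)"
    proof (rule has_loop_integral_at_cong[OF _ e(1) has_loop_integral_at_cmult[OF J(1), of "(w' - w)\<^sup>2"]])
      fix p assume p: "p \<in> loop_set e"
      have "1 / (exp p - w') - 1 / (exp p - w) - (w' - w) * (1 / (exp p - w))\<^sup>2 = (w' - w)\<^sup>2 * ?k p"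
      proof -
        define a b where "a = exp p - w'" and "b = exp p - w"
        have ab: "a \<noteq> 0" "b \<noteq> 0" "w' - w = b - a" using nz[OF ww p] nz[OF w' p] by (auto simp: a_def b_def)
        then show ?thesis
          unfolding ab(3) a_def[symmetric] b_def[symmetric] by (simp add: field_simps power2_eq_square)
      qed
      then have "F p * (1 / (exp p - w') - 1 / (exp p - w) - (w' - w) * (1 / (exp p - w))\<^sup>2) = F p * ((w' - w)\<^sup>2 * ?k p)"
        by simp
      then show "(w' - w)\<^sup>2 * (F p * ?k p) =
        F p / (exp p - w') - F p / (exp p - w) - (w' - w) * (F p * (1 / (exp p - w))\<^sup>2)"
        by (simp add: algebra_simps)
    qed
    ultimately have "cauchy_loop e w' - cauchy_loop e w - (w' - w) * D = (w' - w)\<^sup>2 * J"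
      by (rule has_loop_integral_at_unique)
    then show ?thesis unfolding norm_mult norm_power using J(2) by (simp only: norm_mult norm_power mult_left_mono zero_le_power2)
  qed
  let ?M = "exp (9/4) / c ^ 3 * M"
  have "(cauchy_loop e has_field_derivative D) (at w)"
    unfolding has_field_derivative_iff
  proof (rule LIM_zero_cancel, rule Lim_null_comparison)
    show "\<forall>\<^sub>F w' in at w. norm ((cauchy_loop e w' - cauchy_loop e w) / (w' - w) - D) \<le> norm (w' - w) * ?M"
      unfolding eventually_at
    proof (intro exI[of _ r] conjI ballI impI)
      fix w' assume w': "w' \<noteq> w \<and> dist w' w < r"
      then have nw: "0 < norm (w' - w)" by simp
      have "(cauchy_loop e w' - cauchy_loop e w) / (w' - w) - D =
        (cauchy_loop e w' - cauchy_loop e w - (w' - w) * D) / (w' - w)"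
        using w' by (simp add: diff_divide_distrib)
      then have "norm ((cauchy_loop e w' - cauchy_loop e w) / (w' - w) - D) \<le> (norm (w' - w))\<^sup>2 * ?M / norm (w' - w)"
        using divide_right_mono[OF bound[of w'], of "norm (w' - w)"] w' by (simp only: norm_divide mem_ball dist_commute norm_ge_zero)
      also have "\<dots> = norm (w' - w) * ?M" using nw by (simp add: power2_eq_square)
      finally show "norm ((cauchy_loop e w' - cauchy_loop e w) / (w' - w) - D) \<le> norm (w' - w) * ?M" .
    qed (use c in simp)
    have "((\<lambda>w'. norm (w' - w) * ?M) \<longlongrightarrow> norm (w - w) * ?M) (at w)"
      by (intro tendsto_intros)
    then show "((\<lambda>w'. norm (w' - w) * ?M) \<longlongrightarrow> 0) (at w)" by simp
  qed
  then show ?thesis by (auto simp: field_differentiable_def)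
qed

section \<open>Cauchy integrals over contours of small width\<close>

text \<open>The function \<open>H\<close> of the overview in the variable
  \<open>w = z / a j\<close>. The admissible widths depend on \<open>w\<close>, so that
  \<open>w\<close> can be any point off \<open>cut1\<close>.\<close>

definition cauchy_transform :: "complex \<Rightarrow> complex" where
  "cauchy_transform w = loop_integral (\<lambda>p. F p / (exp p - w))"

lemma vanishes_right_kernel: "vanishes_right (slit d) (\<lambda>p. F p / (exp p - w))"
proof -
  obtain B X where B: "\<And>p. p \<in> slit d \<Longrightarrow> X \<le> Re p \<Longrightarrow> norm (F p) \<le> B * exp (Re p / 4)"
    using growth by blast
  define B' where "B' = max B 0"
  show ?thesis
  proof (rule vanishes_right_exp)
    fix p assume p: "p \<in> slit d" "max (max X 0) (2 * norm w) \<le> Re p"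
    have "2 * norm w \<le> exp (Re p)" using p exp_ge_add_one_self[of "Re p"] by linarith
    then have *: "exp (Re p) / 2 \<le> norm (exp p - w)" using norm_triangle_ineq2[of "exp p" w] by simp
    have "norm (F p) \<le> B' * exp (Re p / 4)"
      using B[of p] p by (auto simp: B'_def intro: order_trans mult_right_mono)
    also have "\<dots> \<le> B' * exp (Re p / 2)" using p by (intro mult_left_mono) (auto simp: B'_def)
    finally have "norm (F p / (exp p - w)) \<le> B' * exp (Re p / 2) / (exp (Re p) / 2)"
      unfolding norm_divide using * by (intro frac_le) (auto simp: B'_def)
    also have "\<dots> = 2 * B' * (exp (Re p / 2) / exp (Re p))" by simp
    also have "exp (Re p / 2) / exp (Re p) = exp (- Re p / 2)" by (simp flip: exp_diff)
    finally show "norm (F p / (exp p - w)) \<le> (2 * B') * exp (- Re p / 2)" .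
  qed
qed

lemma holomorphic_kernel:
  assumes "d' \<le> d" "\<And>p. p \<in> slit d' \<Longrightarrow> exp p \<noteq> w"
  shows "(\<lambda>p. F p / (exp p - w)) holomorphic_on slit d'"
  using assms holomorphic_on_subset[OF holomorphic slit_mono[OF assms(1)]]
  by (intro holomorphic_intros) auto

lemma has_cauchy_transform:
  assumes d': "0 < d'" "d' \<le> d" "\<And>p. p \<in> slit d' \<Longrightarrow> exp p \<noteq> w"
  shows "(\<lambda>p. F p / (exp p - w)) has_loop_integral cauchy_transform w"
    "\<And>e. 0 < e \<Longrightarrow> e < d' \<Longrightarrow> has_loop_integral_at (\<lambda>p. F p / (exp p - w)) e (cauchy_transform w)"
    "\<And>e. 0 < e \<Longrightarrow> e < d' \<Longrightarrow> cauchy_transform w = cauchy_loop e w"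
proof -
  let ?g = "\<lambda>p. F p / (exp p - w)"
  have e: "0 < d' / 2" "d' / 2 < d'" "d' / 2 < d" using d' by auto
  have "w \<notin> exp ` loop_set (d' / 2)" using loop_set_subset_slit[OF e(1,2)] d'(3) by auto
  from exp_loop_separated[OF e(1,2) this]
  obtain c r where "0 < c" "0 < r" and
    "\<And>w' p. w' \<in> ball w r \<Longrightarrow> p \<in> loop_set (d' / 2) \<Longrightarrow> c * exp (Re p) \<le> norm (exp p - w')" by blast
  then have int: "has_loop_integral_at ?g (d' / 2) (cauchy_loop (d' / 2) w)"
    by (intro has_cauchy_loop[OF e(1,3)]) auto
  note sl = holomorphic_kernel[OF d'(2,3)] vanishes_right_mono[OF vanishes_right_kernel slit_mono[OF d'(2)]] e(1,2)
  have "?g has_loop_integral (cauchy_loop (d' / 2) w)"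
    by (rule has_loop_integral_slit[OF sl int])
  then have eq: "cauchy_transform w = cauchy_loop (d' / 2) w"
    unfolding cauchy_transform_def by (rule loop_integral_eq)
  then show "?g has_loop_integral cauchy_transform w" using \<open>?g has_loop_integral _\<close> by simp
  show at: "has_loop_integral_at ?g e' (cauchy_transform w)" if "0 < e'" "e' < d'" for e'
    unfolding eq by (rule has_loop_integral_at_slit[OF sl that int])
  show "cauchy_transform w = cauchy_loop e' w" if "0 < e'" "e' < d'" for e'
    using cauchy_loop_eq[OF at[OF that]] by simp
qed

text \<open>Over a small ball around \<open>w\<close> a single width is admissible, so the transform
  coincides there with one \<open>cauchy_loop\<close>.\<close>

lemma cauchy_transform_differentiable:
  assumes "w \<notin> cut1"
  shows "cauchy_transform field_differentiable at w"
proof -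
  obtain d' r where d': "0 < d'" "d' \<le> d" "0 < r" "\<And>w' p. w' \<in> ball w r \<Longrightarrow> p \<in> slit d' \<Longrightarrow> exp p \<noteq> w'"
    using exp_slit_avoids[OF assms d(1)] by blast
  have e: "0 < d' / 2" "d' / 2 < d'" "d' / 2 < d" using d' by auto
  have "w \<notin> exp ` loop_set (d' / 2)" using loop_set_subset_slit[OF e(1,2)] d'(3) d'(4)[of w] by auto
  then obtain D where D: "(cauchy_loop (d' / 2) has_field_derivative D) (at w)"
    using cauchy_loop_differentiable[OF e(1,3)] by (auto simp: field_differentiable_def)
  have "(cauchy_transform has_field_derivative D) (at w)"
    using D
  proof (rule has_field_derivative_transform_within_open[where S = "ball w r"])
    fix w' assume "w' \<in> ball w r"
    then show "cauchy_loop (d' / 2) w' = cauchy_transform w'"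
      using has_cauchy_transform(3)[OF d'(1,2) d'(4) e(1,2)] by simp
  qed (use d' in auto)
  then show ?thesis by (auto simp: field_differentiable_def)
qed

lemma cauchy_transform_exp_subst:
  assumes "w \<notin> cut1"
  shows "(\<lambda>s. F (Ln (1 + s)) / ((1 + s) * ((1 + s) - w))) has_loop_integral cauchy_transform w"
proof -
  obtain d' r where d': "0 < d'" "d' \<le> d" "0 < r" "\<And>w' p. w' \<in> ball w r \<Longrightarrow> p \<in> slit d' \<Longrightarrow> exp p \<noteq> w'"
    using exp_slit_avoids[OF assms d(1)] by blast
  then have av: "\<And>p. p \<in> slit d' \<Longrightarrow> exp p \<noteq> w" by auto
  have "(\<lambda>s. F (Ln (1 + s)) / (exp (Ln (1 + s)) - w) / (1 + s)) has_loop_integral cauchy_transform w"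
    by (rule has_loop_integral_exp_subst[OF holomorphic_kernel[OF d'(2) av]
          vanishes_right_mono[OF vanishes_right_kernel slit_mono[OF d'(2)]] d'(1) _
          has_cauchy_transform(1)[OF d'(1,2) av]]) (use d' d in auto)
  moreover have "(\<lambda>s. F (Ln (1 + s)) / (exp (Ln (1 + s)) - w) / (1 + s)) =
     (\<lambda>s. F (Ln (1 + s)) / ((1 + s) * ((1 + s) - w)))"
  proof
    fix s
    \<comment> \<open>At \<open>s = - 1\<close> both sides are 0, because division by 0 yields
      0.\<close>
    show "F (Ln (1 + s)) / (exp (Ln (1 + s)) - w) / (1 + s) = F (Ln (1 + s)) / ((1 + s) * ((1 + s) - w))"
      by (cases "1 + s = 0") (simp_all add: mult.commute)
  qed
  ultimately show ?thesis by simp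
qed

text \<open>The narrow contour runs below the height of \<open>q = Ln w\<close>, the wide one
  encloses \<open>q\<close>. The kernel is \<open>h p / (p - q)\<close>, and \<open>E 0 = 1\<close>
  gives \<open>w * h q = F q\<close>: multiplication by \<open>w\<close> clears the factor
  \<open>1 / w\<close> from the residue.\<close>

lemma cauchy_transform_jump:
  assumes w: "w \<notin> cut1" "w \<noteq> 0" and q: "Ln w \<in> slit d" "0 \<le> Re (Ln w) \<or> norm (Ln w) < e'"
    and e: "0 < \<bar>Im (Ln w)\<bar>" "\<bar>Im (Ln w)\<bar> < e'" "e' < d"
  shows "w * cauchy_transform w = w * cauchy_loop e' w + 2 * of_real pi * \<i> * F (Ln w)"
proof -
  define q where "q = Ln w"
  have ew: "exp q = w" using w by (simp add: q_def)
  obtain E where E: "E holomorphic_on UNIV" "E 0 = 1"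
    "\<And>x. x \<noteq> 0 \<Longrightarrow> E x = (exp x - 1) / x" "\<And>x. \<bar>Im x\<bar> < 2 * pi \<Longrightarrow> E x \<noteq> 0"
    using exp_diff_quotient by blast
  define h where "h p = F p / (w * E (p - q))" for p
  have Eq: "E (p - q) \<noteq> 0" if "p \<in> slit d" for p
    using that q d pi_ge_two by (intro E(4)) (auto simp: slit_def q_def)
  have "(\<lambda>p. E (p - q)) holomorphic_on slit d"
    by (rule holomorphic_on_compose_gen[OF _ E(1), of _ "slit d", unfolded o_def])
       (auto intro!: holomorphic_intros)
  then have h: "h holomorphic_on slit d"
    unfolding h_def using Eq w by (intro holomorphic_intros holomorphic) auto
  have eq: "h p / (p - q) = F p / (exp p - w)" for p
  proof (cases "p = q")
    case False
    have "w * exp (p - q) = exp p" unfolding ew[symmetric] by (simp flip: exp_add)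
    moreover have "E (p - q) * (p - q) = exp (p - q) - 1" using E(3)[of "p - q"] False by simp
    ultimately have "w * E (p - q) * (p - q) = exp p - w"
      unfolding mult.assoc by (simp only: right_diff_distrib mult_1_right)
    then show ?thesis by (simp add: h_def)
  qed (simp add: ew)
  obtain d' r where d': "0 < d'" "d' \<le> d" "0 < r" "\<And>w' p. w' \<in> ball w r \<Longrightarrow> p \<in> slit d' \<Longrightarrow> exp p \<noteq> w'"
    using exp_slit_avoids[OF w(1) d(1)] by blast
  have van: "vanishes_right (slit d) (\<lambda>p. h p / (p - q))"
    unfolding eq by (rule vanishes_right_kernel)
  define e0 where "e0 = min d' \<bar>Im q\<bar> / 2"
  have e0: "0 < e0" "e0 < d'" "e0 < \<bar>Im q\<bar>" using d' e by (auto simp: e0_def q_def)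
  have "has_loop_integral_at (\<lambda>p. h p / (p - q)) e0 (cauchy_transform w)"
    unfolding eq by (rule has_cauchy_transform(2)[OF d'(1,2) _ e0(1,2)]) (use d' in auto)
  then have "has_loop_integral_at (\<lambda>p. h p / (p - q)) e' (cauchy_transform w - 2 * of_real pi * \<i> * h q)"
    by (intro has_loop_integral_at_jump[OF h van _ _ e0(1,3)]) (use q e in \<open>auto simp: q_def\<close>)
  then have K: "cauchy_loop e' w = cauchy_transform w - 2 * of_real pi * \<i> * h q"
    unfolding eq by (rule cauchy_loop_eq)
  have wh: "w * h q = F q" using w E(2) by (simp add: h_def)
  have "w * cauchy_transform w = w * cauchy_loop e' w + 2 * of_real pi * \<i> * (w * h q)"
    unfolding K by (simp add: algebra_simps)
  then show ?thesis unfolding wh unfolding q_def .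
qed

section \<open>Growth at infinity\<close>

text \<open>From \<open>max (norm (exp p)) (norm w) \<ge> norm w powr (1/4) * norm (exp p) powr
  (3/4)\<close>: the second factor supplies the decay that \<open>kernel_integral\<close> needs, the
  first one is the gain in \<open>w\<close>.\<close>

lemma cauchy_loop_growth:
  assumes e: "0 < e" "e < d" and c: "0 < c"
    and sep: "\<And>w p. w \<in> W \<Longrightarrow> p \<in> loop_set e \<Longrightarrow> c * max (norm (exp p)) (norm w) \<le> norm (exp p - w)"
    and W: "\<And>w. w \<in> W \<Longrightarrow> 1 \<le> norm w"
  obtains C where "0 \<le> C" "\<And>w. w \<in> W \<Longrightarrow> norm (w * cauchy_loop e w) \<le> C * norm w powr (3/4)"
proof -
  obtain M where M: "0 \<le> M" "\<And>k A. continuous_on (loop_set e) k \<Longrightarrow>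
       (\<And>p. p \<in> loop_set e \<Longrightarrow> norm (k p) \<le> A * exp (- (3 / 4) * Re p)) \<Longrightarrow>
       \<exists>I. has_loop_integral_at (\<lambda>p. F p * k p) e I \<and> norm I \<le> A * M"
    using kernel_integral[OF e] by metis
  have "norm (w * cauchy_loop e w) \<le> M / c * norm w powr (3/4)" if w: "w \<in> W" for w
  proof -
    have w1: "1 \<le> norm w" using W w by simp
    have pos: "0 < c * max (norm (exp p)) (norm w)" for p :: complex using c w1 by (intro mult_pos_pos) (auto simp: less_max_iff_disj)
    then have nz: "exp p - w \<noteq> 0" if "p \<in> loop_set e" for p using less_le_trans[OF pos sep[OF w that]] by auto
    then have "continuous_on (loop_set e) (\<lambda>p. 1 / (exp p - w))"
      by (intro continuous_intros) auto
    moreover have "norm (1 / (exp p - w)) \<le> (norm w powr (- (1/4)) / c) * exp (- (3 / 4) * Re p)"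
      if p: "p \<in> loop_set e" for p
    proof -
      have "norm w powr (1/4) * exp (3 / 4 * Re p) \<le>
         max (norm (exp p)) (norm w) powr (1/4) * max (norm (exp p)) (norm w) powr (3/4)"
      proof (intro mult_mono)
        have "exp (3 / 4 * Re p) = norm (exp p) powr (3/4)" by (simp add: exp_powr_real mult.commute)
        also have "\<dots> \<le> max (norm (exp p)) (norm w) powr (3/4)" by (intro powr_mono2) auto
        finally show "exp (3 / 4 * Re p) \<le> max (norm (exp p)) (norm w) powr (3/4)" .
      qed (auto intro: powr_mono2)
      also have "\<dots> = max (norm (exp p)) (norm w)" by (simp flip: powr_add add: max_def)
      finally have le: "c * (norm w powr (1/4) * exp (3 / 4 * Re p)) \<le> norm (exp p - w)"
        using sep[OF w p] c by (meson mult_left_mono order_trans less_imp_le)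
      have "0 < c * (norm w powr (1/4) * exp (3 / 4 * Re p))" using c w1 by (intro mult_pos_pos) auto
      then have "norm (1 / (exp p - w)) \<le> 1 / (c * (norm w powr (1/4) * exp (3 / 4 * Re p)))"
        using le by (simp only: norm_divide norm_one) (rule frac_le, auto)
      also have "\<dots> = (norm w powr (- (1/4)) / c) * exp (- (3 / 4) * Re p)"
        by (simp add: powr_minus exp_minus divide_simps)
      finally show ?thesis .
    qed
    ultimately obtain I where I: "has_loop_integral_at (\<lambda>p. F p * (1 / (exp p - w))) e I"
      "norm I \<le> (norm w powr (- (1/4)) / c) * M" using M(2) by blast
    have "cauchy_loop e w = I" using I by (intro cauchy_loop_eq) simp
    then have "norm (w * cauchy_loop e w) \<le> norm w * ((norm w powr (- (1/4)) / c) * M)"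
      unfolding norm_mult using I by (simp only: mult_left_mono norm_ge_zero)
    also have "\<dots> = M / c * (norm w powr 1 * norm w powr (- (1/4)))" using w1 by simp
    also have "norm w powr 1 * norm w powr (- (1/4)) = norm w powr (3/4)"
      unfolding powr_add[symmetric] by simp
    finally show ?thesis .
  qed
  then show ?thesis using that[of "M / c"] M c by simp
qed

lemma cauchy_transform_growth:
  obtains C W where "0 \<le> C" "1 \<le> W"
    "\<And>w. w \<notin> cut1 \<Longrightarrow> W \<le> norm w \<Longrightarrow> norm (w * cauchy_transform w) \<le> C * norm w powr (3/4)"
proof -
  \<comment> \<open>Contours of widths \<open>e\<close> and \<open>3 * e\<close> both fit into the
    strip, and the threshold \<open>2 * e\<close> for \<open>\<bar>Im (Ln w)\<bar>\<close> leaves an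
    angle of at least \<open>e\<close> to one of them.\<close>
  define e where "e = d / 5"
  have e: "0 < e" "e \<le> 1" "e < d" "3 * e < d" "5 * e = d" "e < 1/2" using d by (auto simp: e_def)
  have pi2: "2 \<le> pi" by (rule pi_ge_two)
  define c where "c = min (1/2) (sqrt (1 - cos e))"
  have "cos e < cos 0" using e pi2 by (intro cos_monotone_0_pi) auto
  then have c: "0 < c" by (simp add: c_def)
  define W1 where "W1 = {w. 2 \<le> norm w \<and> 2 * e \<le> \<bar>Im (Ln w)\<bar>}"
  define W2 where "W2 = {w. 2 \<le> norm w \<and> \<bar>Im (Ln w)\<bar> < 2 * e}"
  have Imp: "\<bar>Im (Ln w)\<bar> \<le> pi" if "w \<noteq> 0" for w
    using mpi_less_Im_Ln[OF that] Im_Ln_le_pi[OF that] by auto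
  have nz: "w \<noteq> 0" "exp (Ln w) = w" "2 \<le> exp (Re (Ln w))" if "2 \<le> norm w" for w :: complex
  proof -
    show "w \<noteq> 0" using that by auto
    then show "exp (Ln w) = w" "2 \<le> exp (Re (Ln w))" using that by auto
  qed
  obtain C1 where C1: "0 \<le> C1" "\<And>w. w \<in> W1 \<Longrightarrow> norm (w * cauchy_loop e w) \<le> C1 * norm w powr (3/4)"
  proof (rule cauchy_loop_growth[OF e(1,3) c, of W1])
    fix w p assume w: "w \<in> W1" and p: "p \<in> loop_set e"
    then have w2: "2 \<le> norm w" "2 * e \<le> \<bar>Im (Ln w)\<bar>" by (auto simp: W1_def)
    show "c * max (norm (exp p)) (norm w) \<le> norm (exp p - w)"
      using exp_loop_angle_bound[OF e(1,2,1) p nz(3)[OF w2(1)]] Imp[OF nz(1)[OF w2(1)]] w2 e pi2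
      unfolding nz(2)[OF w2(1)] c_def by (auto simp: abs_if split: if_splits)
  qed (auto simp: W1_def)
  obtain C2 where C2: "0 \<le> C2" "\<And>w. w \<in> W2 \<Longrightarrow> norm (w * cauchy_loop (3 * e) w) \<le> C2 * norm w powr (3/4)"
  proof (rule cauchy_loop_growth[OF _ e(4) c, of W2])
    fix w p assume w: "w \<in> W2" and p: "p \<in> loop_set (3 * e)"
    then have w2: "2 \<le> norm w" "\<bar>Im (Ln w)\<bar> < 2 * e" by (auto simp: W2_def)
    show "c * max (norm (exp p)) (norm w) \<le> norm (exp p - w)"
      using exp_loop_angle_bound[OF e(1,2) _ p nz(3)[OF w2(1)]] w2 e pi2
      unfolding nz(2)[OF w2(1)] c_def by (auto simp: abs_if split: if_splits)
  qed (use e in \<open>auto simp: W2_def\<close>)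
  obtain B X where B: "\<And>p. p \<in> slit d \<Longrightarrow> X \<le> Re p \<Longrightarrow> norm (F p) \<le> B * exp (Re p / 4)"
    using growth by blast
  define B' where "B' = max B 0"
  define C where "C = C1 + C2 + 2 * pi * B'"
  define W where "W = max 2 (exp X)"
  show ?thesis
  proof
    show "0 \<le> C" using C1 C2 by (simp add: C_def B'_def)
    show "1 \<le> W" by (simp add: W_def)
    fix w assume w: "w \<notin> cut1" "W \<le> norm w"
    have w2: "2 \<le> norm w" "exp X \<le> norm w" using w by (auto simp: W_def)
    note nzw = nz[OF w2(1)]
    have pp: "0 \<le> norm w powr (3/4)" by simp
    show "norm (w * cauchy_transform w) \<le> C * norm w powr (3/4)"
    proof (cases "w \<in> W1")
      case True
      have "exp p \<noteq> w" if "p \<in> slit (2 * e)" for p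
      proof
        assume "exp p = w"
        then have "Ln w = p" using Ln_exp[of p] that e pi2 by (auto simp: slit_def)
        then show False using that True by (auto simp: slit_def W1_def)
      qed
      then have "cauchy_transform w = cauchy_loop e w"
        using e by (intro has_cauchy_transform(3)[of "2 * e"]) auto
      then have "norm (w * cauchy_transform w) \<le> C1 * norm w powr (3/4)" using C1(2)[OF True] by simp
      also have "\<dots> \<le> C * norm w powr (3/4)"
        using C2 by (intro mult_right_mono pp) (auto simp: C_def B'_def)
      finally show ?thesis .
    next
      case False
      \<comment> \<open>Close to the cut the wide contour encloses \<open>Ln w\<close>, and the
        residue adds a multiple of \<open>F (Ln w)\<close>, which is only of order
        \<open>norm w powr (1/4)\<close>.\<close>
      then have W2: "w \<in> W2" using w2 by (auto simp: W1_def W2_def)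
      then have im: "\<bar>Im (Ln w)\<bar> < 2 * e" by (simp add: W2_def)
      have Re: "0 \<le> Re (Ln w)" "X \<le> Re (Ln w)" using w2 nzw by (auto simp: ln_ge_iff)
      have im0: "Im (Ln w) \<noteq> 0"
      proof
        assume "Im (Ln w) = 0"
        then have "Ln w = of_real (Re (Ln w))" by (simp add: complex_eq_iff)
        then have "w = of_real (exp (Re (Ln w)))" using nzw(2) by (metis exp_of_real)
        moreover have "1 \<le> exp (Re (Ln w))" using Re by simp
        ultimately have "w \<in> cut1" unfolding cut1_def by blast
        then show False using w by simp
      qed
      have sl: "Ln w \<in> slit d" using im im0 Re e by (auto simp: slit_def complex_nonneg_Reals_iff)
      have "norm (F (Ln w)) \<le> B * exp (Re (Ln w) / 4)" by (rule B[OF sl Re(2)])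
      also have "\<dots> \<le> B' * exp (Re (Ln w) / 4)" by (intro mult_right_mono) (auto simp: B'_def)
      also have "exp (Re (Ln w) / 4) = norm w powr (1/4)" using nzw by (simp add: powr_def)
      also have "B' * norm w powr (1/4) \<le> B' * norm w powr (3/4)"
        using w2 by (intro mult_left_mono powr_mono) (auto simp: B'_def)
      finally have "norm (2 * of_real pi * \<i> * F (Ln w)) \<le> 2 * pi * B' * norm w powr (3/4)"
        by (simp add: norm_mult)
      moreover have "w * cauchy_transform w = w * cauchy_loop (3 * e) w + 2 * of_real pi * \<i> * F (Ln w)"
        using w(1) nzw(1) sl Re im im0 e by (intro cauchy_transform_jump) auto
      ultimately have "norm (w * cauchy_transform w) \<le> C2 * norm w powr (3/4) + 2 * pi * B' * norm w powr (3/4)"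
        using C2(2)[OF W2] norm_triangle_ineq[of "w * cauchy_loop (3 * e) w" "2 * of_real pi * \<i> * F (Ln w)"] by simp
      also have "\<dots> = (C2 + 2 * pi * B') * norm w powr (3/4)" by (simp add: algebra_simps)
      also have "\<dots> \<le> C * norm w powr (3/4)" using C1 by (intro mult_right_mono pp) (auto simp: C_def)
      finally show ?thesis .
    qed
  qed
qed

section \<open>Behaviour at \<open>w = 1\<close>\<close>

text \<open>The point 1 is the image of \<open>p = 0\<close>, which the contour encloses at a
  distance. Hence the integral of fixed width is regular at the singular point, and it supplies the
  analytic part \<open>G\<close> there.\<close>

lemma cauchy_loop_near_1:
  assumes e: "0 < e" "e < d"
  obtains r where "0 < r" "\<And>w. w \<in> ball 1 r \<Longrightarrow> cauchy_loop e field_differentiable at w"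
proof -
  have "1 \<notin> exp ` loop_set e"
  proof
    assume "1 \<in> exp ` loop_set e"
    then obtain p where p: "p \<in> loop_set e" "exp p = 1" by auto
    have "\<bar>Im p\<bar> < 1" using loop_set_subset_slit[OF e] p d by (auto simp: slit_def)
    then have "Ln (exp p) = p" using pi_ge_two by (intro Ln_exp) auto
    then have "p = 0" using p by simp
    then show False using p e by (auto simp: loop_set_def)
  qed
  from exp_loop_separated[OF e this]
  obtain c r where c: "0 < c" "0 < r"
    "\<And>w' p. w' \<in> ball 1 r \<Longrightarrow> p \<in> loop_set e \<Longrightarrow> c * exp (Re p) \<le> norm (exp p - w')" by blast
  show ?thesis
  proof
    fix w assume w: "w \<in> ball (1::complex) r"
    have "w \<notin> exp ` loop_set e"
    proof
      assume "w \<in> exp ` loop_set e"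
      then obtain p where p: "p \<in> loop_set e" "w = exp p" by auto
      have "0 < c * exp (Re p)" using c by simp
      then show False using c(3)[OF w p(1)] p by simp
    qed
    then show "cauchy_loop e field_differentiable at w" by (rule cauchy_loop_differentiable[OF e])
  qed (rule c)
qed

text \<open>For real \<open>z < 0\<close> the jump formula is not available, and the identity follows from its
  validity on both sides by continuity.\<close>

lemma cauchy_transform_local:
  obtains r G where "0 < r" "G holomorphic_on ball 0 r"
    "\<And>z. norm z < r \<Longrightarrow> z \<notin> \<real>\<^sub>\<ge>\<^sub>0 \<Longrightarrow>
       (1 + z) * cauchy_transform (1 + z) = 2 * of_real pi * \<i> * F (Ln (1 + z)) + G z"
proof -
  define e where "e = d / 2"
  have e: "0 < e" "e < d" using d by (auto simp: e_def)
  obtain r1 where r1: "0 < r1" "\<And>w. w \<in> ball 1 r1 \<Longrightarrow> cauchy_loop e field_differentiable at w"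
    using cauchy_loop_near_1[OF e] by blast
  have "isCont Ln (1::complex)" by (intro continuous_intros) auto
  then have "((\<lambda>w. Ln w) \<longlongrightarrow> Ln 1) (at (1::complex))" by (simp add: isCont_def)
  \<comment> \<open>Near 1 the logarithm has modulus below \<open>e\<close>, so \<open>Ln w\<close>
    is enclosed by the contour even when its real part is negative.\<close>
  then obtain r2 where r2: "0 < r2" "\<And>w. w \<noteq> 1 \<Longrightarrow> dist w 1 < r2 \<Longrightarrow> dist (Ln w) (Ln 1) < e"
    using e unfolding tendsto_iff eventually_at by (metis UNIV_I)
  define r where "r = min 1 (min r1 r2)"
  have r: "0 < r" "r \<le> 1" "r \<le> r1" "r \<le> r2" using r1 r2 by (auto simp: r_def)
  define G where "G z = (1 + z) * cauchy_loop e (1 + z)" for z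
  \<comment> \<open>The defect of the claimed identity; off the real axis it vanishes by the jump
    formula.\<close>
  define A where "A z = (1 + z) * cauchy_transform (1 + z) - 2 * of_real pi * \<i> * F (Ln (1 + z)) - G z" for z
  have pt: "1 + z \<notin> cut1" "1 + z \<noteq> 0" "norm (Ln (1 + z)) < e" "Ln (1 + z) \<in> slit d" "1 + z \<notin> \<real>\<^sub>\<le>\<^sub>0"
    if z: "norm z < r" "z \<notin> \<real>\<^sub>\<ge>\<^sub>0" for z
  proof -
    show "1 + z \<notin> cut1"
    proof
      assume "1 + z \<in> cut1"
      then obtain t where t: "1 \<le> t" "1 + z = of_real t" by (auto simp: cut1_def)
      then have "z = of_real (t - 1)" by (simp add: algebra_simps)
      moreover have "complex_of_real (t - 1) \<in> \<real>\<^sub>\<ge>\<^sub>0" by (subst nonneg_Reals_of_real_iff) (use t in simp)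
      ultimately show False using z by simp
    qed
    have "0 < Re (1 + z)" using abs_Re_le_cmod[of z] z r by simp
    then show nr: "1 + z \<notin> \<real>\<^sub>\<le>\<^sub>0" by (auto simp: complex_nonpos_Reals_iff)
    then show nz: "1 + z \<noteq> 0" by auto
    have "z \<noteq> 0" using z by auto
    then show n: "norm (Ln (1 + z)) < e" using r2(2)[of "1 + z"] z r by (simp add: dist_norm)
    have "Ln (1 + z) \<notin> \<real>\<^sub>\<ge>\<^sub>0"
    proof
      assume "Ln (1 + z) \<in> \<real>\<^sub>\<ge>\<^sub>0"
      then obtain x where x: "Ln (1 + z) = of_real x" "0 \<le> x" by (auto elim: nonneg_Reals_cases)
      then have "1 + z = of_real (exp x)" using nz by (metis exp_Ln exp_of_real)
      moreover have "1 \<le> exp x" using x by simp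
      ultimately have "1 + z \<in> cut1" unfolding cut1_def by blast
      with \<open>1 + z \<notin> cut1\<close> show False by simp
    qed
    then show "Ln (1 + z) \<in> slit d"
      using n e abs_Im_le_cmod[of "Ln (1 + z)"] abs_Re_le_cmod[of "Ln (1 + z)"] by (auto simp: slit_def)
  qed
  have offreal: "A z = 0" if z: "norm z < r" "Im z \<noteq> 0" for z
  proof -
    have nn: "z \<notin> \<real>\<^sub>\<ge>\<^sub>0" using z by (auto simp: complex_nonneg_Reals_iff)
    note p = pt[OF z(1) nn]
    have "Im (Ln (1 + z)) \<noteq> 0"
    proof
      assume "Im (Ln (1 + z)) = 0"
      then have "Ln (1 + z) = of_real (Re (Ln (1 + z)))" by (simp add: complex_eq_iff)
      then have "1 + z = of_real (exp (Re (Ln (1 + z))))" using p(2) by (metis exp_Ln exp_of_real)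
      then have "Im (1 + z) = 0" by (metis Im_complex_of_real)
      then show False using z by simp
    qed
    then show ?thesis
      unfolding A_def G_def using p e abs_Im_le_cmod[of "Ln (1 + z)"]
      by (subst cauchy_transform_jump[where e' = e]) auto
  qed
  have all: "A z = 0" if z: "norm z < r" "z \<notin> \<real>\<^sub>\<ge>\<^sub>0" for z
  proof (cases "Im z = 0")
    case True
    note p = pt[OF z]
    have "isCont cauchy_transform (1 + z)"
      by (intro field_differentiable_imp_continuous_at cauchy_transform_differentiable p)
    moreover have "isCont (cauchy_loop e) (1 + z)"
      using z r by (intro field_differentiable_imp_continuous_at r1(2)) (simp add: dist_norm)
    moreover have "isCont F (Ln (1 + z))"
      using holomorphic_on_imp_continuous_on[OF holomorphic] p open_slit continuous_on_eq_continuous_at by blast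
    ultimately have "isCont A z"
      unfolding A_def G_def using p
      by (intro continuous_intros isCont_o2[where f = "\<lambda>z. 1 + z" and g = cauchy_transform]
          isCont_o2[where f = "\<lambda>z. 1 + z" and g = "cauchy_loop e"] isCont_o2[where f = "\<lambda>z. Ln (1 + z)" and g = F]) auto
    moreover have "((\<lambda>t::real. z + \<i> * of_real t) \<longlongrightarrow> z + \<i> * of_real 0) (at_right 0)"
      by (intro tendsto_intros)
    ultimately have "((\<lambda>t. A (z + \<i> * of_real t)) \<longlongrightarrow> A z) (at_right 0)"
      using isCont_tendsto_compose by fastforce
    moreover have "\<forall>\<^sub>F t in at_right 0. A (z + \<i> * of_real t) = 0"
      unfolding eventually_at_right_field
    proof (intro exI[of _ "r - norm z"] conjI allI impI)
      fix t :: real assume t: "0 < t" "t < r - norm z"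
      have "norm (z + \<i> * of_real t) \<le> norm z + t" using norm_triangle_ineq[of z "\<i> * of_real t"] t by (simp add: norm_mult)
      then show "A (z + \<i> * of_real t) = 0" using t True by (intro offreal) auto
    qed (use z in simp)
    then have "((\<lambda>t. A (z + \<i> * of_real t)) \<longlongrightarrow> 0) (at_right 0)" by (rule tendsto_eventually)
    ultimately show ?thesis by (rule tendsto_unique[OF trivial_limit_at_right_real])
  qed (use offreal z in blast)
  show ?thesis
  proof
    have "(\<lambda>z. cauchy_loop e (1 + z)) field_differentiable at z" if "z \<in> ball 0 r" for z
    proof -
      have "cauchy_loop e field_differentiable at (1 + z)"
        using that r by (intro r1(2)) (simp add: dist_norm)
      moreover have "(\<lambda>z. 1 + z) field_differentiable at z" by (intro derivative_intros)
      ultimately show ?thesis using field_differentiable_compose[of "\<lambda>z. 1 + z" z "cauchy_loop e"] by (simp add: o_def)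
    qed
    then have "(\<lambda>z. cauchy_loop e (1 + z)) holomorphic_on ball 0 r"
      by (auto simp: holomorphic_on_def intro: field_differentiable_at_within)
    then show "G holomorphic_on ball 0 r" unfolding G_def by (intro holomorphic_intros)
    show "(1 + z) * cauchy_transform (1 + z) = 2 * of_real pi * \<i> * F (Ln (1 + z)) + G z"
      if "norm z < r" "z \<notin> \<real>\<^sub>\<ge>\<^sub>0" for z
      using all[OF that] by (simp add: A_def algebra_simps)
  qed (rule r)
qed

section \<open>Moments and Taylor coefficients\<close>

lemma has_loop_integral_moment:
  assumes k: "1 \<le> k" and e: "0 < e" "e < d"
  shows "has_loop_integral_at (\<lambda>p. exp (- of_nat k * p) * F p) e (loop_integral (\<lambda>p. exp (- of_nat k * p) * F p))"
proof -
  let ?g = "\<lambda>p. exp (- of_nat k * p) * F p"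
  have hol: "?g holomorphic_on slit d" by (intro holomorphic_intros holomorphic)
  obtain B X where B: "\<And>p. p \<in> slit d \<Longrightarrow> X \<le> Re p \<Longrightarrow> norm (F p) \<le> B * exp (Re p / 4)"
    using growth by blast
  have van: "vanishes_right (slit d) ?g"
  proof (rule vanishes_right_exp)
    fix p assume p: "p \<in> slit d" "max X 0 \<le> Re p"
    have "norm (?g p) \<le> exp (- (real k * Re p)) * (B * exp (Re p / 4))"
      unfolding norm_mult using B[of p] p by (intro mult_mono) auto
    also have "\<dots> = B * exp (- (real k * Re p) + Re p / 4)" unfolding exp_add by (simp only: mult_ac)
    also have "\<dots> \<le> B * exp (- Re p / 2)"
    proof (rule mult_left_mono)
      have "0 \<le> B * exp (Re p / 4)" by (rule order_trans[OF norm_ge_zero B]) (use p in auto)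
      then show "0 \<le> B" by (simp add: zero_le_mult_iff)
      have "1 * Re p \<le> real k * Re p" using k p by (intro mult_right_mono) auto
      then show "exp (- (real k * Re p) + Re p / 4) \<le> exp (- Re p / 2)" using p by simp
    qed
    finally show "norm (?g p) \<le> B * exp (- Re p / 2)" .
  qed
  obtain M where M: "\<And>k A. continuous_on (loop_set e) k \<Longrightarrow>
       (\<And>p. p \<in> loop_set e \<Longrightarrow> norm (k p) \<le> A * exp (- (3 / 4) * Re p)) \<Longrightarrow>
       \<exists>I. has_loop_integral_at (\<lambda>p. F p * k p) e I \<and> norm I \<le> A * M"
    using kernel_integral[OF e] by metis
  have "continuous_on (loop_set e) (\<lambda>p. exp (- of_nat k * p))" by (intro continuous_intros)
  moreover have "norm (exp (- of_nat k * p)) \<le> exp (real k - 3 / 4) * exp (- (3 / 4) * Re p)" if p: "p \<in> loop_set e" for p :: complex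
    using exp_minus_le[OF p e, of "real k - 3 / 4"] k by simp
  ultimately obtain I where "has_loop_integral_at (\<lambda>p. F p * exp (- of_nat k * p)) e I" using M by blast
  then have I: "has_loop_integral_at ?g e I" by (simp add: mult.commute)
  have "?g has_loop_integral I" by (rule has_loop_integral_slit[OF hol van e I])
  then show ?thesis using I loop_integral_eq by metis
qed

text \<open>Geometric series in \<open>w * exp (- p)\<close>, whose modulus is at most
  \<open>1 / 2\<close> because \<open>Re p > - 1\<close>; this is the origin of
  \<open>exp (- 1) / 2\<close>. Only finite sums are integrated: the remainder kernel carries the
  factor \<open>(w * exp (- p)) ^ n\<close>, so its integral is
  \<open>O((1 / 2) ^ n)\<close>.\<close>

lemma cauchy_transform_power_series:
  assumes w: "norm w < exp (- 1) / 2"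
  shows "(\<lambda>k. w ^ Suc k * loop_integral (\<lambda>p. exp (- of_nat (Suc k) * p) * F p)) sums (w * cauchy_transform w)"
proof -
  define e where "e = d / 2"
  have e: "0 < e" "e < d" using d by (auto simp: e_def)
  let ?C = "\<lambda>k. loop_integral (\<lambda>p. exp (- of_nat k * p) * F p)"
  have small: "norm (w * exp (- p)) \<le> 1 / 2" if p: "- d < Re p" for p
  proof -
    have "norm w * exp (- Re p) \<le> (exp (- 1) / 2) * exp 1"
      using w p d by (intro mult_mono) auto
    also have "\<dots> = 1 / 2" by (simp flip: exp_add)
    finally show ?thesis by (simp add: norm_mult)
  qed
  have sep: "exp (Re p) / 2 \<le> norm (exp p - w)" if p: "- d < Re p" for p
  proof -
    have "exp p - w = exp p * (1 - w * exp (- p))" by (simp add: algebra_simps flip: exp_add)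
    then have "norm (exp p - w) = exp (Re p) * norm (1 - w * exp (- p))" by (simp add: norm_mult)
    moreover have "1 / 2 \<le> norm (1 - w * exp (- p))"
      using norm_triangle_ineq2[of 1 "w * exp (- p)"] small[OF p] by simp
    then have "exp (Re p) * (1 / 2) \<le> exp (Re p) * norm (1 - w * exp (- p))"
      by (rule mult_left_mono) simp
    ultimately show ?thesis by simp
  qed
  have av: "exp p \<noteq> w" if "- d < Re p" for p using sep[OF that] by (metis diff_self exp_gt_zero half_gt_zero linorder_not_less norm_zero)
  have T: "has_loop_integral_at (\<lambda>p. F p / (exp p - w)) e (cauchy_transform w)"
    by (rule has_cauchy_transform(2)[of d]) (use d e av in \<open>auto simp: slit_def\<close>)
  obtain M where M: "0 \<le> M" "\<And>k A. continuous_on (loop_set e) k \<Longrightarrow>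
       (\<And>p. p \<in> loop_set e \<Longrightarrow> norm (k p) \<le> A * exp (- (3 / 4) * Re p)) \<Longrightarrow>
       \<exists>I. has_loop_integral_at (\<lambda>p. F p * k p) e I \<and> norm I \<le> A * M"
    using kernel_integral[OF e] by metis
  have rem: "norm (w * cauchy_transform w - (\<Sum>k<n. w ^ Suc k * ?C (Suc k))) \<le> (1 / 2) ^ n * (2 * norm w * exp (1/4) * M)" for n
  proof -
    let ?k = "\<lambda>p. (w * exp (- p)) ^ n * (w / (exp p - w))"
    have Rp: "- d < Re p" if "p \<in> loop_set e" for p using loop_set_subset_slit[OF e] that by (auto simp: slit_def)
    have "continuous_on (loop_set e) ?k" using av Rp by (intro continuous_intros) auto
    moreover have "norm (?k p) \<le> ((1 / 2) ^ n * (2 * norm w * exp (1/4))) * exp (- (3 / 4) * Re p)" if p: "p \<in> loop_set e" for p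
    proof -
      have "norm (w / (exp p - w)) \<le> norm w / (exp (Re p) / 2)"
        unfolding norm_divide using sep[OF Rp[OF p]] by (intro divide_left_mono mult_pos_pos) (auto intro: order.strict_trans2)
      also have "\<dots> = 2 * norm w * exp (- (3 / 4 + 1 / 4) * Re p)" by (simp add: exp_minus divide_simps)
      also have "\<dots> \<le> 2 * norm w * (exp (1/4) * exp (- (3 / 4) * Re p))"
        using exp_minus_le[OF p e, of "1/4"] by (intro mult_left_mono) auto
      finally have 1: "norm (w / (exp p - w)) \<le> 2 * norm w * exp (1/4) * exp (- (3 / 4) * Re p)" by simp
      have "norm ((w * exp (- p)) ^ n) \<le> (1 / 2) ^ n"
        unfolding norm_power using small[OF Rp[OF p]] by (intro power_mono) auto
      then have "norm (?k p) \<le> (1 / 2) ^ n * (2 * norm w * exp (1/4) * exp (- (3 / 4) * Re p))"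
        unfolding norm_mult using 1 by (intro mult_mono) auto
      then show ?thesis by (simp only: mult_ac)
    qed
    ultimately obtain J where J: "has_loop_integral_at (\<lambda>p. F p * ?k p) e J"
      "norm J \<le> ((1 / 2) ^ n * (2 * norm w * exp (1/4))) * M" using M(2) by blast
    have "has_loop_integral_at (\<lambda>p. w * (F p / (exp p - w)) - (\<Sum>k<n. w ^ Suc k * (exp (- of_nat (Suc k) * p) * F p))) e
       (w * cauchy_transform w - (\<Sum>k<n. w ^ Suc k * ?C (Suc k)))"
      by (intro has_loop_integral_at_diff has_loop_integral_at_sum has_loop_integral_at_cmult T
          has_loop_integral_moment e) auto
    then have "has_loop_integral_at (\<lambda>p. F p * ?k p) e (w * cauchy_transform w - (\<Sum>k<n. w ^ Suc k * ?C (Suc k)))"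
    proof (rule has_loop_integral_at_cong[OF _ e(1), rotated])
      fix p assume p: "p \<in> loop_set e"
      define x where "x = w * exp (- p)"
      have nz: "exp p - w \<noteq> 0" using av[OF Rp[OF p]] by simp
      have x1: "x \<noteq> 1" using small[OF Rp[OF p]] by (auto simp: x_def)
      have "exp p - w = exp p * (1 - x)" by (simp add: x_def algebra_simps flip: exp_add)
      then have wx: "w / (exp p - w) = x / (1 - x)" by (simp add: x_def exp_minus field_simps)
      have "w ^ Suc k * exp (- of_nat (Suc k) * p) = x * x ^ k" for k
        unfolding x_def by (simp add: power_mult_distrib exp_of_nat_mult[symmetric] exp_add[symmetric] algebra_simps)
      then have "(\<Sum>k<n. w ^ Suc k * (exp (- of_nat (Suc k) * p) * F p)) = (\<Sum>k<n. x ^ k) * x * F p"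
        by (simp add: sum_distrib_left sum_distrib_right mult_ac)
      also have "(\<Sum>k<n. x ^ k) = (1 - x ^ n) / (1 - x)" using x1 by (simp add: sum_gp_strict)
      finally have s: "(\<Sum>k<n. w ^ Suc k * (exp (- of_nat (Suc k) * p) * F p)) = (1 - x ^ n) / (1 - x) * x * F p" .
      have "w * (F p / (exp p - w)) - (\<Sum>k<n. w ^ Suc k * (exp (- of_nat (Suc k) * p) * F p)) =
          F p * (w / (exp p - w)) - (1 - x ^ n) / (1 - x) * x * F p" unfolding s by simp
      also have "(1 - x ^ n) / (1 - x) * x * F p = F p * ((1 - x ^ n) * (x / (1 - x)))" by simp
      also have "F p * (w / (exp p - w)) - F p * ((1 - x ^ n) * (x / (1 - x))) = F p * (x ^ n * (x / (1 - x)))"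
        unfolding wx by (simp only: left_diff_distrib right_diff_distrib mult_1_left) simp
      finally show "w * (F p / (exp p - w)) - (\<Sum>k<n. w ^ Suc k * (exp (- of_nat (Suc k) * p) * F p)) = F p * ?k p"
        unfolding x_def[symmetric] wx .
    qed
    then have "w * cauchy_transform w - (\<Sum>k<n. w ^ Suc k * ?C (Suc k)) = J"
      by (rule has_loop_integral_at_unique[OF _ J(1)])
    then show ?thesis using J(2) by (simp add: mult_ac)
  qed
  have "(\<lambda>n. (1 / 2) ^ n * (2 * norm w * exp (1/4) * M)) \<longlonglongrightarrow> 0"
    by (intro tendsto_mult_left_zero LIMSEQ_power_zero) simp
  then have "(\<lambda>n. w * cauchy_transform w - (\<Sum>k<n. w ^ Suc k * ?C (Suc k))) \<longlonglongrightarrow> 0"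
    by (rule Lim_null_comparison[OF always_eventually, rotated]) (use rem in blast)
  then have "(\<lambda>n. w * cauchy_transform w - (w * cauchy_transform w - (\<Sum>k<n. w ^ Suc k * ?C (Suc k)))) \<longlonglongrightarrow> w * cauchy_transform w - 0"
    by (intro tendsto_intros)
  then show ?thesis unfolding sums_def by simp
qed

end

section \<open>The cut plane in the logarithmic variable\<close>

lemma cut_plane_iff:
  assumes "\<forall>j\<in>{1..N}. a j \<noteq> 0"
  shows "z \<in> cut_plane a N \<longleftrightarrow> (\<forall>j\<in>{1..N}. z / a j \<notin> cut1)"
proof -
  have "(\<exists>t. z = a j * complex_of_real t \<and> 1 \<le> t) \<longleftrightarrow> z / a j \<in> cut1" if "j \<in> {1..N}" for j
    using assms that by (auto simp: cut1_def field_simps)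
  then show ?thesis unfolding cut_plane_def cuts_def by auto
qed

lemma open_cut_plane:
  assumes "\<forall>j\<in>{1..N}. a j \<noteq> 0"
  shows "open (cut_plane a N)"
proof -
  have "cut_plane a N = - (\<Union>j\<in>{1..N}. (\<lambda>z. z / a j) -` cut1)"
    using cut_plane_iff[OF assms] by auto
  moreover have "closed (\<Union>j\<in>{1..N}. (\<lambda>z. z / a j) -` cut1)"
    by (intro closed_UN closed_vimage closed_cut1 ballI continuous_intros) (use assms in auto)
  ultimately show ?thesis by (simp only: open_Compl)
qed

lemma zero_in_cut_plane: "\<forall>j\<in>{1..N}. a j \<noteq> 0 \<Longrightarrow> 0 \<in> cut_plane a N"
  by (auto simp: cut_plane_iff cut1_def)

text \<open>If a multiple of \<open>z\<close> by some \<open>u\<close> with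
  \<open>0 < u \<le> 1\<close> lies on a cut, then \<open>z\<close> lies at least as far out on the
  same cut.\<close>

lemma cut_plane_segment:
  assumes a: "\<forall>j\<in>{1..N}. a j \<noteq> 0" and z: "z \<in> cut_plane a N"
  shows "closed_segment 0 z \<subseteq> cut_plane a N"
proof
  fix x assume "x \<in> closed_segment 0 z"
  then obtain u where u: "0 \<le> u" "u \<le> 1" "x = u *\<^sub>R z" by (auto simp: in_segment)
  have "x / a j \<notin> cut1" if j: "j \<in> {1..N}" for j
  proof
    assume "x / a j \<in> cut1"
    then obtain t where t: "1 \<le> t" "of_real u * (z / a j) = of_real t"
      using u by (auto simp: cut1_def scaleR_conv_of_real)
    then have u0: "u > 0" using u by (cases "u = 0") auto
    then have "z / a j = of_real (t / u)" using t by (simp add: field_simps)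
    moreover have "1 \<le> t / u" using t u u0 by (simp add: le_divide_eq)
    ultimately have "z / a j \<in> cut1" unfolding cut1_def by blast
    then show False using z j by (simp add: cut_plane_iff[OF a])
  qed
  then show "x \<in> cut_plane a N" by (simp add: cut_plane_iff[OF a])
qed

lemma starlike_cut_plane:
  assumes "\<forall>j\<in>{1..N}. a j \<noteq> 0"
  shows "starlike (cut_plane a N)"
  unfolding starlike_def using zero_in_cut_plane[OF assms] cut_plane_segment[OF assms] by blast

lemma Arg_eq_of_pos_multiple:
  assumes "x = of_real t * y" "0 < t"
  shows "Arg x = Arg y"
  using assms Arg_times_of_real[of t y] by simp

lemma slit_subset_half_strip: "slit d \<subseteq> half_strip d - \<real>\<^sub>\<ge>\<^sub>0"
  by (auto simp: slit_def half_strip_def)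

lemma algebraically_bounded_on_growth:
  assumes "algebraically_bounded_on S F" "slit d \<subseteq> S" "d \<le> 1"
  shows "\<exists>B X. \<forall>p\<in>slit d. X \<le> Re p \<longrightarrow> norm (F p) \<le> B * exp (Re p / 4)"
proof -
  obtain C m R where C: "\<And>z. z \<in> S \<Longrightarrow> R \<le> norm z \<Longrightarrow> norm (F z) \<le> C * norm z ^ m"
    using assms(1) unfolding algebraically_bounded_on_def by blast
  \<comment> \<open>With \<open>4 * m \<le> M\<close>, the bound
    \<open>Re p + 1 \<le> M * exp (Re p / M)\<close> raised to the power \<open>m\<close> is at most
    a constant times \<open>exp (Re p / 4)\<close>; the summand 1 ensures \<open>M \<ge> 1\<close>
    for \<open>m = 0\<close>.\<close>
  define M where "M = 4 * real m + 1"
  have M: "1 \<le> M" "4 * real m \<le> M" by (auto simp: M_def)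
  have "norm (F p) \<le> \<bar>C\<bar> * M ^ m * exp (Re p / 4)" if p: "p \<in> slit d" "max R 0 \<le> Re p" for p
  proof -
    have Re: "0 \<le> Re p" using p by simp
    have "R \<le> norm p" using p abs_Re_le_cmod[of p] by linarith
    then have "norm (F p) \<le> C * norm p ^ m" using C p assms(2) by auto
    also have "\<dots> \<le> \<bar>C\<bar> * norm p ^ m" by (intro mult_right_mono) auto
    also have "norm p ^ m \<le> (M * exp (Re p / M)) ^ m"
    proof (rule power_mono)
      have "norm p \<le> Re p + 1" using cmod_le[of p] p assms(3) by (auto simp: slit_def)
      also have "\<dots> \<le> M * (1 + Re p / M)" using M by (simp add: distrib_left)
      also have "\<dots> \<le> M * exp (Re p / M)" using M by (intro mult_left_mono exp_ge_add_one_self) auto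
      finally show "norm p \<le> M * exp (Re p / M)" .
    qed simp
    also have "\<dots> = M ^ m * exp (real m * (Re p / M))" by (simp only: power_mult_distrib exp_of_nat_mult)
    also have "exp (real m * (Re p / M)) \<le> exp (Re p / 4)"
      using M Re mult_right_mono[OF M(2) Re] by (simp add: field_simps)
    finally show ?thesis using M by (simp add: mult_left_mono mult.assoc)
  qed
  then show ?thesis by blast
qed

section \<open>Primitives of \<open>f z / z ^ Suc k\<close> up to the residue\<close>

text \<open>Powers are split off one by one: the difference quotient at 0 extends holomorphically,
  so the remainder factor lives on all of \<open>S\<close> and not merely on a disc around
  0.\<close>

lemma Taylor_remainder:
  assumes "f holomorphic_on S" "open S"
  shows "\<exists>b h. h holomorphic_on S \<and> (\<forall>z\<in>S. f z = (\<Sum>i\<le>k. b i * z ^ i) + z ^ Suc k * h z)"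
proof (induction k)
  case 0
  show ?case
    by (rule exI[of _ "\<lambda>_. f 0"], rule exI[of _ "\<lambda>z. if z = 0 then deriv f 0 else (f z - f 0) / (z - 0)"])
       (auto intro: pole_lemma_open[OF assms])
next
  case (Suc k)
  then obtain b h where h: "h holomorphic_on S" "\<And>z. z \<in> S \<Longrightarrow> f z = (\<Sum>i\<le>k. b i * z ^ i) + z ^ Suc k * h z"
    by blast
  define h' where "h' z = (if z = 0 then deriv h 0 else (h z - h 0) / (z - 0))" for z
  have "h' holomorphic_on S" unfolding h'_def by (rule pole_lemma_open[OF h(1) assms(2)])
  moreover have "f z = (\<Sum>i\<le>Suc k. (b(Suc k := h 0)) i * z ^ i) + z ^ Suc (Suc k) * h' z" if "z \<in> S" for z
  proof -
    have "(\<Sum>i\<le>k. (b(Suc k := h 0)) i * z ^ i) = (\<Sum>i\<le>k. b i * z ^ i)"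
      by (rule sum.cong) auto
    moreover have "h z = h 0 + z * h' z" by (simp add: h'_def)
    then have "z ^ Suc k * h z = h 0 * z ^ Suc k + z ^ Suc (Suc k) * h' z"
      by (simp only: distrib_left power_Suc2[of z "Suc k"] mult_ac)
    ultimately show ?thesis using h(2)[OF that] by simp
  qed
  ultimately show ?case by blast
qed

text \<open>After division by \<open>z ^ Suc k\<close> the terms with \<open>i < k\<close> are
  powers with exponents below \<open>- 1\<close>, the term \<open>i = k\<close> is the subtracted
  multiple of \<open>1 / z\<close>, and the remainder factor has a primitive because
  \<open>S\<close> is starlike.\<close>

lemma Laurent_primitive:
  assumes f: "f holomorphic_on S" and S: "open S" "starlike S" "0 \<in> S"
  obtains Q where "\<And>z. z \<in> S - {0} \<Longrightarrow>
    (Q has_field_derivative (f z / z ^ Suc k - ((deriv ^^ k) f 0 / fact k) / z)) (at z)"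
proof -
  obtain b h where h: "h holomorphic_on S" "\<And>z. z \<in> S \<Longrightarrow> f z = (\<Sum>i\<le>k. b i * z ^ i) + z ^ Suc k * h z"
    using Taylor_remainder[OF f S(1)] by metis
  obtain P where P: "\<And>z. z \<in> S \<Longrightarrow> (P has_field_derivative h z) (at z)"
    using holomorphic_starlike_primitive[OF holomorphic_on_imp_continuous_on[OF h(1)] S(2,1) finite.emptyI] h(1) S(1)
    by (auto simp: holomorphic_on_open field_differentiable_def)
  define Q where "Q z = (\<Sum>i<k. b i * (z powi (int i - int k) / of_int (int i - int k))) + P z" for z
  have Q: "(Q has_field_derivative (f z / z ^ Suc k - b k / z)) (at z)" if z: "z \<in> S - {0}" for z
  proof -
    have "((\<lambda>z. b i * (z powi (int i - int k) / of_int (int i - int k))) has_field_derivative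
       b i * z ^ i / z ^ Suc k) (at z)" if i: "i < k" for i
    proof -
      have nz: "complex_of_int (int i - int k) \<noteq> 0" using i by (simp only: of_int_eq_0_iff)
      have "int i - int k - 1 = int i - int (Suc k)" by simp
      moreover have "z powi (int i - int (Suc k)) = z powi (int i) / z powi (int (Suc k))"
        using z by (intro power_int_diff) simp
      ultimately have "z powi (int i - int k - 1) = z ^ i / z ^ Suc k" by (simp only: power_int_of_nat)
      then show ?thesis using nz z
        by (auto intro!: derivative_eq_intros simp del: of_int_diff)
    qed
    then have "(Q has_field_derivative ((\<Sum>i<k. b i * z ^ i / z ^ Suc k) + h z)) (at z)"
      unfolding Q_def using z by (intro DERIV_add DERIV_sum P) auto
    moreover have "(\<Sum>i<k. b i * z ^ i / z ^ Suc k) + h z = f z / z ^ Suc k - b k / z"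
    proof -
      have "f z = (\<Sum>i<k. b i * z ^ i) + b k * z ^ k + z ^ Suc k * h z"
        using h(2)[of z] z by (simp add: lessThan_Suc_atMost[symmetric])
      then have "f z / z ^ Suc k = (\<Sum>i<k. b i * z ^ i) / z ^ Suc k + b k * z ^ k / z ^ Suc k + z ^ Suc k * h z / z ^ Suc k"
        by (simp only: add_divide_distrib)
      also have "z ^ Suc k * h z / z ^ Suc k = h z" using z by simp
      also have "b k * z ^ k / z ^ Suc k = b k / z" using z by simp
      finally show ?thesis by (simp only: sum_divide_distrib) simp
    qed
    ultimately show ?thesis by simp
  qed
  \<comment> \<open>\<open>Taylor_remainder\<close> leaves its coefficients unidentified. Since
    \<open>Q\<close> is a primitive, the integral over a small circle vanishes, and comparison with
    the Cauchy formula yields \<open>b k\<close>.\<close>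
  obtain r where r: "0 < r" "cball 0 r \<subseteq> S" using S open_contains_cball by blast
  have sph: "path_image (circlepath 0 r) \<subseteq> S - {0}" using r by auto
  have "((\<lambda>z. f z / z ^ Suc k - b k / z) has_contour_integral 0) (circlepath 0 r)"
    by (rule Cauchy_theorem_primitive[OF has_field_derivative_at_within[OF Q] _ sph]) auto
  moreover have "((\<lambda>u. b k / (u - 0) ^ Suc 0) has_contour_integral (2 * pi * \<i> / fact 0 * (deriv ^^ 0) (\<lambda>_. b k) 0)) (circlepath 0 r)"
    by (rule Cauchy_has_contour_integral_higher_derivative_circlepath) (use r in auto)
  ultimately have "((\<lambda>z. (f z / z ^ Suc k - b k / z) + b k / (z - 0) ^ Suc 0) has_contour_integral
      (0 + (2 * pi * \<i> / fact 0 * (deriv ^^ 0) (\<lambda>_. b k) 0))) (circlepath 0 r)"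
    by (rule has_contour_integral_add)
  then have "((\<lambda>z. f z / z ^ Suc k) has_contour_integral (2 * pi * \<i> * b k)) (circlepath 0 r)" by simp
  moreover have "((\<lambda>u. f u / (u - 0) ^ Suc k) has_contour_integral (2 * pi * \<i> / fact k * (deriv ^^ k) f 0)) (circlepath 0 r)"
  proof (rule Cauchy_has_contour_integral_higher_derivative_circlepath)
    show "continuous_on (cball 0 r) f"
      using holomorphic_on_imp_continuous_on[OF f] r continuous_on_subset by blast
    show "f holomorphic_on ball 0 r" using f r by (meson ball_subset_cball holomorphic_on_subset)
  qed (use r in auto)
  ultimately have "2 * pi * \<i> * b k = 2 * pi * \<i> / fact k * (deriv ^^ k) f 0"
    using has_contour_integral_unique by auto
  then have "b k = (deriv ^^ k) f 0 / fact k" by (simp add: field_simps)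
  then show ?thesis using that Q by metis
qed

text \<open>\<open>U\<close> and \<open>L\<close> stand for the values of a primitive at the upper
  and lower edges of horizontal cuts with heights in \<open>A\<close>. Increments across cuts and
  across gaps add up to the total from \<open>\<alpha>\<close> to \<open>\<beta>\<close>; in the
  induction the largest height \<open>b\<close> becomes the right end.\<close>

lemma telescoping_gaps:
  fixes U L :: "real \<Rightarrow> real \<Rightarrow> complex"
  assumes "finite A"
  shows "(\<And>x. x \<in> A \<Longrightarrow> \<alpha> < x) \<Longrightarrow> (\<And>x. x \<in> A \<Longrightarrow> x < \<beta>) \<Longrightarrow> \<alpha> < \<beta> \<Longrightarrow>
    (\<And>x y. x \<in> insert \<alpha> A \<Longrightarrow> y \<in> insert \<beta> A \<Longrightarrow> x < y \<Longrightarrow> A \<inter> {x<..<y} = {} \<Longrightarrow>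
       ((\<lambda>R. L y R - U x R) \<longlongrightarrow> 0) at_top) \<Longrightarrow>
    ((\<lambda>R. (\<Sum>x\<in>A. U x R - L x R) - (L \<beta> R - U \<alpha> R)) \<longlongrightarrow> 0) at_top"
  using assms
proof (induction A arbitrary: \<beta> rule: finite_linorder_max_induct)
  case empty
  then have "((\<lambda>R. L \<beta> R - U \<alpha> R) \<longlongrightarrow> 0) at_top" by simp
  from tendsto_minus[OF this] show ?case by simp
next
  case (insert b A)
  have "b \<notin> A" using insert.hyps by auto
  have "((\<lambda>R. (\<Sum>x\<in>A. U x R - L x R) - (L b R - U \<alpha> R)) \<longlongrightarrow> 0) at_top"
  proof (rule insert.IH)
    fix x y assume "x \<in> insert \<alpha> A" "y \<in> insert b A" "x < y" "A \<inter> {x<..<y} = {}"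
    moreover from this have "insert b A \<inter> {x<..<y} = {}" using insert.hyps by auto
    ultimately show "((\<lambda>R. L y R - U x R) \<longlongrightarrow> 0) at_top" by (intro insert.prems(4)) auto
  qed (use insert in auto)
  moreover have "((\<lambda>R. L \<beta> R - U b R) \<longlongrightarrow> 0) at_top"
    using insert by (intro insert.prems(4)) auto
  ultimately have "((\<lambda>R. (\<Sum>x\<in>A. U x R - L x R) - (L b R - U \<alpha> R) - (L \<beta> R - U b R)) \<longlongrightarrow> 0 - 0) at_top"
    by (rule tendsto_diff)
  moreover have "(\<Sum>x\<in>A. U x R - L x R) - (L b R - U \<alpha> R) - (L \<beta> R - U b R) =
     (\<Sum>x\<in>insert b A. U x R - L x R) - (L \<beta> R - U \<alpha> R)" for R
    using insert.hyps \<open>b \<notin> A\<close> by (simp add: algebra_simps)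
  ultimately show ?case by simp
qed

lemma distinct_Arg_not_multiple:
  assumes "\<forall>j\<in>{1..N}. a j \<noteq> 0" "inj_on (\<lambda>j. Arg (a j)) {1..N}"
    and "i \<in> {1..N}" "j \<in> {1..N}" "i \<noteq> j" "0 < t"
  shows "a j \<noteq> of_real t * a i"
  using Arg_eq_of_pos_multiple[of "a j" t "a i"] inj_onD[OF assms(2), of j i] assms(3-6) by metis

text \<open>If \<open>a j * exp s\<close> lies on the cut of \<open>a i\<close>, then
  \<open>Im s\<close> is the angle between the two directions. For \<open>i \<noteq> j\<close> the
  strip is too narrow for that; for \<open>i = j\<close> the point \<open>s\<close> would lie on the
  removed half-line.\<close>

lemma log_cut_slit:
  assumes a: "\<forall>j\<in>{1..N}. a j \<noteq> 0" and inj: "inj_on (\<lambda>j. Arg (a j)) {1..N}"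
  obtains d where "0 < d" "d \<le> 1" "\<And>j s. j \<in> {1..N} \<Longrightarrow> s \<in> slit d \<Longrightarrow> a j * exp s \<in> cut_plane a N"
proof -
  let ?P = "{(i, j). i \<in> {1..N} \<and> j \<in> {1..N} \<and> i \<noteq> j}"
  \<comment> \<open>The element 1 keeps the set nonempty for \<open>N = 1\<close> and
    \<open>d\<close> below \<open>pi\<close>.\<close>
  define D where "D = insert 1 ((\<lambda>(i, j). \<bar>Arg (a i / a j)\<bar>) ` ?P)"
  have fin: "finite ?P" by (rule finite_subset[of _ "{1..N} \<times> {1..N}"]) auto
  then have finD: "finite D" by (simp add: D_def)
  have Arg_nz: "Arg (a i / a j) \<noteq> 0" if "i \<in> {1..N}" "j \<in> {1..N}" "i \<noteq> j" for i j
  proof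
    assume "Arg (a i / a j) = 0"
    moreover have nz: "a i \<noteq> 0" "a j \<noteq> 0" using a that by auto
    ultimately obtain t where t: "0 \<le> t" "a i / a j = of_real t"
      using Arg_eq_0[of "a i / a j"] by (auto simp: complex_is_Real_iff complex_eq_iff intro!: that)
    then have "a i = of_real t * a j" using nz by (simp add: field_simps)
    moreover have "0 < t" using t nz by (cases "t = 0") auto
    ultimately show False using distinct_Arg_not_multiple[OF a inj that(2,1)] that by auto
  qed
  define d where "d = Min D"
  have "\<forall>x\<in>D. 0 < x" using Arg_nz by (auto simp: D_def)
  then have d: "0 < d" using finD by (simp add: d_def D_def)
  have d1: "d \<le> 1" using finD by (simp add: d_def D_def)
  have dP: "d \<le> \<bar>Arg (a i / a j)\<bar>" if "i \<in> {1..N}" "j \<in> {1..N}" "i \<noteq> j" for i j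
    unfolding d_def by (rule Min_le[OF finD]) (use that in \<open>force simp: D_def\<close>)
  have "a j * exp s \<in> cut_plane a N" if j: "j \<in> {1..N}" and s: "s \<in> slit d" for j s
    unfolding cut_plane_iff[OF a]
  proof (intro ballI notI)
    fix i assume i: "i \<in> {1..N}" and "a j * exp s / a i \<in> cut1"
    then obtain t where t: "1 \<le> t" "a j * exp s / a i = of_real t" by (auto simp: cut1_def)
    have nz: "a i \<noteq> 0" "a j \<noteq> 0" using a i j by auto
    have es: "exp s = of_real t * (a i / a j)" using t(2) nz by (simp add: field_simps)
    have ims: "\<bar>Im s\<bar> < d" "\<bar>Im s\<bar> < pi" using s d1 pi_ge_two by (auto simp: slit_def)
    have "Arg (exp s) = Im s" using ims by (intro Arg_exp) auto
    moreover have "Arg (exp s) = Arg (a i / a j)"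
      using es t by (intro Arg_eq_of_pos_multiple) auto
    ultimately have ar: "Im s = Arg (a i / a j)" by simp
    show False
    proof (cases "i = j")
      case False
      then show False using dP[OF i j] ar ims by simp
    next
      case True
      then have "exp s = of_real t" using es nz by simp
      moreover have "s = Ln (exp s)" using ims by (subst Ln_exp) auto
      ultimately have "s = of_real (ln t)" using t by (simp add: Ln_of_real)
      moreover have "0 \<le> ln t" using t by simp
      ultimately have "s \<in> \<real>\<^sub>\<ge>\<^sub>0" by (simp only: nonneg_Reals_of_real_iff)
      then show False using s by (simp add: slit_def)
    qed
  qed
  then show ?thesis using that d d1 by blast
qed

section \<open>The integrand in the logarithmic variable and its monodromy\<close>

lemma class_M'_small:
  assumes "f \<in> class_M' a N" "0 < c"
  obtains b where "\<And>z. z \<in> cut_plane a N \<Longrightarrow> b \<le> norm z \<Longrightarrow> norm (f z) \<le> c * norm z"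
proof -
  have "f \<in> o[inf at_infinity (principal (cut_plane a N))](\<lambda>z. z)"
    using assms(1) by (simp add: class_M'_def)
  from landau_o.smallD[OF this assms(2)]
  show ?thesis using that unfolding eventually_inf_principal eventually_at_infinity by blast
qed

text \<open>Far out \<open>norm (f (exp s)) \<le> e * exp (Re s)\<close>, and the factor
  \<open>exp (- of_nat k * s)\<close> cancels this exponential. For \<open>k = 1\<close> nothing is
  left over, so the decay comes without a rate.\<close>

lemma log_integrand_vanishes:
  assumes f: "f \<in> class_M' a N" and k: "1 \<le> k"
  shows "vanishes_right {s. exp s \<in> cut_plane a N} (\<lambda>s. exp (- of_nat k * s) * f (exp s))"
  unfolding vanishes_right_def
proof (intro allI impI)
  fix e :: real assume "0 < e"
  then obtain b where b: "\<And>z. z \<in> cut_plane a N \<Longrightarrow> b \<le> norm z \<Longrightarrow> norm (f z) \<le> e * norm z"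
    using class_M'_small[OF f] by blast
  have "norm (exp (- of_nat k * s) * f (exp s)) \<le> e"
    if s: "exp s \<in> cut_plane a N" "max 0 b \<le> Re s" for s
  proof -
    have "b \<le> norm (exp s)"
      unfolding norm_exp_eq_Re using s(2) exp_ge_add_one_self[of "Re s"] by linarith
    then have "norm (f (exp s)) \<le> e * exp (Re s)" using b[OF s(1)] by simp
    then have "norm (exp (- of_nat k * s) * f (exp s)) \<le> exp (- (real k * Re s)) * (e * exp (Re s))"
      unfolding norm_mult by (intro mult_mono) auto
    also have "\<dots> = e * exp (- (real k * Re s) + Re s)" unfolding exp_add by (simp only: mult_ac)
    also have "\<dots> \<le> e * 1"
      using mult_right_mono[of 1 "real k" "Re s"] s k \<open>0 < e\<close> by (intro mult_left_mono) auto
    finally show ?thesis by simp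
  qed
  then show "\<exists>X. \<forall>p\<in>{s. exp s \<in> cut_plane a N}. X \<le> Re p \<longrightarrow> norm (exp (- of_nat k * p) * f (exp p)) \<le> e"
    by blast
qed

text \<open>With \<open>z = exp s\<close>, the differential of \<open>z\<close> contributes the
  factor \<open>exp s\<close> that turns \<open>f z / z ^ Suc k\<close> into the integrand. The
  subtracted multiple of \<open>1 / z\<close> returns as a linear summand of \<open>\<Phi>\<close>,
  the only part that is not periodic.\<close>

lemma log_primitive:
  assumes a: "\<forall>j\<in>{1..N}. a j \<noteq> 0" and f: "f holomorphic_on cut_plane a N"
  obtains \<Phi> where "\<And>s. exp s \<in> cut_plane a N \<Longrightarrow>
      (\<Phi> has_field_derivative exp (- of_nat k * s) * f (exp s)) (at s)"
    "\<And>s. \<Phi> (s - 2 * of_real pi * \<i>) = \<Phi> s - 2 * of_real pi * \<i> * ((deriv ^^ k) f 0 / fact k)"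
proof -
  let ?c = "(deriv ^^ k) f 0 / fact k"
  obtain Q where Q: "\<And>z. z \<in> cut_plane a N - {0} \<Longrightarrow>
    (Q has_field_derivative (f z / z ^ Suc k - ?c / z)) (at z)"
    using Laurent_primitive[OF f open_cut_plane[OF a] starlike_cut_plane[OF a] zero_in_cut_plane[OF a]] by blast
  define \<Phi> where "\<Phi> s = Q (exp s) + ?c * s" for s
  show ?thesis
  proof
    fix s :: complex assume s: "exp s \<in> cut_plane a N"
    have "((\<lambda>s. Q (exp s)) has_field_derivative (f (exp s) / exp s ^ Suc k - ?c / exp s) * exp s) (at s)"
      by (rule DERIV_chain2[OF Q DERIV_exp]) (use s in simp)
    then have "(\<Phi> has_field_derivative (f (exp s) / exp s ^ Suc k - ?c / exp s) * exp s + ?c * 1) (at s)"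
      unfolding \<Phi>_def by (intro DERIV_add DERIV_cmult DERIV_ident)
    moreover have "(f (exp s) / exp s ^ Suc k - ?c / exp s) * exp s + ?c * 1 = exp (- of_nat k * s) * f (exp s)"
    proof -
      have "(f (exp s) / exp s ^ Suc k - ?c / exp s) * exp s = f (exp s) / exp s ^ k - ?c"
        by (simp add: left_diff_distrib)
      moreover have "exp s ^ k = exp (of_nat k * s)" by (rule exp_of_nat_mult[symmetric])
      ultimately show ?thesis by (simp add: exp_minus divide_inverse)
    qed
    ultimately show "(\<Phi> has_field_derivative exp (- of_nat k * s) * f (exp s)) (at s)" by simp
  next
    fix s :: complex
    have "exp (s - 2 * of_real pi * \<i>) = exp s"
      using exp_two_pi_i by (simp add: exp_diff)
    then show "\<Phi> (s - 2 * of_real pi * \<i>) = \<Phi> s - 2 * of_real pi * \<i> * ?c"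
      unfolding \<Phi>_def by (simp add: algebra_simps)
  qed
qed

text \<open>In the logarithmic variable the cuts are horizontal half-lines. The loop integrals are
  increments of a primitive across these half-lines; the increments across the gaps between
  neighbouring half-lines tend to zero, so that only the monodromy of the primitive remains.\<close>

lemma sum_log_loop_integrals:
  assumes a: "N \<ge> 1" "\<forall>j\<in>{1..N}. a j \<noteq> 0" "inj_on (\<lambda>j. Arg (a j)) {1..N}"
    and f: "f \<in> class_M' a N" and k: "1 \<le> k"
  shows "(\<lambda>s. \<Sum>j=1..N. inverse (a j ^ k) * (exp (- of_nat k * s) * f (a j * exp s)))
     has_loop_integral (2 * of_real pi * \<i> * ((deriv ^^ k) f 0 / fact k))"
proof -
  let ?J = "{1..N}" and ?D = "{s. exp s \<in> cut_plane a N}"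
  let ?c = "(deriv ^^ k) f 0 / fact k"
  let ?\<phi> = "\<lambda>s. exp (- of_nat k * s) * f (exp s)"
  have "f holomorphic_on cut_plane a N"
    using f by (auto simp: class_M'_def class_M_def intro: analytic_imp_holomorphic)
  then obtain \<Phi> where \<Phi>: "\<And>s. s \<in> ?D \<Longrightarrow> (\<Phi> has_field_derivative ?\<phi> s) (at s)"
    "\<And>s. \<Phi> (s - 2 * of_real pi * \<i>) = \<Phi> s - 2 * of_real pi * \<i> * ?c"
    using log_primitive[OF a(2)] by (metis mem_Collect_eq)
  have van: "vanishes_right ?D ?\<phi>" by (rule log_integrand_vanishes[OF f k])
  obtain d where d: "0 < d" "d \<le> 1" "\<And>j s. j \<in> ?J \<Longrightarrow> s \<in> slit d \<Longrightarrow> a j * exp s \<in> cut_plane a N"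
    using log_cut_slit[OF a(2,3)] by blast
  let ?\<theta> = "\<lambda>j. Arg (a j)"
  have "Max (?\<theta> ` ?J) \<in> ?\<theta> ` ?J" using a(1) by (intro Max_in) auto
  then obtain m where m: "m \<in> ?J" "?\<theta> m = Max (?\<theta> ` ?J)" by auto
  have le_m: "?\<theta> j \<le> ?\<theta> m" if "j \<in> ?J" for j using that unfolding m(2) by (intro Max_ge) auto
  have lt_m: "?\<theta> j < ?\<theta> m" if "j \<in> ?J - {m}" for j
    using le_m[of j] inj_onD[OF a(3), of j m] that m by fastforce
  define A where "A = ?\<theta> ` (?J - {m})"
  \<comment> \<open>The cut with the largest argument is counted at two heights,
    \<open>\<beta>\<close> and \<open>\<alpha> = \<beta> - 2 * pi\<close>; all others lie strictly
    in between, since \<open>Arg\<close> ranges over an interval of length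
    \<open>2 * pi\<close>.\<close>
  define \<alpha> where "\<alpha> = ?\<theta> m - 2 * pi"
  define \<beta> where "\<beta> = ?\<theta> m"
  have finA: "finite A" by (simp add: A_def)
  have \<alpha>A: "\<alpha> < x" if "x \<in> A" for x
    using that Arg_bounded[of "a m"] Arg_bounded unfolding A_def \<alpha>_def by (smt (verit) image_iff)
  have \<beta>A: "x < \<beta>" if "x \<in> A" for x using that lt_m unfolding A_def \<beta>_def by blast
  have \<alpha>\<beta>: "\<alpha> < \<beta>" by (simp add: \<alpha>_def \<beta>_def)
  \<comment> \<open>In the logarithmic variable the cut of \<open>a j\<close> begins at real part
    \<open>ln (norm (a j))\<close>; adding this to \<open>R\<close> matches the end of the
    \<open>j\<close>-th contour, which is truncated at \<open>R\<close> after division by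
    \<open>a j\<close>.\<close>
  define \<rho> where "\<rho> x = (if x = \<alpha> then ln (norm (a m)) else ln (norm (a (inv_into ?J ?\<theta> x))))" for x
  have \<rho>: "\<rho> (?\<theta> j) = ln (norm (a j))" if "j \<in> ?J" for j
    using that inv_into_f_f[OF a(3) that] \<alpha>A[of "?\<theta> j"] \<alpha>\<beta> by (cases "j = m") (auto simp: \<rho>_def A_def \<beta>_def)
  define gaps where "gaps = {y - x |x y. x \<in> insert \<alpha> A \<and> y \<in> insert \<beta> A \<and> x < y}"
  have "gaps \<subseteq> (\<lambda>(x, y). y - x) ` (insert \<alpha> A \<times> insert \<beta> A)" by (auto simp: gaps_def)
  then have fing: "finite gaps" using finA finite_subset by blast
  \<comment> \<open>At most every gap, so a shift by \<open>e < \<delta>\<close> away from one cut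
    does not reach the next.\<close>
  define \<delta> where "\<delta> = Min (insert d gaps)"
  have \<delta>: "0 < \<delta>" "\<delta> \<le> d" using fing d by (auto simp: \<delta>_def gaps_def)
  have \<delta>gap: "\<delta> \<le> y - x" if "x \<in> insert \<alpha> A" "y \<in> insert \<beta> A" "x < y" for x y
    unfolding \<delta>_def by (rule Min_le) (use fing that in \<open>auto simp: gaps_def\<close>)
  \<comment> \<open>Between neighbouring heights there is no logarithm of a point of a cut. Heights
    are determined only modulo \<open>2 * pi\<close>, but \<open>Im s\<close> and all the arguments
    lie in one window of that length.\<close>
  have strip: "s \<in> ?D" if xy: "x \<in> insert \<alpha> A" "y \<in> insert \<beta> A" "A \<inter> {x<..<y} = {}" and s: "x < Im s" "Im s < y" for s x y
    unfolding mem_Collect_eq cut_plane_iff[OF a(2)]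
  proof (intro ballI notI)
    fix i assume i: "i \<in> ?J" and "exp s / a i \<in> cut1"
    then obtain t where t: "1 \<le> t" "exp s / a i = of_real t" by (auto simp: cut1_def)
    then have "exp s = of_real t * a i" using a(2) i by (auto simp: field_simps)
    then have "Arg (exp s) = ?\<theta> i" using t by (intro Arg_eq_of_pos_multiple) auto
    then obtain n :: int where n: "Im s - of_int n * (2 * pi) = ?\<theta> i" using Arg_exp_diff_2pi[of s] by metis
    have "\<alpha> \<le> x" "y \<le> \<beta>" using xy \<alpha>A \<beta>A by (auto intro: less_imp_le)
    then have "?\<theta> m - 2 * pi < Im s" "Im s < ?\<theta> m" using s by (auto simp: \<alpha>_def \<beta>_def)
    moreover have "?\<theta> m - 2 * pi < ?\<theta> i" "?\<theta> i \<le> ?\<theta> m"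
      using le_m[OF i] Arg_bounded[of "a m"] Arg_bounded[of "a i"] by auto
    ultimately have "\<bar>of_int n * (2 * pi)\<bar> < 1 * (2 * pi)" using n by linarith
    then have "\<bar>real_of_int n\<bar> < 1" by (simp add: abs_mult)
    then have "n = 0" by linarith
    then have "Im s = ?\<theta> i" using n by simp
    moreover from this have "i \<noteq> m" using \<open>Im s < ?\<theta> m\<close> by auto
    ultimately have "Im s \<in> A" using i by (auto simp: A_def)
    then show False using xy(3) s by auto
  qed
  show ?thesis
  proof (rule has_loop_integralI[OF \<delta>(1)])
    fix e assume e: "0 < e" "e < \<delta>"
    define U where "U x R = \<Phi> (Complex (\<rho> x + R) (x + e))" for x R
    define L where "L x R = \<Phi> (Complex (\<rho> x + R) (x - e))" for x R
    have lim: "((\<lambda>R. (\<Sum>x\<in>A. U x R - L x R) - (L \<beta> R - U \<alpha> R)) \<longlongrightarrow> 0) at_top"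
    proof (rule telescoping_gaps[OF finA])
      fix x y assume xy: "x \<in> insert \<alpha> A" "y \<in> insert \<beta> A" "x < y" "A \<inter> {x<..<y} = {}"
      let ?T = "{s. x < Im s} \<inter> {s. Im s < y}"
      have sub: "?T \<subseteq> ?D" using strip[OF xy(1,2,4)] by auto
      have e': "e < y - x" using \<delta>gap[OF xy(1-3)] e by simp
      show "((\<lambda>R. L y R - U x R) \<longlongrightarrow> 0) at_top"
        unfolding L_def U_def
      proof (rule primitive_gap_tendsto[where \<Phi> = \<Phi>, OF _ vanishes_right_mono[OF van sub]])
        show "(\<Phi> has_field_derivative ?\<phi> p) (at p)" if "p \<in> ?T" for p using \<Phi>(1) sub that by blast
        show "convex ?T" by (intro convex_Int convex_halfspace_Im_gt convex_halfspace_Im_lt)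
        have "norm (Complex (\<rho> y + R) (y - e) - Complex (\<rho> x + R) (x + e)) \<le> \<bar>\<rho> y - \<rho> x\<bar> + \<bar>y - e - (x + e)\<bar>" for R
          using cmod_le[of "Complex (\<rho> y + R) (y - e) - Complex (\<rho> x + R) (x + e)"] by simp
        then show "\<forall>\<^sub>F R in at_top. Complex (\<rho> y + R) (y - e) \<in> ?T \<and> Complex (\<rho> x + R) (x + e) \<in> ?T \<and>
            norm (Complex (\<rho> y + R) (y - e) - Complex (\<rho> x + R) (x + e)) \<le> \<bar>\<rho> y - \<rho> x\<bar> + \<bar>y - e - (x + e)\<bar>"
          using e e' by (intro always_eventually) auto
      qed (auto intro: filterlim_tendsto_add_at_top[OF tendsto_const filterlim_ident])
    qed (use \<alpha>A \<beta>A \<alpha>\<beta> in auto)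
    \<comment> \<open>The two copies of the same cut differ by a full turn; here the monodromy of
      \<open>\<Phi>\<close> enters.\<close>
    have "Complex (\<rho> \<alpha> + R) (\<alpha> + e) = Complex (\<rho> \<beta> + R) (\<beta> + e) - 2 * of_real pi * \<i>" for R
      using \<rho>[OF m(1)] by (simp add: complex_eq_iff \<rho>_def \<alpha>_def \<beta>_def)
    then have U\<alpha>: "U \<alpha> R = U \<beta> R - 2 * of_real pi * \<i> * ?c" for R unfolding U_def using \<Phi>(2) by simp
    have sumJ: "(\<Sum>j\<in>?J. U (?\<theta> j) R - L (?\<theta> j) R) = (\<Sum>x\<in>A. U x R - L x R) + (U \<beta> R - L \<beta> R)" for R
    proof -
      have "(\<Sum>j\<in>?J. U (?\<theta> j) R - L (?\<theta> j) R) = (U \<beta> R - L \<beta> R) + (\<Sum>j\<in>?J - {m}. U (?\<theta> j) R - L (?\<theta> j) R)"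
        unfolding \<beta>_def using m by (intro sum.remove) auto
      also have "(\<Sum>j\<in>?J - {m}. U (?\<theta> j) R - L (?\<theta> j) R) = (\<Sum>x\<in>A. U x R - L x R)"
        unfolding A_def by (subst sum.reindex) (auto intro: inj_on_subset[OF a(3)])
      finally show ?thesis by simp
    qed
    have lim': "((\<lambda>R. \<Sum>j\<in>?J. U (?\<theta> j) R - L (?\<theta> j) R) \<longlongrightarrow> 2 * of_real pi * \<i> * ?c) at_top"
    proof -
      have "((\<lambda>R. (\<Sum>x\<in>A. U x R - L x R) - (L \<beta> R - U \<alpha> R) + 2 * of_real pi * \<i> * ?c) \<longlongrightarrow> 0 + 2 * of_real pi * \<i> * ?c) at_top"
        by (intro tendsto_intros lim)
      then show ?thesis unfolding sumJ U\<alpha> by (simp add: algebra_simps)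
    qed
    have int: "((\<lambda>s. \<Sum>j\<in>?J. inverse (a j ^ k) * (exp (- of_nat k * s) * f (a j * exp s))) has_contour_integral
        (\<Sum>j\<in>?J. U (?\<theta> j) R - L (?\<theta> j) R)) (loop_contour e R)" if R: "0 \<le> R" for R
    proof (rule has_contour_integral_sum)
      fix j assume j: "j \<in> ?J"
      then have nz: "a j \<noteq> 0" using a(2) by auto
      have ea: "exp (Ln (a j)) = a j" using nz by simp
      have der: "((\<lambda>s. \<Phi> (Ln (a j) + s)) has_field_derivative
          inverse (a j ^ k) * (exp (- of_nat k * s) * f (a j * exp s))) (at s)" if "s \<in> slit d" for s
      proof -
        have ex: "exp (Ln (a j) + s) = a j * exp s" by (simp add: exp_add ea)
        have "Ln (a j) + s \<in> ?D" using d(3)[OF j that] by (simp add: ex)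
        from DERIV_chain2[OF \<Phi>(1)[OF this] DERIV_add[OF DERIV_const DERIV_ident]]
        have "((\<lambda>s. \<Phi> (Ln (a j) + s)) has_field_derivative ?\<phi> (Ln (a j) + s)) (at s)" by simp
        moreover have "exp (- of_nat k * (Ln (a j) + s)) = inverse (a j ^ k) * exp (- of_nat k * s)"
        proof -
          have "exp (- of_nat k * (Ln (a j) + s)) = inverse (exp (of_nat k * Ln (a j))) * exp (- of_nat k * s)"
            by (simp add: algebra_simps flip: exp_minus exp_add)
          then show ?thesis by (simp only: exp_of_nat_mult ea)
        qed
        ultimately show ?thesis by (simp only: ex mult.assoc)
      qed
      have "e < d" using e \<delta> by simp
      from loop_contour_primitive[OF der loop_set_subset_slit[OF e(1) this] e(1) R]
      have "((\<lambda>s. inverse (a j ^ k) * (exp (- of_nat k * s) * f (a j * exp s))) has_contour_integral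
        (\<Phi> (Ln (a j) + Complex R e) - \<Phi> (Ln (a j) + Complex R (- e)))) (loop_contour e R)" .
      moreover have "Ln (a j) + Complex R y = Complex (\<rho> (?\<theta> j) + R) (?\<theta> j + y)" for y
        unfolding \<rho>[OF j] using nz by (simp add: complex_eq_iff Arg_eq_Im_Ln)
      ultimately show "((\<lambda>s. inverse (a j ^ k) * (exp (- of_nat k * s) * f (a j * exp s))) has_contour_integral
        (U (?\<theta> j) R - L (?\<theta> j) R)) (loop_contour e R)" by (simp add: U_def L_def)
    qed simp
    show "has_loop_integral_at (\<lambda>s. \<Sum>j\<in>?J. inverse (a j ^ k) * (exp (- of_nat k * s) * f (a j * exp s))) e (2 * of_real pi * \<i> * ?c)"
      unfolding has_loop_integral_at_alt
      by (intro exI[of _ "\<lambda>R. \<Sum>j\<in>?J. U (?\<theta> j) R - L (?\<theta> j) R"] conjI lim'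
          eventually_mono[OF eventually_ge_at_top[of 0]] int)
  qed
qed

text \<open>From \<open>k = 2\<close> on, one factor \<open>exp (- s)\<close> can be spent on making
  \<open>exp (- s) * f (a j * exp s)\<close> bounded far out, and the remaining exponent
  \<open>k - 1 \<ge> 1\<close> gives a convergent moment integral.\<close>

lemma log_loop_integrable:
  assumes a: "\<forall>j\<in>{1..N}. a j \<noteq> 0" "inj_on (\<lambda>j. Arg (a j)) {1..N}"
    and f: "f \<in> class_M' a N" and k: "2 \<le> k" and j: "j \<in> {1..N}"
  shows "loop_integrable (\<lambda>s. exp (- of_nat k * s) * f (a j * exp s))"
proof -
  obtain d where d: "0 < d" "d \<le> 1" "\<And>j s. j \<in> {1..N} \<Longrightarrow> s \<in> slit d \<Longrightarrow> a j * exp s \<in> cut_plane a N"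
    using log_cut_slit[OF a] by blast
  define F where "F s = exp (- s) * f (a j * exp s)" for s
  have nz: "a j \<noteq> 0" using a j by auto
  have hf: "f holomorphic_on cut_plane a N"
    using f by (auto simp: class_M'_def class_M_def intro: analytic_imp_holomorphic)
  interpret loop_density d F
  proof
    have "(\<lambda>s. f (a j * exp s)) holomorphic_on slit d"
      by (rule holomorphic_on_compose_gen[OF _ hf, unfolded o_def])
         (use d(3)[OF j] in \<open>auto intro!: holomorphic_intros\<close>)
    then show "F holomorphic_on slit d" unfolding F_def by (intro holomorphic_intros)
    obtain b where b: "\<And>z. z \<in> cut_plane a N \<Longrightarrow> b \<le> norm z \<Longrightarrow> norm (f z) \<le> 1 * norm z"
      using class_M'_small[OF f, of 1] by auto
    have "norm (F s) \<le> norm (a j) * exp (Re s / 4)" if s: "s \<in> slit d" "max 0 (b / norm (a j)) \<le> Re s" for s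
    proof -
      have "b / norm (a j) \<le> exp (Re s)" using s exp_ge_add_one_self[of "Re s"] by linarith
      then have "b \<le> norm (a j * exp s)" using nz by (simp add: norm_mult divide_le_eq mult.commute)
      then have "norm (f (a j * exp s)) \<le> norm (a j) * exp (Re s)"
        using b[OF d(3)[OF j s(1)]] by (simp add: norm_mult)
      then have "norm (F s) \<le> exp (- Re s) * (norm (a j) * exp (Re s))"
        unfolding F_def norm_mult by (intro mult_mono) auto
      also have "\<dots> = norm (a j) * 1" by (simp add: exp_minus)
      also have "\<dots> \<le> norm (a j) * exp (Re s / 4)" using s by (intro mult_left_mono) auto
      finally show ?thesis .
    qed
    then show "\<exists>B X. \<forall>p\<in>slit d. X \<le> Re p \<longrightarrow> norm (F p) \<le> B * exp (Re p / 4)" by blast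
  qed (use d in auto)
  have "(\<lambda>p. exp (- of_nat (k - 1) * p) * F p) has_loop_integral
      loop_integral (\<lambda>p. exp (- of_nat (k - 1) * p) * F p)"
    using k by (intro has_loop_integralI[OF d(1)] has_loop_integral_moment) auto
  moreover have "exp (- of_nat (k - 1) * p) * F p = exp (- of_nat k * p) * f (a j * exp p)" for p
  proof -
    have "of_nat k = of_nat (k - 1) + (1 :: complex)" using k by (simp add: of_nat_diff)
    then have "- of_nat k * p = - of_nat (k - 1) * p + - p" by (simp add: algebra_simps)
    then show ?thesis unfolding F_def by (simp only: exp_add mult.assoc)
  qed
  ultimately show ?thesis unfolding loop_integrable_def by auto
qed

section \<open>The representation theorem\<close>

text \<open>\<open>f\<close> is defined outright by the transforms. Its power series is identified
  only near 0; the rest of the disc of convergence follows by analytic continuation inside the cut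
  plane.\<close>

lemma cauchy_representation:
  fixes a c :: "nat \<Rightarrow> complex"
  assumes a: "\<forall>j\<in>{1..N}. a j \<noteq> 0" "inj_on (\<lambda>j. Arg (a j)) {1..N}"
    and R: "0 < conv_radius c" "conv_radius c < \<infinity>"
    and LD: "\<And>j. j \<in> {1..N} \<Longrightarrow> loop_density d (F j)"
    and c: "\<And>k. 1 \<le> k \<Longrightarrow> c k = (\<Sum>j=1..N. inverse (a j ^ k) * loop_integral (\<lambda>p. exp (- of_nat k * p) * F j p))"
  shows "\<exists>f \<in> class_M' a N.
           (\<forall>z \<in> cut_plane a N \<inter> eball 0 (conv_radius c). (\<lambda>k. c k * z ^ k) sums f z) \<and>
           (\<forall>z \<in> cut_plane a N.
              loop_integrable
                (\<lambda>s. \<Sum>j=1..N. F j (Ln (1 + s)) / ((1 + s) * ((1 + s) * a j - z))) \<and>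
              f z = f 0 + z * loop_integral
                (\<lambda>s. \<Sum>j=1..N. F j (Ln (1 + s)) / ((1 + s) * ((1 + s) * a j - z)))) \<and>
           (\<forall>j\<in>{1..N}. \<exists>G r. r > 0 \<and> G analytic_on {0} \<and>
              (\<forall>z. norm z < r \<and> z \<notin> \<real>\<^sub>\<ge>\<^sub>0 \<longrightarrow>
                 f (a j * (z + 1)) = 2 * of_real pi * \<i> * F j (Ln (1 + z)) + G z))"
proof -
  let ?J = "{1..N}"
  define H where "H j = loop_density.cauchy_transform (F j)" for j
  define f where "f z = c 0 + (\<Sum>j\<in>?J. z / a j * H j (z / a j))" for z
  have nz: "a j \<noteq> 0" if "j \<in> ?J" for j using a that by auto
  have H_diff: "H j field_differentiable at w" if "j \<in> ?J" "w \<notin> cut1" for j w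
    unfolding H_def by (rule loop_density.cauchy_transform_differentiable[OF LD[OF that(1)] that(2)])
  have f0: "f 0 = c 0" by (simp add: f_def)

  have "f field_differentiable at z" if z: "z \<in> cut_plane a N" for z
  proof -
    have "(\<lambda>z. z / a j * H j (z / a j)) field_differentiable at z" if j: "j \<in> ?J" for j
    proof -
      have "z / a j \<notin> cut1" using z j by (simp add: cut_plane_iff[OF a(1)])
      from H_diff[OF j this]
      have "(H j \<circ> (\<lambda>z. z / a j)) field_differentiable at z"
        by (intro field_differentiable_compose) (auto intro!: derivative_intros simp: nz[OF j])
      then show ?thesis unfolding o_def
        by (intro field_differentiable_mult) (auto intro!: derivative_intros simp: nz[OF j])
    qed
    then show ?thesis unfolding f_def
      by (intro field_differentiable_add field_differentiable_const field_differentiable_sum) auto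
  qed
  then have f_hol: "f holomorphic_on cut_plane a N"
    by (auto simp: holomorphic_on_def intro: field_differentiable_at_within)

  have "\<forall>j\<in>?J. \<exists>C W. 0 \<le> C \<and> 1 \<le> W \<and>
      (\<forall>w. w \<notin> cut1 \<and> W \<le> norm w \<longrightarrow> norm (w * H j w) \<le> C * norm w powr (3/4))"
    unfolding H_def using loop_density.cauchy_transform_growth[OF LD] by metis
  then obtain C W where CW: "\<And>j. j \<in> ?J \<Longrightarrow> 0 \<le> C j \<and> (1 :: real) \<le> W j"
    "\<And>j w. j \<in> ?J \<Longrightarrow> w \<notin> cut1 \<Longrightarrow> W j \<le> norm w \<Longrightarrow> norm (w * H j w) \<le> C j * norm w powr (3/4)"
    by metis
  define K where "K = norm (c 0) + (\<Sum>j\<in>?J. C j * norm (a j) powr (- (3/4)))"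
  define X where "X = 1 + (\<Sum>j\<in>?J. W j * norm (a j))"
  have K0: "0 \<le> K" unfolding K_def using CW(1) by (intro add_nonneg_nonneg sum_nonneg mult_nonneg_nonneg) auto
  have W0: "0 \<le> W j * norm (a j)" if "j \<in> ?J" for j using CW(1)[OF that] by simp
  have X: "1 \<le> X" "\<And>j. j \<in> ?J \<Longrightarrow> W j * norm (a j) \<le> X"
  proof -
    have "0 \<le> (\<Sum>j\<in>?J. W j * norm (a j))" by (rule sum_nonneg) (rule W0)
    then show "1 \<le> X" by (simp add: X_def)
    show "W j * norm (a j) \<le> X" if "j \<in> ?J" for j
      unfolding X_def using member_le_sum[of j ?J "\<lambda>j. W j * norm (a j)"] that W0 by auto
  qed
  have growth: "norm (f z) \<le> K * norm z powr (3/4)" if z: "z \<in> cut_plane a N" "X \<le> norm z" for z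
  proof -
    have z1: "1 \<le> norm z" using z X by simp
    have "norm (z / a j * H j (z / a j)) \<le> C j * norm (a j) powr (- (3/4)) * norm z powr (3/4)" if j: "j \<in> ?J" for j
    proof -
      have "z / a j \<notin> cut1" using z j by (simp add: cut_plane_iff[OF a(1)])
      moreover have "W j \<le> norm (z / a j)"
        using order_trans[OF X(2)[OF j] z(2)] nz[OF j] by (simp add: norm_divide le_divide_eq)
      ultimately have "norm (z / a j * H j (z / a j)) \<le> C j * norm (z / a j) powr (3/4)" by (rule CW(2)[OF j])
      also have "norm (z / a j) powr (3/4) = norm (a j) powr (- (3/4)) * norm z powr (3/4)"
        by (simp add: norm_divide powr_divide powr_minus_divide)
      finally show ?thesis by simp
    qed
    then have "norm (\<Sum>j\<in>?J. z / a j * H j (z / a j)) \<le> (\<Sum>j\<in>?J. C j * norm (a j) powr (- (3/4)) * norm z powr (3/4))"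
      by (rule sum_norm_le)
    moreover have "norm (c 0) * 1 \<le> norm (c 0) * norm z powr (3/4)"
      using z1 by (intro mult_left_mono ge_one_powr_ge_zero) auto
    ultimately have "norm (f z) \<le> norm (c 0) * norm z powr (3/4) + (\<Sum>j\<in>?J. C j * norm (a j) powr (- (3/4)) * norm z powr (3/4))"
      unfolding f_def by (intro norm_triangle_le) simp
    then show ?thesis unfolding K_def by (simp only: distrib_right sum_distrib_right)
  qed
  have "f \<in> class_M a N"
    unfolding class_M_def mem_Collect_eq
  proof
    show "f analytic_on cut_plane a N" using f_hol by (simp add: analytic_on_open open_cut_plane[OF a(1)])
    have "norm (f z) \<le> K * norm z ^ 1" if z: "z \<in> cut_plane a N" "X \<le> norm z" for z
    proof -
      have "norm z powr (3/4) \<le> norm z powr 1" using z X by (intro powr_mono) auto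
      then have "K * norm z powr (3/4) \<le> K * norm z ^ 1" using K0 z X by (intro mult_left_mono) auto
      then show ?thesis using growth[OF z] by linarith
    qed
    then show "algebraically_bounded_on (cut_plane a N) f" unfolding algebraically_bounded_on_def by blast
  qed
  moreover have "f \<in> o[inf at_infinity (principal (cut_plane a N))](\<lambda>z. z)"
  proof (rule landau_o.smallI)
    fix b :: real assume b: "0 < b"
    have "((\<lambda>x. K * x powr (- (1/4))) \<longlongrightarrow> 0) at_top" by real_asymp
    then have "\<forall>\<^sub>F x in at_top. K * x powr (- (1/4)) < b" using b by (rule order_tendstoD)
    then obtain Y where Y: "\<And>x. Y \<le> x \<Longrightarrow> K * x powr (- (1/4)) < b" by (auto simp: eventually_at_top_linorder)
    have "norm (f z) \<le> b * norm z" if z: "z \<in> cut_plane a N" "max X Y \<le> norm z" for z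
    proof -
      have "norm (f z) \<le> K * norm z powr (3/4)" using growth z by simp
      also have "norm z powr (3/4) = norm z powr (- (1/4)) * norm z powr 1" unfolding powr_add[symmetric] by simp
      also have "K * (norm z powr (- (1/4)) * norm z powr 1) = (K * norm z powr (- (1/4))) * norm z" using z X by simp
      also have "\<dots> \<le> b * norm z" using Y[of "norm z"] z by (intro mult_right_mono) auto
      finally show ?thesis .
    qed
    then show "\<forall>\<^sub>F z in inf at_infinity (principal (cut_plane a N)). norm (f z) \<le> b * norm z"
      unfolding eventually_inf_principal eventually_at_infinity by blast
  qed
  ultimately have fM: "f \<in> class_M' a N" by (simp add: class_M'_def)

  obtain \<rho> where \<rho>: "conv_radius c = ereal \<rho>" "0 < \<rho>" using R by (cases "conv_radius c") auto
  define g where "g z = (\<Sum>k. c k * z ^ k)" for z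
  have g: "(\<lambda>k. c k * z ^ k) sums g z" if "z \<in> ball 0 \<rho>" for z
    unfolding g_def using that \<rho> by (intro summable_sums summable_in_conv_radius) auto
  have g_hol: "g holomorphic_on ball 0 \<rho>"
    by (rule power_series_holomorphic[of _ _ c]) (use g in auto)
  \<comment> \<open>Small enough for the geometric series of every \<open>j\<close>, which converges
    for \<open>norm (z / a j) < exp (- 1) / 2\<close>.\<close>
  define r where "r = Min (insert \<rho> ((\<lambda>j. norm (a j) * (exp (- 1) / 2)) ` ?J))"
  have r: "0 < r" "r \<le> \<rho>" "\<And>j. j \<in> ?J \<Longrightarrow> r \<le> norm (a j) * (exp (- 1) / 2)"
  proof -
    let ?M = "insert \<rho> ((\<lambda>j. norm (a j) * (exp (- 1) / 2)) ` ?J)"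
    have "\<forall>x\<in>?M. 0 < x" using nz \<rho> by auto
    then show "0 < r" unfolding r_def by (subst Min_gr_iff) auto
    show "r \<le> \<rho>" unfolding r_def by (rule Min_le) auto
    show "r \<le> norm (a j) * (exp (- 1) / 2)" if "j \<in> ?J" for j
      unfolding r_def by (rule Min_le) (use that in auto)
  qed
  have fg: "f z = g z" if z: "z \<in> ball 0 r" for z
  proof -
    have "(\<lambda>k. (z / a j) ^ Suc k * loop_integral (\<lambda>p. exp (- of_nat (Suc k) * p) * F j p)) sums (z / a j * H j (z / a j))"
      if j: "j \<in> ?J" for j
      unfolding H_def
    proof (rule loop_density.cauchy_transform_power_series[OF LD[OF j]])
      have "norm z < norm (a j) * (exp (- 1) / 2)" using r(3)[OF j] z by simp
      then show "norm (z / a j) < exp (- 1) / 2" using nz[OF j] by (simp add: norm_divide divide_less_eq mult.commute)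
    qed
    then have "(\<lambda>k. \<Sum>j\<in>?J. (z / a j) ^ Suc k * loop_integral (\<lambda>p. exp (- of_nat (Suc k) * p) * F j p)) sums
        (\<Sum>j\<in>?J. z / a j * H j (z / a j))" by (rule sums_sum)
    moreover have "(\<Sum>j\<in>?J. (z / a j) ^ Suc k * loop_integral (\<lambda>p. exp (- of_nat (Suc k) * p) * F j p)) = c (Suc k) * z ^ Suc k" for k
    proof -
      have "1 \<le> Suc k" by simp
      then show ?thesis
        by (subst c) (simp_all only: sum_distrib_left power_mult_distrib power_inverse divide_inverse mult_ac)
    qed
    ultimately have "(\<lambda>k. c (Suc k) * z ^ Suc k) sums (\<Sum>j\<in>?J. z / a j * H j (z / a j))" by simp
    then have "(\<lambda>k. c k * z ^ k) sums ((\<Sum>j\<in>?J. z / a j * H j (z / a j)) + c 0 * z ^ 0)" by (rule sums_Suc)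
    then have "(\<lambda>k. c k * z ^ k) sums f z" by (simp add: f_def add.commute)
    moreover have "(\<lambda>k. c k * z ^ k) sums g z" using z r by (intro g) auto
    ultimately show ?thesis by (rule sums_unique2)
  qed
  have sums: "(\<lambda>k. c k * z ^ k) sums f z" if z: "z \<in> cut_plane a N \<inter> eball 0 (conv_radius c)" for z
  proof -
    \<comment> \<open>The cut disc is starlike about 0, hence connected, and the identity theorem
      extends \<open>f = g\<close> from the small disc.\<close>
    let ?S = "cut_plane a N \<inter> ball 0 \<rho>"
    have op: "open ?S" using open_cut_plane[OF a(1)] by auto
    have zS: "0 \<in> ?S" using zero_in_cut_plane[OF a(1)] \<rho> by simp
    have "starlike ?S"
      unfolding starlike_def
    proof (intro bexI ballI)
      fix x assume x: "x \<in> ?S"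
      have "closed_segment 0 x \<subseteq> ball 0 \<rho>" using x \<rho> by (intro closed_segment_subset convex_ball) auto
      then show "closed_segment 0 x \<subseteq> ?S" using cut_plane_segment[OF a(1)] x by blast
    qed (rule zS)
    then have conn: "connected ?S" by (rule starlike_imp_connected)
    have "z \<in> ?S" using z \<rho> by auto
    have "f z = g z"
    proof (rule analytic_continuation_open[of "?S \<inter> ball 0 r" ?S f g z])
      show "open (?S \<inter> ball 0 r)" "open ?S" using op by auto
      show "?S \<inter> ball 0 r \<noteq> {}" using zS r by (auto intro!: exI[of _ 0])
      show "f holomorphic_on ?S" "g holomorphic_on ?S"
        using f_hol g_hol by (auto intro: holomorphic_on_subset)
    qed (use fg conn \<open>z \<in> ?S\<close> in auto)
    then show ?thesis using g[of z] \<open>z \<in> ?S\<close> by auto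
  qed

  have loop: "loop_integrable (\<lambda>s. \<Sum>j=1..N. F j (Ln (1 + s)) / ((1 + s) * ((1 + s) * a j - z))) \<and>
      f z = f 0 + z * loop_integral (\<lambda>s. \<Sum>j=1..N. F j (Ln (1 + s)) / ((1 + s) * ((1 + s) * a j - z)))"
    if z: "z \<in> cut_plane a N" for z
  proof -
    have "(\<lambda>s. F j (Ln (1 + s)) / ((1 + s) * ((1 + s) * a j - z))) has_loop_integral (1 / a j * H j (z / a j))"
      if j: "j \<in> ?J" for j
    proof -
      have "z / a j \<notin> cut1" using z j by (simp add: cut_plane_iff[OF a(1)])
      then have "(\<lambda>s. 1 / a j * (F j (Ln (1 + s)) / ((1 + s) * ((1 + s) - z / a j)))) has_loop_integral (1 / a j * H j (z / a j))"
        unfolding H_def by (intro has_loop_integral_cmult loop_density.cauchy_transform_exp_subst[OF LD[OF j]])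
      moreover have "1 / a j * (F j (Ln (1 + s)) / ((1 + s) * ((1 + s) - z / a j))) =
          F j (Ln (1 + s)) / ((1 + s) * ((1 + s) * a j - z))" for s
      proof -
        have "(1 + s) * a j - z = a j * ((1 + s) - z / a j)" using nz[OF j] by (simp add: right_diff_distrib mult.commute)
        then show ?thesis by (simp only: times_divide_times_eq mult_1_left mult_ac)
      qed
      ultimately show ?thesis by (simp only:)
    qed
    then have "(\<lambda>s. \<Sum>j\<in>?J. F j (Ln (1 + s)) / ((1 + s) * ((1 + s) * a j - z))) has_loop_integral (\<Sum>j\<in>?J. 1 / a j * H j (z / a j))"
      by (intro has_loop_integral_sum) auto
    moreover from this have "loop_integral (\<lambda>s. \<Sum>j\<in>?J. F j (Ln (1 + s)) / ((1 + s) * ((1 + s) * a j - z))) = (\<Sum>j\<in>?J. 1 / a j * H j (z / a j))"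
      by (rule loop_integral_eq)
    moreover have "z * (\<Sum>j\<in>?J. 1 / a j * H j (z / a j)) = (\<Sum>j\<in>?J. z / a j * H j (z / a j))"
      by (simp add: sum_distrib_left)
    ultimately show ?thesis unfolding loop_integrable_def f0 by (auto simp: f_def)
  qed

  have local: "\<exists>G r. r > 0 \<and> G analytic_on {0} \<and> (\<forall>z. norm z < r \<and> z \<notin> \<real>\<^sub>\<ge>\<^sub>0 \<longrightarrow>
      f (a j * (z + 1)) = 2 * of_real pi * \<i> * F j (Ln (1 + z)) + G z)" if j: "j \<in> ?J" for j
  proof -
    obtain s G where G: "0 < s" "G holomorphic_on ball 0 s"
      "\<And>z. norm z < s \<Longrightarrow> z \<notin> \<real>\<^sub>\<ge>\<^sub>0 \<Longrightarrow> (1 + z) * H j (1 + z) = 2 * of_real pi * \<i> * F j (Ln (1 + z)) + G z"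
      unfolding H_def using loop_density.cauchy_transform_local[OF LD[OF j]] by blast
    let ?w = "\<lambda>i z. a j * (z + 1) / a i"
    \<comment> \<open>Only the \<open>j\<close>-th summand contributes a singular part at
      \<open>a j\<close>: for \<open>i \<noteq> j\<close> the quotient \<open>a j / a i\<close> is
      not a positive real, so \<open>H i\<close> is analytic there.\<close>
    define G' where "G' z = c 0 + (G z + (\<Sum>i\<in>?J - {j}. ?w i z * H i (?w i z)))" for z
    have "(\<lambda>z. ?w i z * H i (?w i z)) analytic_on {0}" if i: "i \<in> ?J - {j}" for i
    proof -
      have nzi: "a i \<noteq> 0" using nz i by auto
      have w: "?w i analytic_on {0}" by (intro analytic_intros) (use nzi in auto)
      have "a j / a i \<notin> cut1"
      proof
        assume "a j / a i \<in> cut1"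
        then obtain t where t: "1 \<le> t" "a j / a i = of_real t" by (auto simp: cut1_def)
        then have "a j = of_real t * a i" using nzi by (simp add: field_simps)
        then show False using distinct_Arg_not_multiple[OF a, of i j t] i j t by auto
      qed
      moreover have "H i analytic_on (- cut1)"
        using H_diff i closed_cut1
        by (auto simp: analytic_on_open open_Compl holomorphic_on_def intro: field_differentiable_at_within)
      ultimately have "(H i \<circ> ?w i) analytic_on {0}"
        by (intro analytic_on_compose_gen[OF w]) auto
      then show ?thesis unfolding o_def by (intro analytic_on_mult w)
    qed
    moreover have "G analytic_on {0}"
      using G(1,2) by (intro analytic_on_subset[of G "ball 0 s" "{0}"]) (auto simp: analytic_on_open)
    ultimately have "G' analytic_on {0}"
      unfolding G'_def by (intro analytic_on_add analytic_on_const analytic_on_sum) auto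
    moreover have "f (a j * (z + 1)) = 2 * of_real pi * \<i> * F j (Ln (1 + z)) + G' z" if z: "norm z < s" "z \<notin> \<real>\<^sub>\<ge>\<^sub>0" for z
    proof -
      have "(\<Sum>i\<in>?J. ?w i z * H i (?w i z)) = ?w j z * H j (?w j z) + (\<Sum>i\<in>?J - {j}. ?w i z * H i (?w i z))"
        using j by (intro sum.remove) auto
      moreover have "?w j z = 1 + z" using nz[OF j] by simp
      ultimately show ?thesis unfolding f_def G'_def using G(3)[OF z] by simp
    qed
    ultimately show ?thesis using G(1) by blast
  qed
  show ?thesis using fM sums loop local by blast
qed

text \<open>For \<open>k = 1\<close> the condition \<open>f z = o(z)\<close> leaves integrands that
  tend to zero without a rate, and the single loop integrals need not converge, while the integral
  of their sum does. The converse is therefore stated with the sum under the integral for all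
  \<open>k \<ge> 1\<close>, and termwise under integrability, which holds from \<open>k = 2\<close>
  on. Values on the cuts are arbitrary, so the power series is compared with \<open>f\<close> inside
  the cut plane.\<close>

theorem theorem2p1:
  fixes N :: nat and a :: "nat \<Rightarrow> complex"
  assumes "N \<ge> 1"
    and "\<forall>j\<in>{1..N}. a j \<noteq> 0"
    and "inj_on (\<lambda>j. Arg (a j)) {1..N}"
  shows
    "(\<forall>(c :: nat \<Rightarrow> complex) (F :: nat \<Rightarrow> complex \<Rightarrow> complex) (\<delta> :: real).
        0 < conv_radius c \<and> conv_radius c < \<infinity> \<and> \<delta> > 0 \<and>
        (\<forall>j\<in>{1..N}. F j analytic_on (half_strip \<delta> - \<real>\<^sub>\<ge>\<^sub>0) \<and>
                    algebraically_bounded_on (half_strip \<delta> - \<real>\<^sub>\<ge>\<^sub>0) (F j)) \<and>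
        (\<forall>k\<ge>1. c k = (\<Sum>j=1..N. inverse (a j ^ k) *
                                loop_integral (\<lambda>p. exp (- of_nat k * p) * F j p)))
        \<longrightarrow>
        (\<exists>f \<in> class_M' a N.
           (\<forall>z \<in> cut_plane a N \<inter> eball 0 (conv_radius c). (\<lambda>k. c k * z ^ k) sums f z) \<and>
           (\<forall>z \<in> cut_plane a N.
              loop_integrable
                (\<lambda>s. \<Sum>j=1..N. F j (Ln (1 + s)) / ((1 + s) * ((1 + s) * a j - z))) \<and>
              f z = f 0 + z * loop_integral
                (\<lambda>s. \<Sum>j=1..N. F j (Ln (1 + s)) / ((1 + s) * ((1 + s) * a j - z)))) \<and>
           (\<forall>j\<in>{1..N}. \<exists>G r. r > 0 \<and> G analytic_on {0} \<and>
              (\<forall>z. norm z < r \<and> z \<notin> \<real>\<^sub>\<ge>\<^sub>0 \<longrightarrow>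
                 f (a j * (z + 1)) = 2 * of_real pi * \<i> * F j (Ln (1 + z)) + G z)))) \<and>
     (\<forall>f \<in> class_M' a N. \<forall>(n :: nat \<Rightarrow> nat) (t :: nat \<Rightarrow> nat \<Rightarrow> real).
        (\<forall>j\<in>{1..N}. n j \<ge> 1 \<and> t j 1 = 1 \<and> strict_mono_on {1..n j} (t j)) \<and>
        singularities a N f = {a j * of_real (t j l) |j l. j \<in> {1..N} \<and> l \<in> {1..n j}}
        \<longrightarrow>
        (\<forall>k\<ge>1.
           ((\<forall>j\<in>{1..N}. loop_integrable (\<lambda>s. exp (- of_nat k * s) * f (a j * exp s))) \<longrightarrow>
              (deriv ^^ k) f 0 / fact k =
                1 / (2 * of_real pi * \<i>) * (\<Sum>j=1..N. inverse (a j ^ k) *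
                   loop_integral (\<lambda>s. exp (- of_nat k * s) * f (a j * exp s)))) \<and>
           (k \<ge> 2 \<longrightarrow>
              (\<forall>j\<in>{1..N}. loop_integrable (\<lambda>s. exp (- of_nat k * s) * f (a j * exp s)))) \<and>
           loop_integrable
             (\<lambda>s. \<Sum>j=1..N. inverse (a j ^ k) * (exp (- of_nat k * s) * f (a j * exp s))) \<and>
           (deriv ^^ k) f 0 / fact k =
             1 / (2 * of_real pi * \<i>) * loop_integral
               (\<lambda>s. \<Sum>j=1..N. inverse (a j ^ k) * (exp (- of_nat k * s) * f (a j * exp s)))))"
proof -
  note a = assms
  have part1: "\<exists>f \<in> class_M' a N.
           (\<forall>z \<in> cut_plane a N \<inter> eball 0 (conv_radius c). (\<lambda>k. c k * z ^ k) sums f z) \<and>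
           (\<forall>z \<in> cut_plane a N.
              loop_integrable
                (\<lambda>s. \<Sum>j=1..N. F j (Ln (1 + s)) / ((1 + s) * ((1 + s) * a j - z))) \<and>
              f z = f 0 + z * loop_integral
                (\<lambda>s. \<Sum>j=1..N. F j (Ln (1 + s)) / ((1 + s) * ((1 + s) * a j - z)))) \<and>
           (\<forall>j\<in>{1..N}. \<exists>G r. r > 0 \<and> G analytic_on {0} \<and>
              (\<forall>z. norm z < r \<and> z \<notin> \<real>\<^sub>\<ge>\<^sub>0 \<longrightarrow>
                 f (a j * (z + 1)) = 2 * of_real pi * \<i> * F j (Ln (1 + z)) + G z))"
    if R: "0 < conv_radius c" "conv_radius c < \<infinity>" and \<delta>: "\<delta> > 0"
      and F: "\<And>j. j \<in> {1..N} \<Longrightarrow> F j analytic_on (half_strip \<delta> - \<real>\<^sub>\<ge>\<^sub>0)"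
        "\<And>j. j \<in> {1..N} \<Longrightarrow> algebraically_bounded_on (half_strip \<delta> - \<real>\<^sub>\<ge>\<^sub>0) (F j)"
      and c: "\<And>k. 1 \<le> k \<Longrightarrow> c k = (\<Sum>j=1..N. inverse (a j ^ k) *
                 loop_integral (\<lambda>p. exp (- of_nat k * p) * F j p))"
    for c :: "nat \<Rightarrow> complex" and F :: "nat \<Rightarrow> complex \<Rightarrow> complex" and \<delta> :: real
  proof (rule cauchy_representation[OF a(2,3) R _ c])
    define d where "d = min \<delta> 1"
    have sub: "slit d \<subseteq> half_strip \<delta> - \<real>\<^sub>\<ge>\<^sub>0"
      using slit_mono[of d \<delta>] slit_subset_half_strip[of \<delta>] by (auto simp: d_def)
    show "loop_density d (F j)" if j: "j \<in> {1..N}" for j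
    proof
      show "0 < d" "d \<le> 1" using \<delta> by (auto simp: d_def)
      then show "\<exists>B X. \<forall>p\<in>slit d. X \<le> Re p \<longrightarrow> norm (F j p) \<le> B * exp (Re p / 4)"
        by (intro algebraically_bounded_on_growth[OF F(2)[OF j] sub])
      show "F j holomorphic_on slit d"
        by (intro analytic_imp_holomorphic analytic_on_subset[OF F(1)[OF j] sub])
    qed
  qed
  have part2: "((\<forall>j\<in>{1..N}. loop_integrable (\<lambda>s. exp (- of_nat k * s) * f (a j * exp s))) \<longrightarrow>
              (deriv ^^ k) f 0 / fact k =
                1 / (2 * of_real pi * \<i>) * (\<Sum>j=1..N. inverse (a j ^ k) *
                   loop_integral (\<lambda>s. exp (- of_nat k * s) * f (a j * exp s)))) \<and>
           (k \<ge> 2 \<longrightarrow>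
              (\<forall>j\<in>{1..N}. loop_integrable (\<lambda>s. exp (- of_nat k * s) * f (a j * exp s)))) \<and>
           loop_integrable
             (\<lambda>s. \<Sum>j=1..N. inverse (a j ^ k) * (exp (- of_nat k * s) * f (a j * exp s))) \<and>
           (deriv ^^ k) f 0 / fact k =
             1 / (2 * of_real pi * \<i>) * loop_integral
               (\<lambda>s. \<Sum>j=1..N. inverse (a j ^ k) * (exp (- of_nat k * s) * f (a j * exp s)))"
    if f: "f \<in> class_M' a N" and k: "1 \<le> k" for f k
  proof (intro conjI impI ballI)
    let ?g = "\<lambda>j s. exp (- of_nat k * s) * f (a j * exp s)"
    note S = sum_log_loop_integrals[OF a f k]
    then show "loop_integrable (\<lambda>s. \<Sum>j=1..N. inverse (a j ^ k) * ?g j s)"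
      unfolding loop_integrable_def by blast
    show "(deriv ^^ k) f 0 / fact k = 1 / (2 * of_real pi * \<i>) * loop_integral (\<lambda>s. \<Sum>j=1..N. inverse (a j ^ k) * ?g j s)"
      unfolding loop_integral_eq[OF S] by simp
    show "loop_integrable (?g j)" if "2 \<le> k" "j \<in> {1..N}" for j
      by (rule log_loop_integrable[OF a(2,3) f that])
    assume int: "\<forall>j\<in>{1..N}. loop_integrable (?g j)"
    have "(\<lambda>s. \<Sum>j=1..N. inverse (a j ^ k) * ?g j s) has_loop_integral (\<Sum>j=1..N. inverse (a j ^ k) * loop_integral (?g j))"
    proof (intro has_loop_integral_sum has_loop_integral_cmult)
      fix j assume "j \<in> {1..N}"
      then obtain I where "?g j has_loop_integral I" using int unfolding loop_integrable_def by blast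
      then show "?g j has_loop_integral loop_integral (?g j)" using loop_integral_eq by metis
    qed simp
    note eq = has_loop_integral_unique[OF S this]
    show "(deriv ^^ k) f 0 / fact k = 1 / (2 * of_real pi * \<i>) * (\<Sum>j=1..N. inverse (a j ^ k) * loop_integral (?g j))"
      unfolding eq[symmetric] by simp
  qed
  show ?thesis
  proof (rule conjI, goal_cases)
    case 1
    show ?case
    proof (intro allI impI, elim conjE, goal_cases)
      case (1 c F \<delta>)
      show ?case by (rule part1[of c \<delta> F]) (use 1 in blast)+
    qed
  next
    case 2
    show ?case by (intro ballI allI impI, rule part2)
  qed
qed

end
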